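(* Let $a,b,c,d,p,q\in\mathbb{R}$. Then the invariance equation \[ S_{p,q}\big(S_{a,b}(x,y),S_{c,d}(x,y)\big)=S_{p,q}(x,y)\qquad\text{for all }x,y\in\mathbb{R}_+ \] is valid if and only if one of the following possibilities holds: (i) $a+b=c+d=p+q=0$, i.e., all three means are equal to the geometric mean; (ii) $\{a,b\}=\{c,d\}=\{p,q\}$, i.e., all three means are equal to each other; (iii) $\{a,b\}=\{-c,-d\}$ and $p+q=0$, i.e., $S_{p,q}$ is the geometric mean and $S_{a,b}=S_{-c,-d}$.
   Context: $\mathbb{R}_+$ denotes the set of positive real numbers. For $p,q\in\mathbb{R}$, the two-variable Stolarsky mean $S_{p,q}:\mathbb{R}_+^2\to\mathbb{R}_+$ is defined as follows. If $x=y$, then $S_{p,q}(x,y)=x$. If $x\neq y$, then \[ S_{p,q}(x,y)=\begin{cases} \left(\dfrac{q(x^p-y^p)}{p(x^q-y^q)}\right)^{\frac1{p-q}} & \text{if } (p-q)pq\neq 0,\\[3mm] \exp\left(-\dfrac1p+\dfrac{x^p\log x-y^p\log y}{x^p-y^p}\right) & \text{if } p=q\neq 0,\\[3mm] \left(\dfrac{x^p-y^p}{p(\log x-\log y)}\right)^{\frac1p} & \text{if } p\neq 0,\ q=0,\\[3mm] \left(\dfrac{q(\log x-\log y)}{x^q-y^q}\right)^{-\frac1q} & \text{if } p=0,\ q\neq 0,\\[3mm] \sqrt{xy} & \text{if } p=q=0. \end{cases} \] Equalities such as $\{a,b\}=\{c,d\}$ are equalities of (unordered) sets. *)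

theory Defs
  imports "HOL-Analysis.Analysis"
begin

(* The Stolarsky mean, meant for x, y > 0. All powr bases are then positive
   (see stolarsky_base_pos), so powr is the usual real power. *)
definition stolarsky :: "real \<Rightarrow> real \<Rightarrow> real \<Rightarrow> real \<Rightarrow> real" where
  "stolarsky p q x y =
    (if x = y then x
     else if (p - q) * p * q \<noteq> 0 then
       ((q * (x powr p - y powr p)) / (p * (x powr q - y powr q))) powr (1 / (p - q))
     else if p = q \<and> p \<noteq> 0 then
       exp (- (1 / p) + (x powr p * ln x - y powr p * ln y) / (x powr p - y powr p))
     else if p \<noteq> 0 \<and> q = 0 then
       ((x powr p - y powr p) / (p * (ln x - ln y))) powr (1 / p)
     else if p = 0 \<and> q \<noteq> 0 then
       ((q * (ln x - ln y)) / (x powr q - y powr q)) powr (- (1 / q))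
     else sqrt (x * y))"

lemma powr_diff_div_pos:
  fixes x y p :: real
  assumes "x > 0" "y > 0" "x \<noteq> y" "p \<noteq> 0"
  shows "(x powr p - y powr p) / (p * (ln x - ln y)) > 0"
proof -
  have "p * ln x \<noteq> p * ln y"
    using assms by simp
  moreover have "x powr p = exp (p * ln x)" "y powr p = exp (p * ln y)"
    using assms by (simp_all add: powr_def)
  ultimately have "(x powr p - y powr p) / (p * ln x - p * ln y) > 0"
    by (cases "p * ln x" "p * ln y" rule: linorder_cases) (simp_all add: zero_less_divide_iff)
  then show ?thesis
    by (simp add: right_diff_distrib)
qed

lemma stolarsky_base_pos:
  fixes x y p q :: real
  assumes "x > 0" "y > 0" "x \<noteq> y"
  shows "p \<noteq> 0 \<Longrightarrow> q \<noteq> 0 \<Longrightarrow> (q * (x powr p - y powr p)) / (p * (x powr q - y powr q)) > 0"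
    and "p \<noteq> 0 \<Longrightarrow> (x powr p - y powr p) / (p * (ln x - ln y)) > 0"
    and "q \<noteq> 0 \<Longrightarrow> (q * (ln x - ln y)) / (x powr q - y powr q) > 0"
proof -
  have ln: "ln x - ln y \<noteq> 0" using assms by auto
  show 2: "(x powr p - y powr p) / (p * (ln x - ln y)) > 0" if "p \<noteq> 0" for p
    using powr_diff_div_pos[OF assms that] .
  have "(q * (ln x - ln y)) / (x powr q - y powr q)
      = inverse ((x powr q - y powr q) / (q * (ln x - ln y)))"
    by (simp add: inverse_eq_divide)
  with 2[of q] show "(q * (ln x - ln y)) / (x powr q - y powr q) > 0" if "q \<noteq> 0"
    using that by (metis positive_imp_inverse_positive)
  have "(q * (x powr p - y powr p)) / (p * (x powr q - y powr q))
      = ((x powr p - y powr p) / (p * (ln x - ln y)))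
        / ((x powr q - y powr q) / (q * (ln x - ln y)))"
    using ln by (simp add: divide_simps)
  with 2[of p] 2[of q] show "(q * (x powr p - y powr p)) / (p * (x powr q - y powr q)) > 0"
    if "p \<noteq> 0" "q \<noteq> 0"
    using that by (metis divide_pos_pos)
qed

lemma stolarsky_pos:
  assumes "x > 0" "y > 0"
  shows "stolarsky p q x y > 0"
proof -
  have "x powr r \<noteq> y powr r" if "x \<noteq> y" "r \<noteq> 0" for r
    using stolarsky_base_pos(2)[OF assms that] by auto
  then show ?thesis
    using assms by (auto simp: stolarsky_def)
qed

lemma stolarsky_geometric:
  assumes "x > 0" "y > 0"
  shows "stolarsky p (- p) x y = sqrt (x * y)"
proof (cases "x = y \<or> p = 0")
  case True
  then show ?thesis using assms by (auto simp: stolarsky_def)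
next
  case False
  then have ne: "x powr p \<noteq> y powr p"
    using stolarsky_base_pos(2)[OF assms, of p] by auto
  have "((- p) * (x powr p - y powr p)) / (p * (x powr (- p) - y powr (- p)))
      = (x * y) powr p"
    using False assms ne by (simp add: powr_minus powr_mult field_simps)
  then show ?thesis
    using False assms by (simp add: stolarsky_def powr_powr powr_half_sqrt)
qed

end

theory Submission
  imports Defs "HOL-Complex_Analysis.Complex_Analysis" "HOL-Real_Asymp.Real_Asymp"
begin

text \<open>
  By homogeneity the equation concerns the even functions f(t) = ln S(exp t, exp (-t)), which are
  real analytic, so that it persists for imaginary arguments t = i s, up to the first singularity
  s = pi / m, where m is the largest modulus of an inner parameter. There the means behave like
  powers of the distance to the singularity, and a comparison of exponents, combined with the
  second order term at t = 0 (which gives a + b + c + d = 2 (p + q)), leaves few cases. If p and q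
  have opposite signs or one of them vanishes, the surviving cases are refuted by the asymptotic
  expansion at t = infinity, mostly by its leading exponentially small terms. If p and q are
  positive and the inner means have singularities at different points, then one side continues
  holomorphically through the first one. This forces p and q to be integer multiples of a - b, and
  the exponential terms at infinity again yield a contradiction. For p + q = 0 the outer mean is
  geometric, and the equation says that two Stolarsky means coincide, which is a special case of
  the case p + q ~= 0.
\<close>

subsection \<open>The logarithm of a Stolarsky mean\<close>

text \<open>The exponents come from the simple zero of sin at pi: at distance e from pi / |a|, a
  mean with parameters a and b, |b| < |a|, behaves like e to the power 1 / (a - b); for a = b its
  logarithm even has a simple pole. The singularity thus shows the parameter of larger modulus and
  the difference. Infinity shows the smaller parameter: for a, b > 0 the logarithm of the mean is t
  - \<open>mconst a b\<close> + \<open>mrest a b t\<close>, and the rest decays at the rate of the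
  smaller parameter. Neither source alone determines the parameters. The outer mean acts on growing
  arguments through its slope \<open>mslope p q\<close>. For q < 0 the slope is below 1, so the
  exponents of both inner means enter the comparison. For q = 0 it is 1, and a logarithmic
  correction has to be tracked. For q > 0 it is 1 and the outer mean stays within a bounded distance
  of its larger argument; if only one inner mean vanishes at the singularity, both sides remain
  bounded and the exponents say nothing. This obstacle is the reason for continuing one side
  holomorphically, where orders of zeros must be integers.\<close>

text \<open>
  \<open>hyp a b t\<close> is ln S(exp t, exp (-t)) for the Stolarsky mean S with parameters a and b, and
  \<open>trig a b s\<close> is its value at t = i s, meaningful for \<open>\<bar>a * s\<bar> < pi\<close> and \<open>\<bar>b * s\<bar> < pi\<close> only.
  \<open>gmean\<close> is the Stolarsky mean in logarithmic coordinates.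
\<close>

definition lsinh :: "real \<Rightarrow> real" where
  "lsinh x = ln (if x = 0 then 1 else sinh x / x)"

definition lsin :: "real \<Rightarrow> real" where
  "lsin x = ln (if x = 0 then 1 else sin x / x)"

definition hyp :: "real \<Rightarrow> real \<Rightarrow> real \<Rightarrow> real" where
  "hyp a b t = (if a \<noteq> b then (lsinh (a * t) - lsinh (b * t)) / (a - b)
     else if a * t = 0 then 0 else t * cosh (a * t) / sinh (a * t) - 1 / a)"

definition trig :: "real \<Rightarrow> real \<Rightarrow> real \<Rightarrow> real" where
  "trig a b t = (if a \<noteq> b then (lsin (a * t) - lsin (b * t)) / (a - b)
     else if a * t = 0 then 0 else t * cos (a * t) / sin (a * t) - 1 / a)"

definition gmean :: "real \<Rightarrow> real \<Rightarrow> real \<Rightarrow> real \<Rightarrow> real" where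
  "gmean p q u v = (u + v) / 2 + hyp p q ((u - v) / 2)"

lemma lsinh_0 [simp]: "lsinh 0 = 0" by (simp add: lsinh_def)

lemma lsinh_minus [simp]: "lsinh (- x) = lsinh x" by (simp add: lsinh_def)

lemma lsin_0 [simp]: "lsin 0 = 0" by (simp add: lsin_def)

lemma lsin_minus [simp]: "lsin (- x) = lsin x" by (simp add: lsin_def)

lemma lsinh_abs [simp]: "lsinh \<bar>x\<bar> = lsinh x"
  by (cases "x \<ge> 0") auto

lemma hyp_commute: "hyp a b t = hyp b a t"
  by (simp add: hyp_def minus_divide_right[symmetric] divide_simps) (simp add: algebra_simps)

lemma hyp_uminus: "hyp (- a) (- b) t = - hyp a b t"
  by (simp add: hyp_def divide_simps) (simp add: algebra_simps)

lemma trig_uminus: "trig (- a) (- b) t = - trig a b t"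
  by (simp add: trig_def divide_simps) (simp add: algebra_simps)

lemma hyp_even: "hyp a b (- t) = hyp a b t"
  by (simp add: hyp_def)

lemma hyp_opposite [simp]: "hyp a (- a) t = 0"
  by (simp add: hyp_def)

lemma hyp_0 [simp]: "hyp a b 0 = 0"
  by (simp add: hyp_def)

lemma gmean_uminus: "gmean (- p) (- q) (- u) (- v) = - gmean p q u v"
proof -
  have *: "(v - u) / 2 = - ((u - v) / 2)" by (simp add: field_simps)
  show ?thesis
    by (simp add: gmean_def hyp_uminus * hyp_even del: minus_divide_left) (simp add: field_simps)
qed

lemma gmean_swap: "gmean p q u v = gmean p q v u"
proof -
  have *: "(v - u) / 2 = - ((u - v) / 2)" by (simp add: field_simps)
  show ?thesis by (simp add: gmean_def * hyp_even add.commute del: minus_divide_left)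
qed

lemma gmean_add: "gmean p q (u + s) (v + s) = gmean p q u v + s"
  by (simp add: gmean_def field_simps)

lemma gmean_same [simp]: "gmean p q u u = u"
  by (simp add: gmean_def)

section \<open>Passage from powers to hyperbolic sines\<close>

lemma sinh_div_pos: "(x::real) \<noteq> 0 \<Longrightarrow> sinh x / x > 0"
  by (cases "x > 0") (auto simp: zero_less_divide_iff)

lemma exp_lsinh: "exp (lsinh x) = (if x = 0 then 1 else sinh x / x)"
  using sinh_div_pos[of x] by (simp add: lsinh_def)

lemma exp_mult_sinh: "2 * exp u * sinh v = exp (u + v) - exp (u - v)" for u v :: real
  by (simp add: sinh_field_def exp_add exp_diff exp_minus field_simps)

text \<open>With s and t the half sum and the half difference of the logarithms, the powers are exp
  (p * (s + t)) and exp (p * (s - t)).\<close>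

lemma powr_diff_eq_sinh:
  fixes x y p :: real
  assumes "x > 0" "y > 0"
  shows "x powr p - y powr p = 2 * exp (p * ((ln x + ln y) / 2)) * sinh (p * ((ln x - ln y) / 2))"
proof -
  have "x powr p = exp (p * ((ln x + ln y) / 2) + p * ((ln x - ln y) / 2))"
    "y powr p = exp (p * ((ln x + ln y) / 2) - p * ((ln x - ln y) / 2))"
    using assms by (simp_all add: powr_def field_simps)
  then show ?thesis
    unfolding exp_mult_sinh by simp
qed

lemma powr_diff_div_eq:
  fixes x y p :: real
  assumes "x > 0" "y > 0" "x \<noteq> y" "p \<noteq> 0"
  shows "(x powr p - y powr p) / (p * (ln x - ln y))
    = exp (p * ((ln x + ln y) / 2) + lsinh (p * ((ln x - ln y) / 2)))"
  using assms unfolding powr_diff_eq_sinh[OF assms(1,2)] exp_add exp_lsinh by (simp add: field_simps)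

lemma stolarsky_eq_gmean:
  assumes "x > 0" "y > 0"
  shows "stolarsky p q x y = exp (gmean p q (ln x) (ln y))"
proof (cases "x = y")
  case True
  then show ?thesis using assms by (simp add: stolarsky_def gmean_def)
next
  case False
  define s t where "s = (ln x + ln y) / 2" and "t = (ln x - ln y) / 2"
  have t: "t \<noteq> 0" using False assms by (simp add: t_def)
  have lnd: "ln x - ln y \<noteq> 0" using False assms by simp
  note E = powr_diff_div_eq[OF assms False, folded s_def t_def]
  consider "p \<noteq> q" "p \<noteq> 0" "q \<noteq> 0" | "p = q" "p \<noteq> 0" | "p \<noteq> 0" "q = 0" | "p = 0" "q \<noteq> 0" | "p = 0" "q = 0"
    by blast
  then show ?thesis
  proof cases
    case 1
    \<comment> \<open>Dividing numerator and denominator by ln x - ln y turns each of them into a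
      single exponential.\<close>
    have "(q * (x powr p - y powr p)) / (p * (x powr q - y powr q))
       = ((x powr p - y powr p) / (p * (ln x - ln y))) / ((x powr q - y powr q) / (q * (ln x - ln y)))"
      using lnd by (simp add: divide_simps)
    also have "\<dots> = exp ((p - q) * s + (lsinh (p * t) - lsinh (q * t)))"
      unfolding E[OF 1(2)] E[OF 1(3)] exp_diff[symmetric] by (simp add: algebra_simps)
    finally show ?thesis using 1 False
      by (simp add: stolarsky_def powr_def gmean_def hyp_def flip: s_def t_def) (simp add: field_simps)
  next
    case 2
    have lx: "ln x = s + t" "ln y = s - t" by (simp_all add: s_def t_def field_simps)
    have xy: "x powr p = exp (p * s) * exp (p * t)" "y powr p = exp (p * s) * exp (- (p * t))"
      using assms by (simp_all add: powr_def lx exp_add[symmetric] algebra_simps)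
    have "x powr p * ln x - y powr p * ln y = exp (p * s) * 2 * (s * sinh (p * t) + t * cosh (p * t))"
      unfolding xy lx by (simp add: sinh_field_def cosh_field_def field_simps)
    moreover have "x powr p - y powr p = exp (p * s) * 2 * sinh (p * t)"
      using powr_diff_eq_sinh[OF assms, folded s_def t_def] by simp
    ultimately have "(x powr p * ln x - y powr p * ln y) / (x powr p - y powr p)
       = (s * sinh (p * t) + t * cosh (p * t)) / sinh (p * t)"
      by simp
    also have "\<dots> = s + t * cosh (p * t) / sinh (p * t)"
      using 2 t by (simp add: field_simps)
    finally show ?thesis using 2 False t
      by (simp add: stolarsky_def gmean_def hyp_def flip: s_def t_def)
  next
    case 3
    then have "stolarsky p q x y = ((x powr p - y powr p) / (p * (ln x - ln y))) powr (1 / p)"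
      using False by (simp add: stolarsky_def)
    also have "\<dots> = exp ((p * s + lsinh (p * t)) / p)"
      unfolding E[OF 3(1)] by (simp add: powr_def)
    finally show ?thesis using 3 t
      by (simp add: gmean_def hyp_def flip: s_def t_def) (simp add: field_simps)
  next
    case 4
    have "q * (ln x - ln y) / (x powr q - y powr q) = inverse ((x powr q - y powr q) / (q * (ln x - ln y)))"
      by (simp add: field_simps)
    also have "\<dots> = exp (- (q * s + lsinh (q * t)))"
      unfolding E[OF 4(2)] by (simp only: exp_minus)
    finally have base: "q * (ln x - ln y) / (x powr q - y powr q) = exp (- (q * s + lsinh (q * t)))" .
    have "stolarsky p q x y = (q * (ln x - ln y) / (x powr q - y powr q)) powr (- (1 / q))"
      using False 4 by (simp add: stolarsky_def)
    also have "\<dots> = exp ((q * s + lsinh (q * t)) / q)"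
      unfolding base using 4(2) by (simp add: powr_def field_simps)
    finally show ?thesis using 4 t
      by (simp add: gmean_def hyp_def flip: s_def t_def) (simp add: field_simps)
  next
    case 5
    have "sqrt (x * y) = exp (ln (sqrt (x * y)))" using assms by simp
    also have "ln (sqrt (x * y)) = s" using assms by (simp add: ln_sqrt ln_mult s_def)
    finally show ?thesis using 5 False
      by (simp add: stolarsky_def gmean_def hyp_def flip: s_def t_def)
  qed
qed

text \<open>A common factor of x and y is a translation of the logarithms, which passes through all
  three means by \<open>gmean_add\<close>. Hence the pairs (exp t, exp (-t)) represent all
  pairs.\<close>

lemma invariance_iff:
  "(\<forall>x y. x > 0 \<longrightarrow> y > 0 \<longrightarrow>
      stolarsky p q (stolarsky a b x y) (stolarsky c d x y) = stolarsky p q x y)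
   \<longleftrightarrow> (\<forall>t. gmean p q (hyp a b t) (hyp c d t) = hyp p q t)"
proof
  assume L: "\<forall>x y. x > 0 \<longrightarrow> y > 0 \<longrightarrow>
      stolarsky p q (stolarsky a b x y) (stolarsky c d x y) = stolarsky p q x y"
  show "\<forall>t. gmean p q (hyp a b t) (hyp c d t) = hyp p q t"
  proof
    fix t :: real
    have *: "stolarsky r s (exp t) (exp (- t)) = exp (hyp r s t)" for r s
      by (simp add: stolarsky_eq_gmean gmean_def)
    have "stolarsky p q (exp (hyp a b t)) (exp (hyp c d t)) = exp (hyp p q t)"
      using L[rule_format, of "exp t" "exp (- t)"] by (simp add: *)
    then show "gmean p q (hyp a b t) (hyp c d t) = hyp p q t"
      by (simp add: stolarsky_eq_gmean)
  qed
next
  assume R: "\<forall>t. gmean p q (hyp a b t) (hyp c d t) = hyp p q t"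
  have "stolarsky p q (stolarsky a b x y) (stolarsky c d x y) = stolarsky p q x y"
    if "x > 0" "y > 0" for x y
  proof -
    have "gmean p q (gmean a b (ln x) (ln y)) (gmean c d (ln x) (ln y)) = gmean p q (ln x) (ln y)"
      using R[rule_format, of "(ln x - ln y) / 2"]
        gmean_add[of p q "hyp a b ((ln x - ln y) / 2)" "(ln x + ln y) / 2" "hyp c d ((ln x - ln y) / 2)"]
      by (simp add: gmean_def[of a b] gmean_def[of c d] gmean_def[of p q "ln x"] add.commute)
    then show ?thesis using that by (simp add: stolarsky_eq_gmean)
  qed
  then show "\<forall>x y. x > 0 \<longrightarrow> y > 0 \<longrightarrow>
      stolarsky p q (stolarsky a b x y) (stolarsky c d x y) = stolarsky p q x y"
    by blast
qed

subsection \<open>Analytic continuation to the imaginary axis\<close>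

definition sinhc :: "complex \<Rightarrow> complex" where
  "sinhc z = (if z = 0 then 1 else sinh z / z)"

text \<open>The value at a = b is the derivative of Ln (sinhc (a * z)) in a, the limit of the
  quotient. Written with \<open>deriv\<close> it is visibly holomorphic at z = 0, unlike the
  expression with coth in \<open>hyp\<close>.\<close>

definition chyp :: "real \<Rightarrow> real \<Rightarrow> complex \<Rightarrow> complex" where
  "chyp a b z = (if a \<noteq> b then (Ln (sinhc (a * z)) - Ln (sinhc (b * z))) / (a - b)
     else if a = 0 then 0 else z * deriv (\<lambda>w. Ln (sinhc w)) (a * z))"

lemma holomorphic_sinhc: "sinhc holomorphic_on UNIV"
proof -
  have D: "deriv sinh (0::complex) = 1"
    by (rule DERIV_imp_deriv) (auto intro!: derivative_eq_intros)
  have "sinh holomorphic_on (UNIV :: complex set)"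
    unfolding sinh_field_def by (intro holomorphic_intros) auto
  from pole_lemma_open[OF this, of 0] show ?thesis
    by (rule holomorphic_transform) (auto simp: sinhc_def D)
qed

text \<open>This makes the principal logarithm of \<open>sinhc\<close> holomorphic on the strip. A
  value -l with l >= 0 would mean sinh z = - l * z, but in the strip the imaginary part of sinh z
  has the sign of Im z; on the real line sinh x / x is positive.\<close>

lemma sinhc_nonpos:
  assumes "\<bar>Im z\<bar> < pi"
  shows "sinhc z \<notin> \<real>\<^sub>\<le>\<^sub>0"
proof
  assume "sinhc z \<in> \<real>\<^sub>\<le>\<^sub>0"
  then obtain l where l: "sinhc z = - of_real l" "l \<ge> 0"
    by (metis minus_minus neg_le_0_iff_le nonpos_Reals_cases of_real_minus)
  then have z: "z \<noteq> 0"
    by (auto simp: sinhc_def complex_eq_iff)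
  have eq: "sinh z = - of_real l * z"
    using l z by (simp add: sinhc_def field_simps)
  have im: "Im (sinh z) = cosh (Re z) * sin (Im z)" and re: "Re (sinh z) = sinh (Re z) * cos (Im z)"
    by (simp_all add: sinh_field_def cosh_field_def Im_exp Re_exp field_simps)
  have pos: "y > 0 \<Longrightarrow> y < pi \<Longrightarrow> cosh x * sin y > 0" for x y :: real
    by (simp add: sin_gt_zero)
  consider "Im z > 0" | "Im z < 0" | "Im z = 0" by linarith
  then show False
  proof cases
    case 1
    then have "Im (sinh z) > 0" using pos assms unfolding im by auto
    moreover have "Im (sinh z) \<le> 0" unfolding eq using 1 l by simp
    ultimately show False by simp
  next
    case 2
    then have "cosh (Re z) * sin (- Im z) > 0" using pos[of "- Im z"] assms by auto
    then have "Im (sinh z) < 0" unfolding im by simp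
    moreover have "Im (sinh z) \<ge> 0" unfolding eq using 2 l by (simp add: mult_nonneg_nonpos)
    ultimately show False by simp
  next
    case 3
    then have "sinh (Re z) = - l * Re z"
      using re unfolding eq by simp
    moreover have "Re z \<noteq> 0" using 3 z by (auto simp: complex_eq_iff)
    ultimately have "sinh (Re z) / Re z = - l" by (simp add: field_simps)
    then show False using sinh_div_pos[OF \<open>Re z \<noteq> 0\<close>] l by simp
  qed
qed

lemma holomorphic_Ln_sinhc: "(\<lambda>z. Ln (sinhc z)) holomorphic_on {z. \<bar>Im z\<bar> < pi}"
  by (intro holomorphic_on_Ln' holomorphic_on_subset[OF holomorphic_sinhc])
     (auto simp: sinhc_nonpos)

lemma open_strip: "open {z. \<bar>Im z\<bar> < r}"
proof -
  have "{z. \<bar>Im z\<bar> < r} = {z. Im z < r} \<inter> {z. Im z > - r}" by auto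
  then show ?thesis by (simp add: open_halfspace_Im_lt open_halfspace_Im_gt open_Int)
qed

lemma deriv_Ln_sinhc:
  assumes "\<bar>Im z\<bar> < pi" "z \<noteq> 0"
  shows "deriv (\<lambda>w. Ln (sinhc w)) z = cosh z / sinh z - 1 / z"
proof -
  have nz: "sinh z \<noteq> 0"
    using sinhc_nonpos[OF assms(1)] assms(2) by (auto simp: sinhc_def)
  have "(sinhc has_field_derivative (cosh z * z - sinh z) / z\<^sup>2) (at z)"
  proof (rule has_field_derivative_transform_within[where S = UNIV and d = "norm z"])
    show "((\<lambda>z. sinh z / z) has_field_derivative (cosh z * z - sinh z) / z\<^sup>2) (at z)"
      using assms(2) by (auto intro!: derivative_eq_intros simp: power2_eq_square)
    show "0 < norm z" using assms by simp
  qed (use assms(2) in \<open>auto simp: sinhc_def dist_norm\<close>)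
  then have "((\<lambda>w. Ln (sinhc w)) has_field_derivative inverse (sinhc z) * ((cosh z * z - sinh z) / z\<^sup>2)) (at z)"
    by (intro DERIV_chain2[OF has_field_derivative_Ln] sinhc_nonpos assms)
  moreover have "inverse (sinhc z) * ((cosh z * z - sinh z) / z\<^sup>2) = cosh z / sinh z - 1 / z"
    using nz assms(2) by (simp add: sinhc_def field_simps power2_eq_square)
  ultimately show ?thesis by (metis DERIV_imp_deriv)
qed

lemma holomorphic_chyp:
  assumes "f holomorphic_on S" "\<And>z. z \<in> S \<Longrightarrow> \<bar>a * Im (f z)\<bar> < pi" "\<And>z. z \<in> S \<Longrightarrow> \<bar>b * Im (f z)\<bar> < pi"
  shows "(\<lambda>z. chyp a b (f z)) holomorphic_on S"
proof -
  have L: "(\<lambda>z. Ln (sinhc (complex_of_real r * f z))) holomorphic_on S" if "r \<in> {a, b}" for r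
    by (rule holomorphic_on_compose_gen[OF _ holomorphic_Ln_sinhc, unfolded o_def])
       (use assms that in \<open>auto intro!: holomorphic_intros\<close>)
  have D: "(\<lambda>z. deriv (\<lambda>w. Ln (sinhc w)) (complex_of_real a * f z)) holomorphic_on S"
    by (rule holomorphic_on_compose_gen[OF _ holomorphic_deriv[OF holomorphic_Ln_sinhc open_strip], unfolded o_def])
       (use assms in \<open>auto intro!: holomorphic_intros\<close>)
  show ?thesis
    unfolding chyp_def using L[of a] L[of b] D assms(1)
    by (cases "a = b"; cases "a = 0") (auto intro!: holomorphic_intros)
qed

lemma sinh_complex_of_real: "sinh (complex_of_real x) = of_real (sinh x)"
  and cosh_complex_of_real: "cosh (complex_of_real x) = of_real (cosh x)"
  by (simp_all add: sinh_field_def cosh_field_def flip: exp_of_real)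

lemma sinhc_of_real: "sinhc (of_real x) = of_real (exp (lsinh x))"
  by (simp add: sinhc_def exp_lsinh sinh_complex_of_real)

lemma sin_div_pos: "x \<noteq> 0 \<Longrightarrow> \<bar>x\<bar> < pi \<Longrightarrow> sin x / x > 0" for x :: real
  using sin_gt_zero[of x] sin_gt_zero[of "- x"] by (cases "x > 0") (auto simp: zero_less_divide_iff)

lemma exp_lsin: "\<bar>x\<bar> < pi \<Longrightarrow> exp (lsin x) = (if x = 0 then 1 else sin x / x)"
  using sin_div_pos[of x] by (simp add: lsin_def)

lemma sinhc_imag: "\<bar>x\<bar> < pi \<Longrightarrow> sinhc (\<i> * of_real x) = of_real (exp (lsin x))"
  by (simp add: sinhc_def exp_lsin sinh_conv_sin sin_of_real mult.assoc[symmetric])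

lemma chyp_of_real: "chyp a b (of_real t) = of_real (hyp a b t)"
proof -
  have "Ln (sinhc (complex_of_real r * of_real t)) = of_real (lsinh (r * t))" for r
    using sinhc_of_real[of "r * t"] by (simp add: Ln_of_real)
  moreover have "complex_of_real t * deriv (\<lambda>w. Ln (sinhc w)) (of_real r * of_real t)
      = of_real (t * cosh (r * t) / sinh (r * t) - 1 / r)" if "r \<noteq> 0" "t \<noteq> 0" for r
    using that by (subst deriv_Ln_sinhc)
      (auto simp: field_simps sinh_complex_of_real cosh_complex_of_real simp flip: of_real_mult)
  ultimately show ?thesis by (auto simp: chyp_def hyp_def)
qed

lemma chyp_imag:
  assumes "\<bar>a * t\<bar> < pi" "\<bar>b * t\<bar> < pi"
  shows "chyp a b (\<i> * of_real t) = of_real (trig a b t)"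
proof -
  have "Ln (sinhc (complex_of_real r * (\<i> * of_real t))) = of_real (lsin (r * t))" if "\<bar>r * t\<bar> < pi" for r
    using sinhc_imag[of "r * t"] that by (simp add: Ln_of_real mult.left_commute)
  moreover have "\<i> * complex_of_real t * deriv (\<lambda>w. Ln (sinhc w)) (of_real r * (\<i> * of_real t))
      = of_real (t * cos (r * t) / sin (r * t) - 1 / r)" if "r \<noteq> 0" "t \<noteq> 0" "\<bar>r * t\<bar> < pi" for r
  proof -
    have e: "of_real r * (\<i> * of_real t) = \<i> * complex_of_real (r * t)" by simp
    have c: "cosh (\<i> * complex_of_real x) = of_real (cos x)" 
      and s: "sinh (\<i> * complex_of_real x) = \<i> * of_real (sin x)" for x
      by (simp_all add: cosh_conv_cos sinh_conv_sin cos_of_real sin_of_real mult.assoc[symmetric])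
    have n: "sin (r * t) \<noteq> 0" using sin_div_pos[of "r * t"] that by auto
    have "\<i> * T * (C / (\<i> * S) - 1 / (\<i> * (Q * T))) = T * C / S - 1 / Q"
      if "S \<noteq> 0" "Q \<noteq> 0" "T \<noteq> 0" for T C S Q :: complex
      using that by (simp add: field_simps)
    note * = this[of "of_real (sin (r * t))" "of_real r" "of_real t" "of_real (cos (r * t))"]
    show ?thesis unfolding e using that n *
      by (subst deriv_Ln_sinhc) (auto simp: c s simp flip: of_real_mult)
  qed
  ultimately show ?thesis using assms by (auto simp: chyp_def trig_def)
qed

lemma trig_identity:
  assumes eq: "\<And>t. gmean p q (hyp a b t) (hyp c d t) = hyp p q t"
    and s: "\<And>r. r \<in> {a, b, c, d, p, q} \<Longrightarrow> \<bar>r\<bar> * s < pi" "s \<ge> 0"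
  shows "gmean p q (trig a b s) (trig c d s) = trig p q s"
proof -
  define M where "M = Max (abs ` {a, b, c, d, p, q})"
  have M: "\<bar>r\<bar> \<le> M" if "r \<in> {a, b, c, d, p, q}" for r
    unfolding M_def using that by (intro Max_ge) auto
  have "M \<in> abs ` {a, b, c, d, p, q}" unfolding M_def by (rule Max_in) auto
  then have Ms: "M * s < pi" using s by auto
  have M0: "M \<ge> 0" using M[of a] by simp
  define S where "S = {z. M * \<bar>Im z\<bar> < pi}"
  have oS: "open S"
    unfolding S_def by (intro open_Collect_less continuous_intros)
  have r: "\<bar>r * y\<bar> < pi" if "r \<in> {a, b, c, d, p, q}" "M * \<bar>y\<bar> < pi" for r y
    using mult_right_mono[OF M[OF that(1)], of "\<bar>y\<bar>"] that by (simp add: abs_mult)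
  define w where "w = (\<lambda>z. (chyp a b z - chyp c d z) / 2)"
  have hab: "chyp a b holomorphic_on S" and hcd: "chyp c d holomorphic_on S"
    and hpq: "chyp p q holomorphic_on S"
    by (rule holomorphic_chyp[of "\<lambda>z. z", simplified]; (rule r)?; force simp: S_def)+
  have hw: "w holomorphic_on S"
    unfolding w_def using hab hcd by (intro holomorphic_intros) auto
  \<comment> \<open>The outer mean is evaluated at w z, so holomorphy is known only where w z stays
    in the strip. This set may be disconnected, and the identity is continued within the component
    of 0.\<close>
  define Q where "Q = {z \<in> S. w z \<in> S}"
  have "open (S \<inter> w -` S)"
    using holomorphic_on_imp_continuous_on[OF hw] oS by (rule continuous_open_preimage) (rule oS)
  then have oQ: "open Q" by (simp add: Q_def Int_def vimage_def)
  define C where "C = connected_component_set Q 0"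
  define f where "f = (\<lambda>z. (chyp a b z + chyp c d z) / 2 + chyp p q (w z) - chyp p q z)"
  have wr: "w (of_real t) = of_real ((hyp a b t - hyp c d t) / 2)" for t
    by (simp add: w_def chyp_of_real)
  have wi: "w (\<i> * of_real t) = of_real ((trig a b t - trig c d t) / 2)" if "0 \<le> t" "t \<le> s" for t
  proof -
    have "M * \<bar>t\<bar> < pi" using that M0 Ms mult_left_mono[of t s M] by auto
    then show ?thesis using r[of _ t] by (simp add: w_def chyp_imag)
  qed
  \<comment> \<open>w takes real values on the real axis and on the imaginary segment, so both lie
    in Q, and both pass through 0.\<close>
  have real: "range complex_of_real \<subseteq> Q"
    by (auto simp: Q_def S_def wr)
  have imag: "(\<lambda>t. \<i> * complex_of_real t) ` {0..s} \<subseteq> Q"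
    using M0 Ms mult_left_mono[of _ s M] by (fastforce simp: Q_def S_def wi)
  have con1: "connected (range complex_of_real)"
    by (intro connected_continuous_image continuous_intros) auto
  have con2: "connected ((\<lambda>t. \<i> * complex_of_real t) ` {0..s})"
    by (intro connected_continuous_image continuous_intros) auto
  have sub: "range complex_of_real \<subseteq> C" "(\<lambda>t. \<i> * complex_of_real t) ` {0..s} \<subseteq> C"
    unfolding C_def using con1 con2 real imag s(2)
    by (intro connected_component_maximal; force intro: image_eqI[of _ _ 0])+
  have hol: "f holomorphic_on Q"
    unfolding f_def
    by (intro holomorphic_intros holomorphic_on_compose_gen[OF _ hpq, unfolded o_def])
       (use holomorphic_on_subset[OF hab] holomorphic_on_subset[OF hcd] holomorphic_on_subset[OF hpq]
            holomorphic_on_subset[OF hw] in \<open>auto simp: Q_def\<close>)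
  have C: "C \<subseteq> Q" by (simp add: C_def connected_component_subset)
  have "f (\<i> * of_real s) = 0"
  proof (rule analytic_continuation[of f C "range complex_of_real" 0])
    show "f holomorphic_on C" using hol C by (rule holomorphic_on_subset)
    show "open C" "connected C" using oQ by (auto simp: C_def open_connected_component)
    show "range complex_of_real \<subseteq> C" by (fact sub)
    show "0 \<in> C" using sub(1) by auto
    show "0 islimpt range complex_of_real"
      unfolding islimpt_approachable
    proof (intro allI impI)
      fix e :: real assume "e > 0"
      then show "\<exists>x'\<in>range complex_of_real. x' \<noteq> 0 \<and> dist x' 0 < e"
        by (intro bexI[of _ "of_real (e / 2)"] rangeI) auto
    qed
    show "f z = 0" if "z \<in> range complex_of_real" for z
    proof -
      from that obtain t where t: "z = of_real t" by auto
      have "f z = of_real (gmean p q (hyp a b t) (hyp c d t) - hyp p q t)"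
        by (simp add: f_def t wr chyp_of_real gmean_def del: of_real_divide of_real_diff) simp
      then show ?thesis using eq by simp
    qed
    show "\<i> * of_real s \<in> C" using sub(2) s(2) by auto
  qed
  moreover have "f (\<i> * of_real s) = of_real (gmean p q (trig a b s) (trig c d s) - trig p q s)"
  proof -
    have "chyp p q (w (\<i> * of_real s)) = of_real (hyp p q ((trig a b s - trig c d s) / 2))"
      by (simp only: wi[OF s(2) order_refl] chyp_of_real)
    moreover have "M * \<bar>s\<bar> < pi" using Ms s(2) by simp
    ultimately show ?thesis
      using r[of _ s] by (simp add: f_def chyp_imag gmean_def del: of_real_divide of_real_diff) simp
  qed
  ultimately show ?thesis by simp
qed

subsection \<open>Asymptotic behaviour\<close>

lemma isCont_trig:
  assumes "\<bar>a * s\<bar> < pi" "\<bar>b * s\<bar> < pi"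
  shows "isCont (trig a b) s"
proof -
  define S where "S = {t. \<bar>a * t\<bar> < pi \<and> \<bar>b * t\<bar> < pi}"
  have oS: "open S"
    unfolding S_def by (intro open_Collect_conj open_Collect_less continuous_intros)
  define T where "T = {z. \<bar>a * Im z\<bar> < pi \<and> \<bar>b * Im z\<bar> < pi}"
  have "chyp a b holomorphic_on T"
    by (rule holomorphic_chyp[of "\<lambda>z. z", simplified]) (auto simp: T_def)
  then have "continuous_on T (chyp a b)"
    by (rule holomorphic_on_imp_continuous_on)
  then have "continuous_on S (\<lambda>t. chyp a b (\<i> * of_real t))"
    by (rule continuous_on_compose2) (auto simp: S_def T_def intro!: continuous_intros)
  then have "continuous_on S (\<lambda>t. Re (chyp a b (\<i> * of_real t)))"
    by (rule continuous_on_Re)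
  also have "?this \<longleftrightarrow> continuous_on S (trig a b)"
    by (intro continuous_on_cong refl) (auto simp: S_def chyp_imag)
  finally show ?thesis
    using oS assms by (simp add: continuous_on_eq_continuous_at S_def)
qed

lemma isCont_lsin:
  assumes "\<bar>x\<bar> < pi"
  shows "isCont lsin x"
proof -
  have "lsin = trig 1 0" by (simp add: fun_eq_iff trig_def)
  then show ?thesis using isCont_trig[of 1 x 0] assms by simp
qed

lemma tendsto_left_shift:
  fixes f :: "real \<Rightarrow> real"
  assumes "isCont f s"
  shows "((\<lambda>e. f (s - e)) \<longlongrightarrow> f s) (at_right 0)"
proof -
  have "((\<lambda>e. s - e) \<longlongrightarrow> s) (at_right 0)"
    by (auto intro!: tendsto_eq_intros)
  then show ?thesis by (rule isCont_tendsto_compose[OF assms])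
qed

section \<open>Behaviour at the first imaginary singularity\<close>

lemma lsin_singular:
  assumes "A > 0"
  shows "((\<lambda>e. lsin (A * (pi / A - e)) / ln e) \<longlongrightarrow> 1) (at_right 0)"
proof -
  have "((\<lambda>e. ln (sin (A * e) / (pi - A * e)) / ln e) \<longlongrightarrow> 1) (at_right 0)"
    using assms by real_asymp
  then show ?thesis
  proof (rule Lim_transform_eventually)
    have "eventually (\<lambda>e. e \<in> {0<..<pi / A}) (at_right 0)"
      using assms by (intro eventually_at_right_real) auto
    then show "\<forall>\<^sub>F e in at_right 0. ln (sin (A * e) / (pi - A * e)) / ln e = lsin (A * (pi / A - e)) / ln e"
    proof eventually_elim
      case (elim e)
      have "A * (pi / A - e) = pi - A * e" using assms by (simp add: field_simps)
      moreover have "A * e < pi" using elim assms by (simp add: field_simps)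
      ultimately show ?case by (simp add: lsin_def)
    qed
  qed
qed

lemma bounded_div_ln:
  assumes "(f \<longlongrightarrow> (L::real)) (at_right 0)"
  shows "((\<lambda>e. f e / ln e) \<longlongrightarrow> 0) (at_right 0)"
proof -
  have "filterlim (\<lambda>e::real. ln e) at_infinity (at_right 0)"
    using ln_at_0 by (rule filterlim_mono) (auto simp: at_bot_le_at_infinity)
  from tendsto_divide_0[OF assms this] show ?thesis .
qed

text \<open>Only the term with the parameter of larger modulus is singular at pi / |a|; the other
  one stays bounded and disappears after division by ln e.\<close>

lemma trig_singular_log:
  assumes "\<bar>b\<bar> < \<bar>a\<bar>"
  shows "((\<lambda>e. trig a b (pi / \<bar>a\<bar> - e) / ln e) \<longlongrightarrow> 1 / (a - b)) (at_right 0)"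
proof -
  have a: "\<bar>a\<bar> > 0" using assms by simp
  have "\<bar>b * (pi / \<bar>a\<bar>)\<bar> < pi" using assms by (simp add: abs_mult field_simps)
  then have "isCont (\<lambda>s. lsin (b * s)) (pi / \<bar>a\<bar>)"
    by (rule isCont_o2[OF continuous_mult_left[OF continuous_ident] isCont_lsin])
  from bounded_div_ln[OF tendsto_left_shift[OF this]]
  have "((\<lambda>e. (lsin (\<bar>a\<bar> * (pi / \<bar>a\<bar> - e)) / ln e - lsin (b * (pi / \<bar>a\<bar> - e)) / ln e) / (a - b)) \<longlongrightarrow> (1 - 0) / (a - b)) (at_right 0)"
    using assms by (intro tendsto_intros lsin_singular a) auto
  moreover have "lsin (\<bar>a\<bar> * s) = lsin (a * s)" for s
    by (cases "a \<ge> 0") auto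
  moreover have "(lsin (\<bar>a\<bar> * s) / ln e - lsin (b * s) / ln e) / (a - b) = trig a b s / ln e" for s e
    using assms \<open>\<And>s. lsin (\<bar>a\<bar> * s) = lsin (a * s)\<close>
    by (auto simp: trig_def diff_divide_distrib mult.commute)
  ultimately show ?thesis by simp
qed

text \<open>For equal parameters the logarithm is replaced by its derivative in the parameter, which
  turns the logarithmic singularity into a simple pole.\<close>

lemma trig_singular_pole:
  assumes "a \<noteq> 0"
  shows "((\<lambda>e. trig a a (pi / \<bar>a\<bar> - e) * e) \<longlongrightarrow> - (pi / (a * \<bar>a\<bar>))) (at_right 0)"
proof -
  have pos: "((\<lambda>e. trig a a (pi / a - e) * e) \<longlongrightarrow> - (pi / a ^ 2)) (at_right 0)" if a: "a > 0" for a
  proof -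
    have "((\<lambda>e. ((pi / a - e) * (- cos (a * e)) / sin (a * e) - 1 / a) * e) \<longlongrightarrow> - (pi / a ^ 2)) (at_right 0)"
      using a by (real_asymp simp: power2_eq_square field_simps)
    then show ?thesis
    proof (rule Lim_transform_eventually)
      have "eventually (\<lambda>e. e \<in> {0<..<pi / a}) (at_right 0)"
        using a by (intro eventually_at_right_real) auto
      then show "\<forall>\<^sub>F e in at_right 0. ((pi / a - e) * (- cos (a * e)) / sin (a * e) - 1 / a) * e = trig a a (pi / a - e) * e"
      proof eventually_elim
        case (elim e)
        have "a * (pi / a - e) = pi - a * e" using a by (simp add: field_simps)
        moreover have "a * e < pi" using elim a by (simp add: field_simps)
        ultimately show ?case using a by (simp add: trig_def)
      qed
    qed
  qed
  show ?thesis
  proof (cases "a > 0")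
    case True
    then show ?thesis using pos by (simp add: power2_eq_square)
  next
    case False
    then have "((\<lambda>e. - (trig (- a) (- a) (pi / (- a) - e) * e)) \<longlongrightarrow> pi / a ^ 2) (at_right 0)"
      using assms tendsto_minus[OF pos[of "- a"]] by simp
    then show ?thesis using False assms by (simp add: trig_uminus power2_eq_square)
  qed
qed

section \<open>Exponential remainders at infinity\<close>

lemma lsinh_pos_eq: "x > 0 \<Longrightarrow> lsinh x = x - ln (2 * x) + ln (1 - exp (- 2 * x))"
proof -
  assume x: "x > 0"
  have "sinh x / x = exp x * (1 - exp (- 2 * x)) / (2 * x)"
  proof -
    have "exp x * (1 - exp (- 2 * x)) = 2 * sinh x"
      by (simp add: sinh_field_def right_diff_distrib flip: exp_add)
    then show ?thesis by simp
  qed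
  moreover have "1 - exp (- 2 * x) > 0" using x by simp
  ultimately show ?thesis using x
    by (simp add: lsinh_def ln_mult ln_div)
qed

text \<open>For positive a and b this is the reciprocal of their logarithmic mean.\<close>

definition mconst :: "real \<Rightarrow> real \<Rightarrow> real" where
  "mconst a b = (if a = b then 1 / a else (ln a - ln b) / (a - b))"

text \<open>A divided difference in the parameter of ln (1 - exp (- 2 * a * t)); the value at a = b
  is the derivative.\<close>

definition mrest :: "real \<Rightarrow> real \<Rightarrow> real \<Rightarrow> real" where
  "mrest a b t = (if a = b then 2 * t * exp (- 2 * a * t) / (1 - exp (- 2 * a * t))
     else (ln (1 - exp (- 2 * a * t)) - ln (1 - exp (- 2 * b * t))) / (a - b))"

lemma mrest_commute: "mrest a b t = mrest b a t"
  by (simp add: mrest_def divide_simps) (simp add: algebra_simps)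

lemma mconst_pos: "a > 0 \<Longrightarrow> b > 0 \<Longrightarrow> mconst a b > 0"
  by (cases a b rule: linorder_cases) (auto simp: mconst_def zero_less_divide_iff)

lemma hyp_eq_mrest:
  assumes "a > 0" "b > 0" "t > 0"
  shows "hyp a b t = t - mconst a b + mrest a b t"
proof (cases "a = b")
  case True
  have "exp (- 2 * a * t) < 1" using assms by simp
  moreover have "cosh (a * t) / sinh (a * t) = (1 + exp (- 2 * a * t)) / (1 - exp (- 2 * a * t))"
  proof -
    have "cosh (a * t) = exp (a * t) / 2 * (1 + exp (- 2 * a * t))"
      "sinh (a * t) = exp (a * t) / 2 * (1 - exp (- 2 * a * t))"
      by (simp_all add: sinh_field_def cosh_field_def ring_distribs add_divide_distrib diff_divide_distrib flip: exp_add)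
    then show ?thesis by (simp only: mult_divide_mult_cancel_left) simp
  qed
  then have "t * cosh (a * t) / sinh (a * t) = t * ((1 + exp (- 2 * a * t)) / (1 - exp (- 2 * a * t)))"
    by (metis times_divide_eq_right)
  moreover have "t * ((1 + e) / (1 - e)) = t + 2 * t * e / (1 - e)" if "e < 1" for e :: real
    using that by (simp add: field_simps)
  ultimately show ?thesis using True assms
    by (simp add: hyp_def mconst_def mrest_def)
next
  case False
  have "lsinh (a * t) - lsinh (b * t) = (a - b) * t - (ln a - ln b) + (ln (1 - exp (- 2 * a * t)) - ln (1 - exp (- 2 * b * t)))"
    using assms by (simp add: lsinh_pos_eq ln_mult algebra_simps)
  then show ?thesis using False
    by (simp add: hyp_def mconst_def mrest_def add_divide_distrib diff_divide_distrib)
qed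

lemma mrest_pos:
  assumes "a > 0" "b > 0" "t > 0"
  shows "mrest a b t > 0"
proof -
  have "x < y \<Longrightarrow> x > 0 \<Longrightarrow> ln (1 - exp (- 2 * x * t)) < ln (1 - exp (- 2 * y * t))" for x y
    using assms(3) by (subst ln_less_cancel_iff) auto
  from this[of a b] this[of b a] show ?thesis using assms
    by (cases a b rule: linorder_cases) (auto simp: zero_less_divide_iff mrest_def)
qed

text \<open>The smaller parameter b dominates, since - ln (1 - x) behaves like x at 0.\<close>

lemma mrest_exact:
  assumes "b > 0" "b < a"
  shows "((\<lambda>t. mrest a b t * exp (2 * b * t)) \<longlongrightarrow> 1 / (a - b)) at_top"
  using assms unfolding mrest_def by simp (real_asymp simp: field_simps)

lemma mrest_same_eq: "mrest a a t * exp (2 * s * t) = 2 * t * exp (2 * (s - a) * t) / (1 - exp (- 2 * a * t))"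
  by (simp add: mrest_def algebra_simps flip: exp_add)

lemma mrest_same_small:
  assumes "a > 0" "s < a"
  shows "((\<lambda>t. mrest a a t * exp (2 * s * t)) \<longlongrightarrow> 0) at_top"
proof -
  define r where "r = a - s"
  have "r > 0" using assms by (simp add: r_def)
  then have "((\<lambda>t. 2 * t * exp (- 2 * r * t)) \<longlongrightarrow> 0) at_top" by real_asymp
  moreover have "((\<lambda>t. 1 - exp (- 2 * a * t)) \<longlongrightarrow> 1) at_top" using assms(1) by real_asymp
  ultimately have "((\<lambda>t. 2 * t * exp (- 2 * r * t) / (1 - exp (- 2 * a * t))) \<longlongrightarrow> 0 / 1) at_top"
    by (rule tendsto_divide) simp
  moreover have "2 * (s - a) = - 2 * r" by (simp add: r_def)
  ultimately show ?thesis by (simp add: mrest_same_eq)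
qed

text \<open>Already at s = a the factor t makes the product unbounded. This distinguishes a double
  parameter from the case of \<open>mrest_exact\<close>, where a finite limit is attained.\<close>

lemma mrest_same_large:
  assumes "a > 0" "s \<ge> a"
  shows "filterlim (\<lambda>t. mrest a a t * exp (2 * s * t)) at_top at_top"
proof -
  define r where "r = s - a"
  have "r > 0 \<or> r = 0" using assms by (auto simp: r_def)
  then have "filterlim (\<lambda>t. 2 * t * exp (2 * r * t)) at_top at_top"
  proof
    assume "r > 0"
    then show ?thesis by real_asymp
  next
    assume "r = 0"
    then show ?thesis by simp real_asymp
  qed
  moreover have "((\<lambda>t. 1 / (1 - exp (- 2 * a * t))) \<longlongrightarrow> 1) at_top" using assms(1) by real_asymp
  ultimately have "filterlim (\<lambda>t. 1 / (1 - exp (- 2 * a * t)) * (2 * t * exp (2 * r * t))) at_top at_top"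
    by (intro filterlim_tendsto_pos_mult_at_top[of "\<lambda>t. 1 / (1 - exp (- 2 * a * t))" 1]) auto
  then show ?thesis by (simp add: mrest_same_eq r_def)
qed

lemma mrest_small:
  assumes "b > 0" "b \<le> a" "s < b"
  shows "((\<lambda>t. mrest a b t * exp (2 * s * t)) \<longlongrightarrow> 0) at_top"
proof (cases "a = b")
  case True
  then show ?thesis using assms mrest_same_small by simp
next
  case False
  define r where "r = b - s"
  have "r > 0" using assms by (simp add: r_def)
  then have "((\<lambda>t. exp (- 2 * r * t)) \<longlongrightarrow> 0) at_top" by real_asymp
  from tendsto_mult[OF mrest_exact this] assms False
  have "((\<lambda>t. mrest a b t * exp (2 * b * t) * exp (- 2 * r * t)) \<longlongrightarrow> 1 / (a - b) * 0) at_top" by simp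
  moreover have "mrest a b t * exp (2 * b * t) * exp (- 2 * r * t) = mrest a b t * exp (2 * s * t)" for t
    unfolding mult.assoc exp_add[symmetric] by (simp add: r_def algebra_simps)
  ultimately show ?thesis by (simp only: mult_zero_right)
qed

lemma mrest_large:
  assumes "b > 0" "b \<le> a" "s > b"
  shows "filterlim (\<lambda>t. mrest a b t * exp (2 * s * t)) at_top at_top"
proof (cases "a = b")
  case True
  then show ?thesis using assms mrest_same_large by simp
next
  case False
  define r where "r = s - b"
  have "r > 0" using assms by (simp add: r_def)
  then have "filterlim (\<lambda>t. exp (2 * r * t)) at_top at_top" by real_asymp
  from filterlim_tendsto_pos_mult_at_top[OF mrest_exact _ this] assms False
  have "filterlim (\<lambda>t. mrest a b t * exp (2 * b * t) * exp (2 * r * t)) at_top at_top" by simp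
  moreover have "mrest a b t * exp (2 * b * t) * exp (2 * r * t) = mrest a b t * exp (2 * s * t)" for t
    unfolding mult.assoc exp_add[symmetric] by (simp add: r_def algebra_simps)
  ultimately show ?thesis by simp
qed

section \<open>Linear growth at infinity\<close>

lemma lsinh_div_at_top: "((\<lambda>t. lsinh (a * t) / t) \<longlongrightarrow> \<bar>a\<bar>) at_top"
proof (cases "a = 0")
  case False
  define A where "A = \<bar>a\<bar>"
  have A: "A > 0" using False by (simp add: A_def)
  then have "((\<lambda>t. (A * t - ln (2 * (A * t)) + ln (1 - exp (- 2 * (A * t)))) / t) \<longlongrightarrow> A) at_top"
    by real_asymp
  then show ?thesis unfolding A_def[symmetric]
  proof (rule Lim_transform_eventually)
    show "\<forall>\<^sub>F t in at_top. (A * t - ln (2 * (A * t)) + ln (1 - exp (- 2 * (A * t)))) / t = lsinh (a * t) / t"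
      using eventually_gt_at_top[of 0]
    proof eventually_elim
      case (elim t)
      have "lsinh (a * t) = lsinh (A * t)" by (cases "a \<ge> 0") (auto simp: A_def)
      then show ?case using lsinh_pos_eq[of "A * t"] A elim by simp
    qed
  qed
qed auto

definition mslope :: "real \<Rightarrow> real \<Rightarrow> real" where
  "mslope a b = (if a = b then sgn a else (\<bar>a\<bar> - \<bar>b\<bar>) / (a - b))"

lemma hyp_slope: "((\<lambda>t. hyp a b t / t) \<longlongrightarrow> mslope a b) at_top"
proof (cases "a = b")
  case False
  have "((\<lambda>t. (lsinh (a * t) / t - lsinh (b * t) / t) / (a - b)) \<longlongrightarrow> (\<bar>a\<bar> - \<bar>b\<bar>) / (a - b)) at_top"
    using False by (intro tendsto_intros lsinh_div_at_top) auto
  then show ?thesis using False by (simp add: hyp_def mslope_def diff_divide_distrib mult.commute)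
next
  case True
  have pos: "((\<lambda>t. hyp a a t / t) \<longlongrightarrow> 1) at_top" if "a > 0" for a
  proof -
    have "((\<lambda>t. (t - 1 / a + 2 * t * exp (- 2 * a * t) / (1 - exp (- 2 * a * t))) / t) \<longlongrightarrow> 1) at_top"
      using that by real_asymp
    then show ?thesis
    proof (rule Lim_transform_eventually)
      show "\<forall>\<^sub>F t in at_top. (t - 1 / a + 2 * t * exp (- 2 * a * t) / (1 - exp (- 2 * a * t))) / t = hyp a a t / t"
        using eventually_gt_at_top[of 0]
        by eventually_elim (use that hyp_eq_mrest[of a a] in \<open>simp add: mconst_def mrest_def\<close>)
    qed
  qed
  consider "a > 0" | "a = 0" | "a < 0" by linarith
  then show ?thesis
  proof cases
    case 1 then show ?thesis using pos True by (simp add: mslope_def)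
  next
    case 2 then show ?thesis using True by (simp add: mslope_def hyp_def)
  next
    case 3 then show ?thesis using True tendsto_minus[OF pos[of "- a"]] by (simp add: mslope_def hyp_uminus)
  qed
qed

lemma slope_lt_1:
  assumes "((\<lambda>t. f t / t) \<longlongrightarrow> k) at_top" "k < (1::real)"
  shows "filterlim (\<lambda>t. t - f t) at_top at_top"
proof -
  have "((\<lambda>t. 1 - f t / t) \<longlongrightarrow> 1 - k) at_top"
    using assms by (intro tendsto_intros)
  then have "filterlim (\<lambda>t. (1 - f t / t) * t) at_top at_top"
    by (rule filterlim_tendsto_pos_mult_at_top) (use assms filterlim_ident in auto)
  moreover have "\<forall>\<^sub>F t in at_top. (1 - f t / t) * t = t - f t"
    using eventually_gt_at_top[of 0] by eventually_elim (simp add: left_diff_distrib)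
  ultimately show ?thesis
    by (subst (asm) filterlim_cong[OF refl refl])
qed

text \<open>For two positive parameters t - hyp a b t converges, so this separates the two kinds of
  means. The slope is below 1 except for one positive and one vanishing parameter; there it is 1,
  but the deficit grows like ln (2 * a * t) / a.\<close>

lemma hyp_gap:
  assumes "a \<le> 0 \<or> b \<le> 0"
  shows "filterlim (\<lambda>t. t - hyp a b t) at_top at_top"
proof -
  have zero: "filterlim (\<lambda>t. t - hyp a 0 t) at_top at_top" if "a > 0" for a
  proof -
    have "filterlim (\<lambda>t. t - (a * t - ln (2 * (a * t)) + ln (1 - exp (- 2 * (a * t)))) / a) at_top at_top"
    proof -
      have "filterlim (\<lambda>t. (ln (2 * (a * t)) - ln (1 - exp (- 2 * (a * t)))) / a) at_top at_top"
        using that by real_asymp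
      moreover have "(ln (2 * (a * t)) - ln (1 - exp (- 2 * (a * t)))) / a
          = t - (a * t - ln (2 * (a * t)) + ln (1 - exp (- 2 * (a * t)))) / a" for t
        using that by (simp add: field_simps)
      ultimately show ?thesis by simp
    qed
    then show ?thesis
    proof (rule filterlim_mono_eventually)
      show "\<forall>\<^sub>F t in at_top. t - (a * t - ln (2 * (a * t)) + ln (1 - exp (- 2 * (a * t)))) / a = t - hyp a 0 t"
        using eventually_gt_at_top[of 0]
        by eventually_elim (use that lsinh_pos_eq in \<open>simp add: hyp_def\<close>)
    qed auto
  qed
  have *: "filterlim (\<lambda>t. t - hyp a b t) at_top at_top" if b: "b \<le> 0" for a b
  proof (cases "a > 0 \<and> b = 0")
    case True then show ?thesis using zero by simp
  next
    case False
    consider "a = b" | "a \<le> 0" "a \<noteq> b" | "a > 0" "b < 0"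
      using False b by linarith
    then have "mslope a b < 1"
    proof cases
      case 1
      then show ?thesis using b by (simp add: mslope_def sgn_if)
    next
      case 2
      then have "(\<bar>a\<bar> - \<bar>b\<bar>) / (a - b) = - 1" using b by (simp add: field_simps)
      then show ?thesis using 2 by (simp add: mslope_def)
    next
      case 3
      then show ?thesis by (simp add: mslope_def)
    qed
    then show ?thesis by (rule slope_lt_1[OF hyp_slope])
  qed
  show ?thesis using assms *[of a b] *[of b a] by (auto simp: hyp_commute)
qed

section \<open>Second order at the origin\<close>

lemma lsinh_small: "((\<lambda>t. lsinh (a * t) / t\<^sup>2) \<longlongrightarrow> a\<^sup>2 / 6) (at_right 0)"
proof (cases "a = 0")
  case False
  define A where "A = \<bar>a\<bar>"
  have A: "A > 0" using False by (simp add: A_def)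
  have one: "((\<lambda>x::real. ln (sinh x / x) / x\<^sup>2) \<longlongrightarrow> 1 / 6) (at_right 0)"
    by real_asymp
  have "filterlim (\<lambda>t. A * t) (at_right 0) (at_right 0)"
    using A by real_asymp
  from tendsto_mult[OF filterlim_compose[OF one this] tendsto_const[of "A\<^sup>2"]]
  have "((\<lambda>t. ln (sinh (A * t) / (A * t)) / t\<^sup>2) \<longlongrightarrow> A\<^sup>2 / 6) (at_right 0)"
    using A by (simp add: power_mult_distrib)
  then have "((\<lambda>t. lsinh (a * t) / t\<^sup>2) \<longlongrightarrow> A\<^sup>2 / 6) (at_right 0)"
  proof (rule Lim_transform_eventually)
    show "\<forall>\<^sub>F t in at_right 0. ln (sinh (A * t) / (A * t)) / t\<^sup>2 = lsinh (a * t) / t\<^sup>2"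
      using eventually_at_right_less[of 0]
    proof eventually_elim
      case (elim t)
      have "lsinh (a * t) = lsinh (A * t)" by (cases "a \<ge> 0") (auto simp: A_def)
      then show ?case using A elim by (simp add: lsinh_def)
    qed
  qed
  then show ?thesis by (simp add: A_def)
qed auto

lemma hyp_small: "((\<lambda>t. hyp a b t / t\<^sup>2) \<longlongrightarrow> (a + b) / 6) (at_right 0)"
proof (cases "a = b")
  case False
  have "((\<lambda>t. (lsinh (a * t) / t\<^sup>2 - lsinh (b * t) / t\<^sup>2) / (a - b)) \<longlongrightarrow> (a\<^sup>2 / 6 - b\<^sup>2 / 6) / (a - b)) (at_right 0)"
    using False by (intro tendsto_intros lsinh_small) auto
  moreover have "(a\<^sup>2 / 6 - b\<^sup>2 / 6) / (a - b) = (a + b) / 6"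
    using False by (simp add: field_simps power2_eq_square)
  moreover have "(lsinh (a * t) / t\<^sup>2 - lsinh (b * t) / t\<^sup>2) / (a - b) = hyp a b t / t\<^sup>2" for t
    using False by (simp add: hyp_def diff_divide_distrib mult.commute)
  ultimately show ?thesis by simp
next
  case True
  have pos: "((\<lambda>t. hyp a a t / t\<^sup>2) \<longlongrightarrow> a / 3) (at_right 0)" if "a > 0" for a
  proof -
    have one: "((\<lambda>x::real. (x * cosh x / sinh x - 1) / x\<^sup>2) \<longlongrightarrow> 1 / 3) (at_right 0)"
      by real_asymp
    have "filterlim (\<lambda>t. a * t) (at_right 0) (at_right 0)"
      using that by real_asymp
    from tendsto_mult[OF filterlim_compose[OF one this] tendsto_const[of a]]
    have "((\<lambda>t. (t * cosh (a * t) / sinh (a * t) - 1 / a) / t\<^sup>2) \<longlongrightarrow> a / 3) (at_right 0)"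
      by (rule Lim_transform_eventually[OF tendsto_eq_rhs])
         (use that in \<open>auto intro!: eventually_mono[OF eventually_at_right_less[of 0]] simp: power_mult_distrib field_simps power2_eq_square\<close>)
    then show ?thesis
    proof (rule Lim_transform_eventually)
      show "\<forall>\<^sub>F t in at_right 0. (t * cosh (a * t) / sinh (a * t) - 1 / a) / t\<^sup>2 = hyp a a t / t\<^sup>2"
        using eventually_at_right_less[of 0] by eventually_elim (use that in \<open>simp add: hyp_def\<close>)
    qed
  qed
  consider "a > 0" | "a = 0" | "a < 0" by linarith
  then show ?thesis
  proof cases
    case 1 then show ?thesis using pos True by simp
  next
    case 2 then show ?thesis using True by (simp add: hyp_def)
  next
    case 3 then show ?thesis using True tendsto_minus[OF pos[of "- a"]] by (simp add: hyp_uminus)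
  qed
qed

text \<open>The half difference w of the inner means is of order t^2, so the outer
  \<open>hyp p q (w t)\<close> is of order t^4. At order t^2 only the arithmetic mean of the inner
  terms remains on the left.\<close>

lemma sum_identity:
  assumes eq: "\<And>t. gmean p q (hyp a b t) (hyp c d t) = hyp p q t"
  shows "a + b + c + d = 2 * (p + q)"
proof -
  define w where "w = (\<lambda>t. (hyp a b t - hyp c d t) / 2)"
  have w2: "((\<lambda>t. w t / t\<^sup>2) \<longlongrightarrow> ((a + b) / 6 - (c + d) / 6) / 2) (at_right 0)"
    unfolding w_def
    using tendsto_divide[OF tendsto_diff[OF hyp_small[of a b] hyp_small[of c d]] tendsto_const[of 2]]
    by (simp add: diff_divide_distrib mult.commute)
  have t2: "((\<lambda>t. t\<^sup>2) \<longlongrightarrow> (0::real)) (at_right 0)" by (auto intro!: tendsto_eq_intros)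
  have "((\<lambda>t. w t / t\<^sup>2 * t\<^sup>2) \<longlongrightarrow> 0) (at_right 0)"
    using tendsto_mult[OF w2 t2] by simp
  then have w0: "(w \<longlongrightarrow> 0) (at_right 0)"
    by (rule Lim_transform_eventually) (rule eventually_mono[OF eventually_at_right_less[of 0]], simp)
  \<comment> \<open>w t may vanish or have either sign, so the quotient is extended to a function
    continuous at 0; evenness supplies the limit from the left.\<close>
  define k where "k = (\<lambda>x. if x = 0 then (p + q) / 6 else hyp p q x / x\<^sup>2)"
  have kr: "((\<lambda>x. k x) \<longlongrightarrow> k 0) (at_right 0)"
    unfolding k_def using hyp_small[of p q]
    by (simp, rule Lim_transform_eventually) (rule eventually_mono[OF eventually_at_right_less[of 0]], simp)
  have "((\<lambda>x. k x) \<longlongrightarrow> k 0) (at_left 0)"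
  proof -
    have "k (- x) = k x" for x by (simp add: k_def hyp_even)
    then show ?thesis using kr by (subst at_left_minus) (simp add: filterlim_filtermap)
  qed
  with kr have "isCont k 0" by (simp add: isCont_def filterlim_split_at)
  then have "((\<lambda>t. k (w t)) \<longlongrightarrow> k 0) (at_right 0)"
    by (rule isCont_tendsto_compose) (rule w0)
  then have "((\<lambda>t. k (w t) * (w t / t\<^sup>2) * w t) \<longlongrightarrow> k 0 * (((a + b) / 6 - (c + d) / 6) / 2) * 0) (at_right 0)"
    by (intro tendsto_mult w0 w2)
  then have "((\<lambda>t. (hyp a b t / t\<^sup>2 + hyp c d t / t\<^sup>2) / 2 + k (w t) * (w t / t\<^sup>2) * w t) \<longlongrightarrow>
      ((a + b) / 6 + (c + d) / 6) / 2 + k 0 * (((a + b) / 6 - (c + d) / 6) / 2) * 0) (at_right 0)"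
    by (intro tendsto_add tendsto_divide hyp_small tendsto_const) auto
  moreover have "(hyp a b t / t\<^sup>2 + hyp c d t / t\<^sup>2) / 2 + k (w t) * (w t / t\<^sup>2) * w t = hyp p q t / t\<^sup>2" for t
  proof -
    have "hyp p q (w t) = k (w t) * w t * w t"
      by (simp add: k_def power2_eq_square)
    moreover have "hyp p q t = (hyp a b t + hyp c d t) / 2 + hyp p q (w t)"
      using eq[of t] by (simp add: gmean_def w_def)
    ultimately show ?thesis by (simp add: add_divide_distrib mult.commute)
  qed
  ultimately have "((\<lambda>t. hyp p q t / t\<^sup>2) \<longlongrightarrow> ((a + b) / 6 + (c + d) / 6) / 2) (at_right 0)"
    by simp
  from tendsto_unique[OF _ this hyp_small[of p q]] show ?thesis by (simp add: field_simps)
qed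

section \<open>Global bounds on the real line\<close>

lemma isCont_hyp: "isCont (hyp a b) t"
proof -
  have "chyp a b holomorphic_on {z. \<bar>a * Im z\<bar> < pi \<and> \<bar>b * Im z\<bar> < pi}"
    by (rule holomorphic_chyp[of "\<lambda>z. z", simplified]) auto
  then have "continuous_on {z. \<bar>a * Im z\<bar> < pi \<and> \<bar>b * Im z\<bar> < pi} (chyp a b)"
    by (rule holomorphic_on_imp_continuous_on)
  then have "continuous_on UNIV (\<lambda>t. chyp a b (of_real t))"
    by (rule continuous_on_compose2) (auto intro!: continuous_intros)
  then have "continuous_on UNIV (\<lambda>t. Re (chyp a b (of_real t)))"
    by (rule continuous_on_Re)
  then show ?thesis by (simp add: chyp_of_real continuous_on_eq_continuous_at)
qed

lemma isCont_lsinh: "isCont lsinh x"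
proof -
  have "lsinh = hyp 1 0" by (simp add: fun_eq_iff hyp_def)
  then show ?thesis using isCont_hyp[of x 1 0] by simp
qed

text \<open>The derivative of \<open>lsinh\<close> is coth x - 1 / x; these bounds place it between
  0 and 1.\<close>

lemma coth_bounds:
  fixes x :: real
  assumes "x > 0"
  shows "1 / x \<le> cosh x / sinh x" "cosh x / sinh x \<le> 1 + 1 / x"
proof -
  have "(\<lambda>x. x * cosh x - sinh x) 0 \<le> (\<lambda>x. x * cosh x - sinh x) x"
  proof (rule DERIV_nonneg_imp_nondecreasing[where f = "\<lambda>x. x * cosh x - sinh x"])
    show "\<exists>y. ((\<lambda>x. x * cosh x - sinh x) has_real_derivative y) (at u) \<and> 0 \<le> y" if "0 \<le> u" "u \<le> x" for u
      using that by (intro exI[of _ "u * sinh u"]) (auto intro!: derivative_eq_intros)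
  qed (use assms in auto)
  moreover have s: "sinh x > 0" using assms by simp
  ultimately show "1 / x \<le> cosh x / sinh x" using assms by (simp add: field_simps)
  have "x * exp (- x) \<le> exp (- x) * (exp (2 * x) - 1) / 2"
  proof -
    have "2 * x \<le> exp (2 * x) - 1" using exp_ge_add_one_self[of "2 * x"] by linarith
    from mult_left_mono[OF this, of "exp (- x)"] show ?thesis by (simp add: mult_ac)
  qed
  also have "\<dots> = sinh x"
    by (simp add: sinh_field_def right_diff_distrib flip: exp_add)
  finally have "x * (cosh x - sinh x) \<le> sinh x"
    by (simp add: cosh_minus_sinh)
  then show "cosh x / sinh x \<le> 1 + 1 / x" using assms s by (simp add: field_simps)
qed

lemma DERIV_lsinh:
  assumes "x > 0"
  shows "(lsinh has_real_derivative cosh x / sinh x - 1 / x) (at x)"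
proof (rule has_field_derivative_transform_within[where S = UNIV and d = x])
  show "((\<lambda>x. ln (sinh x / x)) has_real_derivative cosh x / sinh x - 1 / x) (at x)"
    using assms by (auto intro!: derivative_eq_intros simp: field_simps)
qed (use assms in \<open>auto simp: lsinh_def dist_real_def\<close>)

lemma lsinh_mono:
  assumes "0 \<le> x" "x \<le> y"
  shows "lsinh x \<le> lsinh y" "lsinh y - lsinh x \<le> y - x"
proof -
  have c: "continuous_on {x..y} lsinh"
    by (intro continuous_at_imp_continuous_on ballI isCont_lsinh)
  show "lsinh x \<le> lsinh y"
  proof (rule DERIV_nonneg_imp_increasing_open[OF assms(2) _ c])
    fix t assume t: "x < t" "t < y"
    show "\<exists>y. (lsinh has_real_derivative y) (at t) \<and> 0 \<le> y"
      using DERIV_lsinh[of t] coth_bounds(1)[of t] t assms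
      by (intro exI[of _ "cosh t / sinh t - 1 / t"]) simp
  qed
  have "(\<lambda>t. t - lsinh t) x \<le> (\<lambda>t. t - lsinh t) y"
  proof (rule DERIV_nonneg_imp_increasing_open[where f = "\<lambda>t. t - lsinh t", OF assms(2)])
    fix t assume t: "x < t" "t < y"
    have "((\<lambda>t. t - lsinh t) has_real_derivative 1 - (cosh t / sinh t - 1 / t)) (at t)"
      using DERIV_lsinh[of t] t assms by (auto intro!: derivative_intros)
    then show "\<exists>y. ((\<lambda>t. t - lsinh t) has_real_derivative y) (at t) \<and> 0 \<le> y"
      using coth_bounds(2)[of t] t assms by (intro exI[of _ "1 - (cosh t / sinh t - 1 / t)"]) simp
  qed (use c in \<open>intro continuous_intros; simp\<close>)
  then show "lsinh y - lsinh x \<le> y - x" by simp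
qed

lemma lsinh_lipschitz: "\<bar>x\<bar> \<le> \<bar>y\<bar> \<Longrightarrow> 0 \<le> lsinh y - lsinh x \<and> lsinh y - lsinh x \<le> \<bar>y\<bar> - \<bar>x\<bar>"
  using lsinh_mono[of "\<bar>x\<bar>" "\<bar>y\<bar>"] by simp

lemma hyp_nonneg:
  assumes "p + q \<ge> 0"
  shows "0 \<le> hyp p q w"
proof (cases "p = q")
  case True
  have *: "0 \<le> hyp p p w" if w: "w > 0" for w
  proof (cases "p = 0")
    case False
    then have "p > 0" using True assms by simp
    moreover have "1 / (p * w) * w \<le> cosh (p * w) / sinh (p * w) * w"
      using coth_bounds(1)[of "p * w"] \<open>p > 0\<close> w by (intro mult_right_mono) auto
    ultimately show ?thesis using w by (simp add: hyp_def mult.commute)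
  qed (simp add: hyp_def)
  consider "w > 0" | "w = 0" | "- w > 0" by linarith
  then show ?thesis using True *[of w] *[of "- w"] by cases (auto simp: hyp_even)
next
  case False
  have *: "0 \<le> hyp p q w" if "p > q" "p + q \<ge> 0" for p q
  proof -
    have "\<bar>q\<bar> \<le> \<bar>p\<bar>" using that by linarith
    then have "\<bar>q * w\<bar> \<le> \<bar>p * w\<bar>" by (simp add: abs_mult mult_right_mono)
    then show ?thesis using lsinh_lipschitz[of "q * w" "p * w"] that by (simp add: hyp_def)
  qed
  show ?thesis using *[of p q] *[of q p] False assms
    by (cases "p > q") (auto simp: hyp_commute)
qed

text \<open>In logarithmic form, a Stolarsky mean lies between its two arguments.\<close>

lemma hyp_le_abs: "\<bar>hyp p q w\<bar> \<le> \<bar>w\<bar>"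
proof (cases "p = q")
  case True
  have *: "hyp p p w \<le> w" if w: "w > 0" "p > 0" for w p
  proof -
    have "cosh (p * w) / sinh (p * w) * w \<le> (1 + 1 / (p * w)) * w"
      using coth_bounds(2)[of "p * w"] w by (intro mult_right_mono) auto
    then show ?thesis using w by (simp add: hyp_def mult.commute distrib_left)
  qed
  have pos: "\<bar>hyp p p w\<bar> \<le> \<bar>w\<bar>" if "p > 0" for p w
  proof -
    consider "w > 0" | "w = 0" | "- w > 0" by linarith
    then show ?thesis using hyp_nonneg[of p p w] *[of w p] *[of "- w" p] that by cases (auto simp: hyp_even)
  qed
  consider "p > 0" | "p = 0" | "- p > 0" by linarith
  then show ?thesis using True pos[of p w] pos[of "- p" w] by cases (auto simp: hyp_uminus, simp add: hyp_def)
next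
  case False
  have "\<bar>lsinh x - lsinh y\<bar> \<le> \<bar>x - y\<bar>" for x y
    using lsinh_lipschitz[of x y] lsinh_lipschitz[of y x] by linarith
  from this[of "p * w" "q * w"] have "\<bar>lsinh (p * w) - lsinh (q * w)\<bar> \<le> \<bar>p - q\<bar> * \<bar>w\<bar>"
    by (simp add: abs_mult left_diff_distrib[symmetric])
  then show ?thesis using False by (simp add: hyp_def abs_divide divide_le_eq mult.commute)
qed

text \<open>For q < 0 this sharpens the bound |w|, because the slope is then less than 1.\<close>

lemma hyp_le_slope:
  assumes "q < 0" "- q \<le> p"
  shows "hyp p q w \<le> mslope p q * \<bar>w\<bar>"
proof -
  have "\<bar>q * w\<bar> \<le> \<bar>p * w\<bar>" using assms unfolding abs_mult by (intro mult_right_mono) auto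
  from lsinh_lipschitz[OF this] have "lsinh (p * w) - lsinh (q * w) \<le> (\<bar>p\<bar> - \<bar>q\<bar>) * \<bar>w\<bar>"
    by (simp add: abs_mult left_diff_distrib)
  then show ?thesis using assms by (simp add: hyp_def mslope_def divide_right_mono)
qed

lemma hyp_abs: "hyp p q \<bar>w\<bar> = hyp p q w"
  by (cases "w \<ge> 0") (auto simp: hyp_even)

lemma abs_half_diff: "\<bar>(u - v) / 2\<bar> = (max u v - min u v) / 2" "(u + v) / 2 = (max u v + min u v) / 2"
  for u v :: real
  by (auto simp: max_def min_def)

lemma gmean_le_max: "gmean p q u v \<le> max u v"
proof -
  have "hyp p q ((u - v) / 2) \<le> \<bar>(u - v) / 2\<bar>" using hyp_le_abs[of p q "(u - v) / 2"] by linarith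
  then show ?thesis using abs_half_diff[of u v] unfolding gmean_def by argo
qed

lemma gmean_ge_mean: "p + q \<ge> 0 \<Longrightarrow> (u + v) / 2 \<le> gmean p q u v"
  by (simp add: gmean_def hyp_nonneg)

text \<open>The scale g is t at infinity and - ln e at a singularity, so the filter is left
  open.\<close>

lemma tendsto_hyp_div:
  assumes w: "((\<lambda>x. w x / g x) \<longlongrightarrow> l) F" and g: "filterlim g at_top F"
  shows "((\<lambda>x. hyp p q (w x) / g x) \<longlongrightarrow> mslope p q * \<bar>l\<bar>) F"
proof (cases "l = 0")
  case True
  \<comment> \<open>For l = 0 the argument w need not grow, so its slope at infinity gives nothing;
    the global bound by |w| does.\<close>
  have "((\<lambda>x. hyp p q (w x) / g x) \<longlongrightarrow> 0) F"
  proof (rule Lim_null_comparison)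
    show "\<forall>\<^sub>F x in F. norm (hyp p q (w x) / g x) \<le> \<bar>w x / g x\<bar>"
      by (simp add: abs_divide divide_right_mono hyp_le_abs)
    show "((\<lambda>x. \<bar>w x / g x\<bar>) \<longlongrightarrow> 0) F"
      using w True by (intro tendsto_rabs_zero) simp
  qed
  then show ?thesis using True by simp
next
  case False
  have pos: "\<forall>\<^sub>F x in F. g x > 0"
    using g[unfolded filterlim_at_top_dense] by blast
  have aw: "((\<lambda>x. \<bar>w x\<bar> / g x) \<longlongrightarrow> \<bar>l\<bar>) F"
  proof (rule Lim_transform_eventually[OF tendsto_rabs[OF w]])
    show "\<forall>\<^sub>F x in F. \<bar>w x / g x\<bar> = \<bar>w x\<bar> / g x"
      using pos by eventually_elim (simp add: abs_divide)
  qed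
  have "filterlim (\<lambda>x. \<bar>w x\<bar> / g x * g x) at_top F"
    by (rule filterlim_tendsto_pos_mult_at_top[OF aw _ g]) (use False in auto)
  moreover have "\<forall>\<^sub>F x in F. \<bar>w x\<bar> / g x * g x = \<bar>w x\<bar>"
    using pos by eventually_elim simp
  ultimately have top: "filterlim (\<lambda>x. \<bar>w x\<bar>) at_top F"
    by (subst (asm) filterlim_cong[OF refl refl])
  from filterlim_compose[OF hyp_slope[of p q] top]
  have "((\<lambda>x. hyp p q (w x) / \<bar>w x\<bar>) \<longlongrightarrow> mslope p q) F"
    by (simp add: hyp_abs)
  from tendsto_mult[OF this aw]
  have "((\<lambda>x. hyp p q (w x) / \<bar>w x\<bar> * (\<bar>w x\<bar> / g x)) \<longlongrightarrow> mslope p q * \<bar>l\<bar>) F"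
    by simp
  moreover have "\<forall>\<^sub>F x in F. hyp p q (w x) / \<bar>w x\<bar> * (\<bar>w x\<bar> / g x) = hyp p q (w x) / g x"
    using top[unfolded filterlim_at_top_dense, rule_format, of 0] by eventually_elim simp
  ultimately show ?thesis
    by (rule Lim_transform_eventually)
qed

lemma tendsto_gmean_div:
  assumes u: "((\<lambda>x. u x / g x) \<longlongrightarrow> y) F" and v: "((\<lambda>x. v x / g x) \<longlongrightarrow> z) F"
    and g: "filterlim g at_top F"
  shows "((\<lambda>x. gmean p q (u x) (v x) / g x) \<longlongrightarrow> (y + z + mslope p q * \<bar>y - z\<bar>) / 2) F"
proof -
  have w: "((\<lambda>x. (u x - v x) / 2 / g x) \<longlongrightarrow> (y - z) / 2) F"
    using tendsto_divide[OF tendsto_diff[OF u v] tendsto_const[of 2]] by (simp add: diff_divide_distrib mult.commute)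
  have "((\<lambda>x. (u x / g x + v x / g x) / 2 + hyp p q ((u x - v x) / 2) / g x) \<longlongrightarrow>
      (y + z) / 2 + mslope p q * \<bar>(y - z) / 2\<bar>) F"
    by (intro tendsto_add tendsto_divide u v tendsto_const tendsto_hyp_div[OF w g]) auto
  moreover have "(u x / g x + v x / g x) / 2 + hyp p q ((u x - v x) / 2) / g x = gmean p q (u x) (v x) / g x" for x
    by (simp add: gmean_def add_divide_distrib mult.commute)
  moreover have "(y + z) / 2 + mslope p q * \<bar>(y - z) / 2\<bar> = (y + z + mslope p q * \<bar>y - z\<bar>) / 2"
    by (simp only: abs_divide abs_numeral) (simp add: field_simps)
  ultimately show ?thesis by (simp only:)
qed

lemma hyp_pos_pos_limit:
  assumes "p > 0" "q > 0"
  shows "((\<lambda>w. hyp p q w - w) \<longlongrightarrow> - mconst p q) at_top"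
proof -
  have "((\<lambda>w. mrest p q w) \<longlongrightarrow> 0) at_top"
    using mrest_small[of "min p q" "max p q" 0] assms
    by (cases "p \<le> q") (auto simp: mrest_commute min_def max_def)
  then have "((\<lambda>w. - mconst p q + mrest p q w) \<longlongrightarrow> - mconst p q + 0) at_top"
    by (intro tendsto_intros)
  moreover have "\<forall>\<^sub>F w in at_top. - mconst p q + mrest p q w = hyp p q w - w"
    using eventually_gt_at_top[of 0] by eventually_elim (use assms in \<open>simp add: hyp_eq_mrest\<close>)
  ultimately show ?thesis
    by (simp add: Lim_transform_eventually)
qed

lemma hyp_pos_zero_limit:
  assumes "p > 0"
  shows "((\<lambda>w. hyp p 0 w - w + ln (2 * p * w) / p) \<longlongrightarrow> 0) at_top"
proof -
  have "((\<lambda>w. ln (1 - exp (- 2 * p * w)) / p) \<longlongrightarrow> 0) at_top"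
    using assms by real_asymp
  then show ?thesis
  proof (rule Lim_transform_eventually)
    show "\<forall>\<^sub>F w in at_top. ln (1 - exp (- 2 * p * w)) / p = hyp p 0 w - w + ln (2 * p * w) / p"
      using eventually_gt_at_top[of 0]
    proof eventually_elim
      case (elim w)
      then have "lsinh (p * w) = p * w - ln (2 * p * w) + ln (1 - exp (- 2 * p * w))"
        using lsinh_pos_eq[of "p * w"] assms by (simp add: mult.assoc)
      then show ?case using assms by (simp add: hyp_def add_divide_distrib diff_divide_distrib)
    qed
  qed
qed

lemma hyp_pos_neg_eq:
  assumes "p > 0" "r > 0" "w > 0"
  shows "hyp p (- r) w = (p - r) / (p + r) * w - (ln p - ln r) / (p + r)
     + (ln (1 - exp (- 2 * p * w)) - ln (1 - exp (- 2 * r * w))) / (p + r)"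
proof -
  have "lsinh (p * w) - lsinh (r * w) = (p - r) * w - (ln p - ln r) + (ln (1 - exp (- 2 * p * w)) - ln (1 - exp (- 2 * r * w)))"
    using assms by (simp add: lsinh_pos_eq ln_mult algebra_simps)
  then show ?thesis using assms
    by (simp add: hyp_def add_divide_distrib diff_divide_distrib left_diff_distrib)
qed

text \<open>The limit is the order of the zero of K at \<open>\<xi>\<close>, which makes exponents
  integral. The ray is the approach to the singularity from below on the imaginary axis.\<close>

lemma holomorphic_order_along_ray:
  assumes K: "K holomorphic_on S" "open S" "\<xi> \<in> S"
    and nz: "\<forall>\<^sub>F e in at_right 0. K (\<xi> - \<i> * of_real e) \<noteq> 0"
  shows "\<exists>n::nat. ((\<lambda>e. ln (cmod (K (\<xi> - \<i> * of_real e))) / ln e) \<longlongrightarrow> of_nat n) (at_right 0)"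
proof -
  obtain r where r: "r > 0" "ball \<xi> r \<subseteq> S" using K openE by blast
  have lim: "((\<lambda>e. \<xi> - \<i> * of_real e) \<longlongrightarrow> \<xi>) (at_right 0)"
    using tendsto_diff[OF tendsto_const[of \<xi>] tendsto_mult[OF tendsto_const[of \<i>] tendsto_of_real[OF tendsto_ident_at[of 0 "{0<..}"]]]]
    by simp
  have ball: "\<forall>\<^sub>F e in at_right 0. \<xi> - \<i> * of_real e \<in> ball \<xi> s" if "s > 0" for s
    using topological_tendstoD[OF lim, of "ball \<xi> s"] that by auto
  have base: "((\<lambda>e. ln (cmod (g (\<xi> - \<i> * of_real e))) / ln e) \<longlongrightarrow> 0) (at_right 0)"
    if "g holomorphic_on ball \<xi> s" "s > 0" "g \<xi> \<noteq> 0" for g s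
  proof (rule bounded_div_ln)
    have "isCont g \<xi>"
      using holomorphic_on_imp_continuous_on[OF that(1)] that(2)
      by (simp add: continuous_on_eq_continuous_at)
    from isCont_tendsto_compose[OF this lim]
    have "((\<lambda>e. g (\<xi> - \<i> * of_real e)) \<longlongrightarrow> g \<xi>) (at_right 0)" .
    then show "((\<lambda>e. ln (cmod (g (\<xi> - \<i> * of_real e)))) \<longlongrightarrow> ln (cmod (g \<xi>))) (at_right 0)"
      by (intro tendsto_ln tendsto_norm) (use that in auto)
  qed
  have hol: "K holomorphic_on ball \<xi> r" using K r holomorphic_on_subset by blast
  show ?thesis
  proof (cases "K \<xi> = 0")
    case False
    from base[OF hol r(1) False] show ?thesis by (intro exI[of _ 0]) simp
  next
    case True
    \<comment> \<open>A constant K would vanish on the whole ball and hence on the ray, contrary to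
      \<open>nz\<close>.\<close>
    have "\<not> K constant_on ball \<xi> r"
    proof
      assume "K constant_on ball \<xi> r"
      then have "K z = 0" if "z \<in> ball \<xi> r" for z
        using True that r(1) unfolding constant_on_def by (metis centre_in_ball)
      with ball[OF r(1)] have "\<forall>\<^sub>F e in at_right 0. K (\<xi> - \<i> * of_real e) = 0"
        by (auto elim: eventually_mono)
      with nz have "\<forall>\<^sub>F e in at_right (0::real). False" by eventually_elim auto
      then show False by simp
    qed
    moreover have "\<xi> \<in> ball \<xi> r" using r(1) by simp
    ultimately obtain g s n where g: "s > 0" "g holomorphic_on ball \<xi> s"
        "\<And>w. w \<in> ball \<xi> s \<Longrightarrow> K w = (w - \<xi>) ^ n * g w" "\<And>w. w \<in> ball \<xi> s \<Longrightarrow> g w \<noteq> 0"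
      using holomorphic_factor_zero_nonconstant[OF hol open_ball connected_ball _ True]
      by (metis (no_types, lifting))
    have "((\<lambda>e. of_nat n + ln (cmod (g (\<xi> - \<i> * of_real e))) / ln e) \<longlongrightarrow> of_nat n + 0) (at_right 0)"
      by (intro tendsto_intros base[OF g(2,1)]) (use g(1,4) in auto)
    then have "((\<lambda>e. ln (cmod (K (\<xi> - \<i> * of_real e))) / ln e) \<longlongrightarrow> of_nat n) (at_right 0)"
    proof (rule Lim_transform_eventually[OF tendsto_eq_rhs])
      show "\<forall>\<^sub>F e in at_right 0. of_nat n + ln (cmod (g (\<xi> - \<i> * of_real e))) / ln e
         = ln (cmod (K (\<xi> - \<i> * of_real e))) / ln e"
        using ball[OF g(1)] eventually_at_right_real[OF zero_less_one]
      proof eventually_elim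
        case (elim e)
        have "cmod (K (\<xi> - \<i> * of_real e)) = e ^ n * cmod (g (\<xi> - \<i> * of_real e))"
          using elim by (simp add: g(3) norm_mult norm_power)
        moreover have "cmod (g (\<xi> - \<i> * of_real e)) > 0" using g(4) elim by simp
        moreover have "ln e < 0" using elim by (simp add: ln_less_zero)
        ultimately show ?case using elim by (simp add: ln_mult ln_realpow field_simps)
      qed
    qed simp
    then show ?thesis by blast
  qed
qed

subsection \<open>The invariance equation near infinity\<close>

lemma tendsto_at_top_contra:
  fixes f :: "'a \<Rightarrow> real"
  assumes "F \<noteq> bot" "(f \<longlongrightarrow> c) F" "filterlim f at_top F"
  shows False
  using not_tendsto_and_filterlim_at_infinity[OF assms(1,2)] assms(3)
  by (blast intro: filterlim_at_top_imp_at_infinity)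

lemma tendsto_at_bot_contra:
  fixes f :: "'a \<Rightarrow> real"
  assumes "F \<noteq> bot" "(f \<longlongrightarrow> c) F" "filterlim f at_bot F"
  shows False
  using not_tendsto_and_filterlim_at_infinity[OF assms(1,2)] assms(3)
  by (blast intro: filterlim_at_bot_imp_at_infinity)

text \<open>The weighted rest tends to 0, to 1 / (a - b) or to infinity. A known finite limit
  therefore reveals the smaller parameter, and a nonzero one also the difference of the two.\<close>

lemma mrest_limit_cases:
  assumes "b > 0" "b \<le> a" and L: "((\<lambda>t. mrest a b t * exp (2 * s * t)) \<longlongrightarrow> L) at_top"
  shows "(s < b \<and> L = 0) \<or> (s = b \<and> b < a \<and> L = 1 / (a - b))"
proof -
  consider "s < b" | "s = b" "b < a" | "s = b" "b = a" | "s > b" using assms(2) by linarith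
  then show ?thesis
  proof cases
    case 1
    then show ?thesis using tendsto_unique[OF _ L mrest_small[OF assms(1,2) 1]] by simp
  next
    case 2
    then show ?thesis using tendsto_unique[OF _ L] mrest_exact[OF assms(1) 2(2)] by simp
  next
    case 3
    then show ?thesis using mrest_same_large[of a s] assms tendsto_at_top_contra[OF _ L] by simp
  next
    case 4
    then show ?thesis using mrest_large[OF assms(1,2)] tendsto_at_top_contra[OF _ L] by simp
  qed
qed

lemma mrest_tendsto_0:
  assumes "a > 0" "b > 0"
  shows "(mrest a b \<longlongrightarrow> 0) at_top"
  using mrest_small[of b a 0] mrest_small[of a b 0] assms
  by (cases "b \<le> a") (auto simp: mrest_commute)

lemma exp_weight_mono:
  assumes "((\<lambda>t. f t * exp (2 * s * t)) \<longlongrightarrow> L) at_top" "s' < s"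
  shows "((\<lambda>t. f t * exp (2 * s' * t)) \<longlongrightarrow> (0::real)) at_top"
proof -
  define r where "r = s - s'"
  have "r > 0" using assms by (simp add: r_def)
  then have "((\<lambda>t. exp (- 2 * r * t)) \<longlongrightarrow> 0) at_top" by real_asymp
  from tendsto_mult[OF assms(1) this]
  have "((\<lambda>t. f t * exp (2 * s * t) * exp (- 2 * r * t)) \<longlongrightarrow> 0) at_top" by simp
  moreover have "f t * exp (2 * s * t) * exp (- 2 * r * t) = f t * exp (2 * s' * t)" for t
    unfolding mult.assoc exp_add[symmetric] by (simp add: r_def algebra_simps)
  ultimately show ?thesis by (simp only:)
qed

text \<open>For large t the inner logarithms are near t and -t, so both sides can be written with
  logarithms of 1 - exp. Multiplied by p + r, the linear terms cancel and the constants must agree;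
  the limit compares what is left at the rate r, the leading rate of the outer rest.\<close>

lemma infinity_opposite:
  assumes eq: "\<And>t. gmean p (- r) (hyp a b t) (hyp (- c) (- d) t) = hyp p (- r) t"
    and pos: "0 < r" "r < p" "a > 0" "b > 0" "c > 0" "d > 0"
  shows "((\<lambda>t. (r * mrest c d t - p * mrest a b t) * exp (2 * r * t))
            \<longlongrightarrow> exp (r * (mconst a b + mconst c d)) - 1) at_top"
proof -
  define A C \<eta> \<zeta> where "A = mconst a b" and "C = mconst c d" and "\<eta> = mrest a b" and "\<zeta> = mrest c d"
  define \<psi> where "\<psi> = (\<lambda>w. ln (1 - exp (- 2 * p * w)) - ln (1 - exp (- 2 * r * w)))"
  define w where "w = (\<lambda>t. t - (A + C) / 2 + (\<eta> t + \<zeta> t) / 2)"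
  have \<eta>0: "(\<eta> \<longlongrightarrow> 0) at_top" and \<zeta>0: "(\<zeta> \<longlongrightarrow> 0) at_top"
    unfolding \<eta>_def \<zeta>_def using pos by (auto intro!: mrest_tendsto_0)
  have wt: "((\<lambda>t. t - w t) \<longlongrightarrow> (A + C) / 2) at_top"
  proof -
    have "((\<lambda>t. (A + C) / 2 - (\<eta> t + \<zeta> t) / 2) \<longlongrightarrow> (A + C) / 2 - (0 + 0) / 2) at_top"
      by (intro tendsto_intros \<eta>0 \<zeta>0) auto
    then show ?thesis by (simp add: w_def)
  qed
  have wtop: "filterlim w at_top at_top"
  proof -
    have "filterlim (\<lambda>t. - (t - w t) + t) at_top at_top"
      by (rule filterlim_tendsto_add_at_top[OF tendsto_minus[OF wt] filterlim_ident])
    then show ?thesis by simp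
  qed
  have \<psi>: "((\<lambda>t. \<psi> t * exp (2 * r * t)) \<longlongrightarrow> 1) at_top"
  proof -
    have "((\<lambda>t. (p - r) * (mrest p r t * exp (2 * r * t))) \<longlongrightarrow> (p - r) * (1 / (p - r))) at_top"
      by (intro tendsto_intros mrest_exact pos)
    then show ?thesis using pos by (simp add: mrest_def \<psi>_def)
  qed
  \<comment> \<open>The argument w lags behind t by (A + C) / 2 in the limit, which multiplies exp
    (- 2 * r * t) by exp (r * (A + C)).\<close>
  have \<psi>w: "((\<lambda>t. \<psi> (w t) * exp (2 * r * t)) \<longlongrightarrow> exp (r * (A + C))) at_top"
  proof -
    have "((\<lambda>t. \<psi> (w t) * exp (2 * r * w t) * exp (2 * r * (t - w t))) \<longlongrightarrow> 1 * exp (2 * r * ((A + C) / 2))) at_top"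
      by (intro tendsto_mult filterlim_compose[OF \<psi> wtop] tendsto_exp tendsto_const wt)
    moreover have "\<psi> (w t) * exp (2 * r * w t) * exp (2 * r * (t - w t)) = \<psi> (w t) * exp (2 * r * t)" for t
      unfolding mult.assoc exp_add[symmetric] by (simp add: algebra_simps)
    ultimately show ?thesis by simp
  qed
  have key: "\<forall>\<^sub>F t in at_top. r * \<zeta> t - p * \<eta> t = (r * C - p * A) + \<psi> (w t) - \<psi> t"
    using eventually_gt_at_top[of 0] wtop[unfolded filterlim_at_top_dense, rule_format, of 0]
  proof eventually_elim
    case (elim t)
    have u: "hyp a b t = t - A + \<eta> t" and v: "hyp (- c) (- d) t = - (t - C + \<zeta> t)"
      using pos elim by (simp_all add: hyp_uminus hyp_eq_mrest A_def C_def \<eta>_def \<zeta>_def)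
    have "(hyp a b t + hyp (- c) (- d) t) / 2 + hyp p (- r) (w t) = hyp p (- r) t"
    proof -
      have "w t = (hyp a b t - hyp (- c) (- d) t) / 2" by (simp add: u v w_def field_simps)
      then show ?thesis using eq[of t] by (simp only: gmean_def)
    qed
    moreover have "hyp a b t + hyp (- c) (- d) t = C - A + \<eta> t - \<zeta> t" by (simp add: u v)
    ultimately have "(p + r) * ((C - A + \<eta> t - \<zeta> t) / 2 + hyp p (- r) (w t)) = (p + r) * hyp p (- r) t"
      by simp
    moreover have "(p + r) * hyp p (- r) s = (p - r) * s - (ln p - ln r) + \<psi> s" if "s > 0" for s
    proof -
      have "m * (k / m * s - L / m + Q / m) = k * s - L + Q" if "m \<noteq> 0" for m k L Q :: real
        using that by (simp add: field_simps)
      from this[of "p + r"] show ?thesis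
        unfolding hyp_pos_neg_eq[OF order.strict_trans[OF pos(1,2)] pos(1) that] \<psi>_def
        using pos by simp
    qed
    ultimately have "(p + r) * ((C - A + \<eta> t - \<zeta> t) / 2) + ((p - r) * w t + \<psi> (w t)) = (p - r) * t + \<psi> t"
      using elim by (simp add: distrib_left)
    then show ?case by (simp add: w_def field_simps)
  qed
  have "((\<lambda>t. \<psi> (w t)) \<longlongrightarrow> 0) at_top" "(\<psi> \<longlongrightarrow> 0) at_top"
    using exp_weight_mono[OF \<psi>w, of 0] exp_weight_mono[OF \<psi>, of 0] pos by simp_all
  then have l1: "((\<lambda>t. (r * C - p * A) + \<psi> (w t) - \<psi> t) \<longlongrightarrow> (r * C - p * A) + 0 - 0) at_top"
    by (intro tendsto_intros)
  have l2: "((\<lambda>t. r * \<zeta> t - p * \<eta> t) \<longlongrightarrow> r * 0 - p * 0) at_top"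
    by (intro tendsto_intros \<eta>0 \<zeta>0)
  have "r * C - p * A = 0"
    using tendsto_unique[OF _ Lim_transform_eventually[OF l2 key] l1] by simp
  have key': "\<forall>\<^sub>F t in at_top. \<psi> (w t) * exp (2 * r * t) - \<psi> t * exp (2 * r * t) = (r * \<zeta> t - p * \<eta> t) * exp (2 * r * t)"
    using key
  proof eventually_elim
    case (elim t)
    then show ?case using \<open>r * C - p * A = 0\<close> by (simp add: left_diff_distrib)
  qed
  from Lim_transform_eventually[OF tendsto_diff[OF \<psi>w \<psi>] key']
  show ?thesis by (simp add: A_def C_def \<eta>_def \<zeta>_def)
qed

text \<open>Below the rate r the two inner rests must cancel each other, so their leading rates and
  coefficients have to agree, which the parameters do not permit.\<close>

lemma infinity_opposite_I:
  assumes eq: "\<And>t. gmean p (- r) (hyp p (p - r) t) (hyp (- c) (- d) t) = hyp p (- r) t"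
    and pos: "0 < r" "r < p" "d > 0" "d \<le> c" and sum: "c + d = r"
  shows False
proof -
  \<comment> \<open>The smaller of the two decay rates; d is at most r / 2, so m lies below
    r.\<close>
  define m where "m = min d (p - r)"
  have "m < r" using pos sum by (simp add: m_def min_def split: if_splits)
  have "((\<lambda>t. (r * mrest c d t - p * mrest p (p - r) t) * exp (2 * r * t))
      \<longlongrightarrow> exp (r * (mconst p (p - r) + mconst c d)) - 1) at_top"
    by (rule infinity_opposite[OF eq]) (use pos in auto)
  from exp_weight_mono[OF this \<open>m < r\<close>]
  have "((\<lambda>t. (r * mrest c d t - p * mrest p (p - r) t) * exp (2 * m * t)) \<longlongrightarrow> 0) at_top" .
  then have 0: "((\<lambda>t. r * (mrest c d t * exp (2 * m * t)) - p * (mrest p (p - r) t * exp (2 * m * t))) \<longlongrightarrow> 0) at_top"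
    by (simp add: algebra_simps)
  consider "p - r < d" | "p - r \<ge> d" by linarith
  then show False
  proof cases
    case 1
    then have m: "m = p - r" by (simp add: m_def)
    have "((\<lambda>t. r * (mrest c d t * exp (2 * m * t)) - p * (mrest p (p - r) t * exp (2 * m * t))) \<longlongrightarrow> r * 0 - p * (1 / (p - (p - r)))) at_top"
      unfolding m using pos 1
      by (intro tendsto_diff[OF tendsto_mult[OF tendsto_const mrest_small] tendsto_mult[OF tendsto_const mrest_exact]]) auto
    from tendsto_unique[OF _ this 0] show False using pos by simp
  next
    case 2
    then have m: "m = d" by (simp add: m_def)
    define L where "L = (if d = p - r then 1 / r else 0)"
    have L: "((\<lambda>t. mrest p (p - r) t * exp (2 * m * t)) \<longlongrightarrow> L) at_top"
    proof (cases "d = p - r")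
      case True
      have "((\<lambda>t. mrest p (p - r) t * exp (2 * (p - r) * t)) \<longlongrightarrow> 1 / (p - (p - r))) at_top"
        using pos by (intro mrest_exact) auto
      with True m show ?thesis by (simp add: L_def)
    next
      case False
      then show ?thesis using pos 2 by (simp add: L_def m mrest_small)
    qed
    have "((\<lambda>t. (r * (mrest c d t * exp (2 * m * t)) - p * (mrest p (p - r) t * exp (2 * m * t))
        + p * (mrest p (p - r) t * exp (2 * m * t))) / r) \<longlongrightarrow> (0 + p * L) / r) at_top"
      using pos by (intro tendsto_divide[OF tendsto_add[OF 0 tendsto_mult[OF tendsto_const L]] tendsto_const]) auto
    then have "((\<lambda>t. mrest c d t * exp (2 * m * t)) \<longlongrightarrow> p * L / r) at_top"
      using pos by simp
    from mrest_limit_cases[OF pos(3,4) this] have "d < c \<and> p * L / r = 1 / (c - d)"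
      unfolding m by simp
    then have *: "d < c" "p * L / r = 1 / (c - d)" by simp_all
    then have "L \<noteq> 0" by auto
    have d: "d = p - r"
    proof (rule ccontr)
      assume "d \<noteq> p - r"
      then have "L = 0" by (simp add: L_def)
      with \<open>L \<noteq> 0\<close> show False by simp
    qed
    then have L: "L = 1 / r" by (simp add: L_def)
    \<comment> \<open>Equal rates d = p - r require equal coefficients r / (c - d) = p / r. This is
      quadratic and leaves only p = r or 2 * p = r.\<close>
    have c: "c - d = 3 * r - 2 * p" using sum d by linarith
    have "p / (r * r) = 1 / (3 * r - 2 * p)" "3 * r - 2 * p > 0"
      using * unfolding L c[symmetric] by simp_all
    then have "p * (3 * r - 2 * p) = r * r"
      using pos by (simp add: frac_eq_eq)
    then have "(2 * p - r) * (p - r) = 0" by (simp add: algebra_simps)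
    then show False using pos by simp
  qed
qed

text \<open>As b > n, the rest of the first mean decays faster than that of the second. Matching
  rates leaves n = r and E = r / (m - r), while exp x - 1 >= x shows that E exceeds r *
  \<open>mconst m n\<close>. The bound 3 * r <= m makes these incompatible; it will come from the
  singularity.\<close>

lemma infinity_opposite_II:
  assumes eq: "\<And>t. gmean p (- r) (hyp m b t) (hyp (- m) (- n) t) = hyp p (- r) t"
    and pos: "0 < r" "r < p" "n > 0" "n < m" "b < m" and sum: "b - n = 2 * (p - r)"
    and rel: "n = r \<Longrightarrow> 3 * r \<le> m"
  shows False
proof -
  have b: "b > n" using pos sum by simp
  define E where "E = exp (r * (mconst m b + mconst m n)) - 1"
  have lim: "((\<lambda>t. (r * mrest m n t - p * mrest m b t) * exp (2 * r * t)) \<longlongrightarrow> E) at_top"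
    unfolding E_def by (rule infinity_opposite[OF eq]) (use pos b in auto)
  have "mconst m b > 0" "mconst m n > 0" using pos b by (auto intro!: mconst_pos)
  then have "r * mconst m n < r * (mconst m b + mconst m n)" using pos by simp
  also have "\<dots> \<le> E" unfolding E_def using exp_ge_add_one_self[of "r * (mconst m b + mconst m n)"] by linarith
  finally have E: "r * mconst m n < E" .
  have E0: "E > 0" using E mult_pos_pos[OF pos(1) \<open>mconst m n > 0\<close>] by linarith
  show False
  proof (cases "n < r")
    case True
    from exp_weight_mono[OF lim True]
    have 0: "((\<lambda>t. r * (mrest m n t * exp (2 * n * t)) - p * (mrest m b t * exp (2 * n * t))) \<longlongrightarrow> 0) at_top"
      by (simp add: algebra_simps)
    have "((\<lambda>t. r * (mrest m n t * exp (2 * n * t)) - p * (mrest m b t * exp (2 * n * t))) \<longlongrightarrow> r * (1 / (m - n)) - p * 0) at_top"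
      using pos b
      by (intro tendsto_diff[OF tendsto_mult[OF tendsto_const mrest_exact] tendsto_mult[OF tendsto_const mrest_small]]) auto
    from tendsto_unique[OF _ this 0] show False using pos by simp
  next
    case False
    have 1: "((\<lambda>t. r * (mrest m n t * exp (2 * r * t)) - p * (mrest m b t * exp (2 * r * t))) \<longlongrightarrow> E) at_top"
      using lim by (simp add: algebra_simps)
    have 2: "((\<lambda>t. p * (mrest m b t * exp (2 * r * t))) \<longlongrightarrow> p * 0) at_top"
      using pos b False by (intro tendsto_intros mrest_small) auto
    have "((\<lambda>t. (r * (mrest m n t * exp (2 * r * t)) - p * (mrest m b t * exp (2 * r * t))
        + p * (mrest m b t * exp (2 * r * t))) / r) \<longlongrightarrow> (E + p * 0) / r) at_top"
      using pos by (intro tendsto_divide[OF tendsto_add[OF 1 2] tendsto_const]) auto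
    then have "((\<lambda>t. mrest m n t * exp (2 * r * t)) \<longlongrightarrow> E / r) at_top"
      using pos by simp
    from mrest_limit_cases[OF pos(3) _ this] pos E0
    have n: "n = r" and e: "E / r = 1 / (m - r)" by auto
    have m: "3 * r \<le> m" using rel n by simp
    \<comment> \<open>The constant 3 enters as an upper bound of e: it gives ln (m / r) >= 1, so
      \<open>mconst m n\<close> is at least 1 / (m - r).\<close>
    have "r * exp 1 \<le> r * 3" using exp_le pos by (intro mult_left_mono) auto
    with m have "r * exp 1 \<le> m" by linarith
    then have "exp 1 \<le> m / r" using pos by (simp add: field_simps)
    then have "1 \<le> ln (m / r)" using pos n by (subst ln_ge_iff) auto
    then have "1 \<le> ln m - ln r" using pos n by (simp add: ln_div)
    then have "r * (1 / (m - r)) \<le> r * ((ln m - ln r) / (m - r))"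
      using pos n by (intro mult_left_mono divide_right_mono) auto
    also have "\<dots> = r * mconst m n" using pos n by (simp add: mconst_def)
    also have "\<dots> < E" by (rule E)
    also have "E = r * (1 / (m - r))" using e pos by (simp add: field_simps)
    finally show False by simp
  qed
qed

lemma slope_equation:
  assumes eq: "\<And>t. gmean p q (hyp a b t) (hyp c d t) = hyp p q t"
  shows "mslope a b + mslope c d + mslope p q * \<bar>mslope a b - mslope c d\<bar> = 2 * mslope p q"
proof -
  have "((\<lambda>t. gmean p q (hyp a b t) (hyp c d t) / t) \<longlongrightarrow>
      (mslope a b + mslope c d + mslope p q * \<bar>mslope a b - mslope c d\<bar>) / 2) at_top"
    by (intro tendsto_gmean_div hyp_slope filterlim_ident)
  then have "((\<lambda>t. hyp p q t / t) \<longlongrightarrow>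
      (mslope a b + mslope c d + mslope p q * \<bar>mslope a b - mslope c d\<bar>) / 2) at_top"
    by (simp add: eq)
  from tendsto_unique[OF _ this hyp_slope] show ?thesis by simp
qed

text \<open>The equation expresses r * (t - hyp c d t) by convergent terms, whereas a nonpositive
  parameter makes this deficit unbounded by \<open>hyp_gap\<close>.\<close>

lemma infinity_opposite_params_pos:
  assumes eq: "\<And>t. gmean p (- r) (hyp a b t) (hyp (- c) (- d) t) = hyp p (- r) t"
    and pos: "0 < r" "r < p" "a > 0" "b > 0" "c + d \<ge> 0"
  shows "c > 0 \<and> d > 0"
proof (rule ccontr)
  assume "\<not> (c > 0 \<and> d > 0)"
  then have gap: "filterlim (\<lambda>t. t - hyp c d t) at_top at_top"
    by (intro hyp_gap) auto
  define B where "B = (ln p - ln r) / (p + r)"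
  define w where "w = (\<lambda>t. (hyp a b t + hyp c d t) / 2)"
  have H: "((\<lambda>w. hyp p (- r) w - (p - r) / (p + r) * w) \<longlongrightarrow> - B) at_top"
  proof -
    have "((\<lambda>w. - B + (p - r) / (p + r) * mrest p r w) \<longlongrightarrow> - B + (p - r) / (p + r) * 0) at_top"
      using pos by (intro tendsto_intros mrest_tendsto_0) auto
    moreover have "\<forall>\<^sub>F w in at_top. - B + (p - r) / (p + r) * mrest p r w = hyp p (- r) w - (p - r) / (p + r) * w"
      using eventually_gt_at_top[of 0]
      by eventually_elim (use pos hyp_pos_neg_eq[of p r] in \<open>simp add: B_def mrest_def\<close>)
    ultimately show ?thesis by (simp add: Lim_transform_eventually)
  qed
  have A: "((\<lambda>t. hyp a b t - t) \<longlongrightarrow> - mconst a b) at_top"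
    using pos by (intro hyp_pos_pos_limit)
  have "filterlim (\<lambda>t. (hyp a b t - t) + t) at_top at_top"
    by (rule filterlim_tendsto_add_at_top[OF A filterlim_ident])
  then have "filterlim (\<lambda>t. (1 / 2) * hyp a b t) at_top at_top"
    by (intro filterlim_tendsto_pos_mult_at_top[OF tendsto_const]) auto
  \<comment> \<open>c + d >= 0 makes hyp c d nonnegative, so w is at least half of hyp a b.\<close>
  then have wtop: "filterlim w at_top at_top"
    by (rule filterlim_at_top_mono) (use hyp_nonneg[OF pos(5)] in \<open>simp add: w_def\<close>)
  have key: "r * (t - hyp c d t) = - p * (hyp a b t - t)
      - (p + r) * ((hyp p (- r) (w t) - (p - r) / (p + r) * w t) - (hyp p (- r) t - (p - r) / (p + r) * t))" for t
  proof -
    have "(hyp a b t - hyp c d t) / 2 + hyp p (- r) (w t) = hyp p (- r) t"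
      using eq[of t] by (simp add: gmean_def hyp_uminus w_def)
    then have h: "hyp p (- r) t = (hyp a b t - hyp c d t) / 2 + hyp p (- r) (w t)" by simp
    have k: "(p + r) * ((p - r) / (p + r) * x) = (p - r) * x" for x using pos by simp
    show ?thesis
      unfolding right_diff_distrib[of "p + r"] k unfolding h by (simp add: w_def field_simps)
  qed
  have "((\<lambda>t. - p * (hyp a b t - t)
      - (p + r) * ((hyp p (- r) (w t) - (p - r) / (p + r) * w t) - (hyp p (- r) t - (p - r) / (p + r) * t)))
      \<longlongrightarrow> - p * - mconst a b - (p + r) * (- B - - B)) at_top"
    by (intro tendsto_diff tendsto_mult tendsto_const A H filterlim_compose[OF H wtop])
  then have "((\<lambda>t. r * (t - hyp c d t)) \<longlongrightarrow> - p * - mconst a b - (p + r) * (- B - - B)) at_top"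
    by (simp only: key)
  moreover have "filterlim (\<lambda>t. r * (t - hyp c d t)) at_top at_top"
    using gap pos by (intro filterlim_tendsto_pos_mult_at_top[OF tendsto_const])
  ultimately show False
    by (rule tendsto_at_top_contra[rotated]) simp
qed

text \<open>With a vanishing outer parameter the mean follows its larger argument v only up to a
  logarithm of the distance, which is where the smaller argument remains visible.\<close>

lemma gmean_zero_asymp:
  assumes "p > 0" and top: "filterlim (\<lambda>x. v x - u x) at_top F"
  shows "((\<lambda>x. gmean p 0 (u x) (v x) - v x + ln (p * (v x - u x)) / p) \<longlongrightarrow> 0) F"
proof -
  have "filterlim (\<lambda>x. (1 / 2) * (v x - u x)) at_top F"
    by (rule filterlim_tendsto_pos_mult_at_top[OF tendsto_const _ top]) simp
  from filterlim_compose[OF hyp_pos_zero_limit[OF assms(1)] this]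
  have "((\<lambda>x. hyp p 0 ((v x - u x) / 2) - (v x - u x) / 2 + ln (p * (v x - u x)) / p) \<longlongrightarrow> 0) F"
    by simp
  moreover have "hyp p 0 ((v x - u x) / 2) - (v x - u x) / 2 + ln (p * (v x - u x)) / p
     = gmean p 0 (u x) (v x) - v x + ln (p * (v x - u x)) / p" for x
    unfolding gmean_swap[of p 0 "u x"] by (simp add: gmean_def field_simps)
  ultimately show ?thesis by simp
qed

text \<open>The left side is about (t - 1 / p) - ln (p * t) / p and the right side about t - ln (2 *
  p * t) / p. Equality of the constants would give ln 2 = 1.\<close>

lemma infinity_zero:
  assumes eq: "\<And>t. gmean p 0 (hyp p p t) (hyp 0 0 t) = hyp p 0 t" and "p > 0"
  shows False
proof -
  have sh: "((\<lambda>t. hyp p p t - t) \<longlongrightarrow> - (1 / p)) at_top"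
    using hyp_pos_pos_limit[of p p] assms by (simp add: mconst_def)
  have "filterlim (\<lambda>t. (hyp p p t - t) + t) at_top at_top"
    by (rule filterlim_tendsto_add_at_top[OF sh filterlim_ident])
  then have top: "filterlim (\<lambda>t. hyp p p t) at_top at_top" by simp
  from gmean_zero_asymp[OF assms(2), of "hyp p p" "\<lambda>_. 0" at_top] top
  have 1: "((\<lambda>t. gmean p 0 0 (hyp p p t) - hyp p p t + ln (p * hyp p p t) / p) \<longlongrightarrow> 0) at_top"
    by simp
  have h0: "hyp 0 0 t = 0" for t by (simp add: hyp_def)
  have 2: "((\<lambda>t. (gmean p 0 0 (hyp p p t) - hyp p p t + ln (p * hyp p p t) / p)
      - (hyp p 0 t - t + ln (2 * p * t) / p) + (hyp p p t - t)) \<longlongrightarrow> 0 - 0 + - (1 / p)) at_top"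
    by (intro tendsto_intros 1 hyp_pos_zero_limit assms sh)
  have 3: "((\<lambda>t. hyp p p t / t) \<longlongrightarrow> 1) at_top"
    using hyp_slope[of p p] assms by (simp add: mslope_def)
  have "((\<lambda>t. ln (hyp p p t / t / 2) / p) \<longlongrightarrow> ln (1 / 2) / p) at_top"
    by (intro tendsto_intros 3) (use assms in auto)
  moreover have "\<forall>\<^sub>F t in at_top. ln (hyp p p t / t / 2) / p =
      (gmean p 0 0 (hyp p p t) - hyp p p t + ln (p * hyp p p t) / p)
      - (hyp p 0 t - t + ln (2 * p * t) / p) + (hyp p p t - t)"
    using eventually_gt_at_top[of 0] top[unfolded filterlim_at_top_dense, rule_format, of 0]
  proof eventually_elim
    case (elim t)
    have "gmean p 0 0 (hyp p p t) = hyp p 0 t" using eq[of t] gmean_swap by (simp add: h0)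
    moreover have "ln (hyp p p t / t / 2) = ln (p * hyp p p t) - ln (2 * p * t)"
      using elim assms by (simp add: ln_div ln_mult)
    ultimately show ?case by (simp add: diff_divide_distrib)
  qed
  ultimately have "((\<lambda>t. (gmean p 0 0 (hyp p p t) - hyp p p t + ln (p * hyp p p t) / p)
      - (hyp p 0 t - t + ln (2 * p * t) / p) + (hyp p p t - t)) \<longlongrightarrow> ln (1 / 2) / p) at_top"
    by (rule Lim_transform_eventually)
  from tendsto_unique[OF _ this 2] have "ln (1 / 2) = (- 1 :: real)" using assms by (simp add: field_simps)
  then show False using ln_2_less_1 by (simp add: ln_div)
qed

text \<open>The right side stays within a bounded distance \<open>mconst p q\<close> of t in the
  limit; each way of having a nonpositive inner parameter contradicts this.\<close>

lemma infinity_params_pos: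
  assumes eq: "\<And>t. gmean p q (hyp a b t) (hyp c d t) = hyp p q t"
    and pq: "p > 0" "q > 0"
  shows "a > 0 \<and> b > 0 \<and> c > 0 \<and> d > 0"
proof -
  have P: "((\<lambda>t. t - hyp p q t) \<longlongrightarrow> mconst p q) at_top"
    using tendsto_minus[OF hyp_pos_pos_limit[OF pq]] by simp
  \<comment> \<open>One inner mean falls behind, so the outer mean follows the other with its own
    lag: the lags \<open>mconst c d\<close> and \<open>mconst p q\<close> add up, although the right
    side has only the latter.\<close>
  have one: False if "\<And>t. gmean p q (hyp a b t) (hyp c d t) = hyp p q t"
    "a \<le> 0 \<or> b \<le> 0" "c > 0" "d > 0" for a b c d
  proof -
    have A: "filterlim (\<lambda>t. t - hyp a b t) at_top at_top" by (rule hyp_gap) fact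
    have C: "((\<lambda>t. hyp c d t - t) \<longlongrightarrow> - mconst c d) at_top"
      by (rule hyp_pos_pos_limit) fact+
    define w where "w = (\<lambda>t. (hyp c d t - hyp a b t) / 2)"
    have "filterlim (\<lambda>t. (hyp c d t - t) + (t - hyp a b t)) at_top at_top"
      by (rule filterlim_tendsto_add_at_top[OF C A])
    then have "filterlim (\<lambda>t. (1 / 2) * (hyp c d t - hyp a b t)) at_top at_top"
      by (intro filterlim_tendsto_pos_mult_at_top[OF tendsto_const]) auto
    then have wtop: "filterlim w at_top at_top" by (simp add: w_def)
    have "((\<lambda>t. - (hyp c d t - t) - (hyp p q (w t) - w t)) \<longlongrightarrow> - (- mconst c d) - (- mconst p q)) at_top"
      by (intro tendsto_intros C filterlim_compose[OF hyp_pos_pos_limit[OF pq] wtop])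
    moreover have "- (hyp c d t - t) - (hyp p q (w t) - w t) = t - hyp p q t" for t
      using that(1)[of t] unfolding gmean_swap[of p q "hyp a b t"]
      by (simp add: gmean_def w_def field_simps)
    ultimately have "((\<lambda>t. t - hyp p q t) \<longlongrightarrow> - (- mconst c d) - (- mconst p q)) at_top" by (simp only:)
    from tendsto_unique[OF _ this P] have "mconst c d = 0" by simp
    then show False using mconst_pos[OF that(3,4)] by simp
  qed
  \<comment> \<open>Both inner means fall behind t without bound, and the outer mean is at most
    their maximum.\<close>
  have two: False if "a \<le> 0 \<or> b \<le> 0" "c \<le> 0 \<or> d \<le> 0"
  proof -
    have "filterlim (\<lambda>t. min (t - hyp a b t) (t - hyp c d t)) at_top at_top"
      using hyp_gap[OF that(1)] hyp_gap[OF that(2)] unfolding filterlim_at_top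
      by (simp add: eventually_conj_iff)
    then have "filterlim (\<lambda>t. t - hyp p q t) at_top at_top"
    proof (rule filterlim_at_top_mono)
      have "hyp p q t \<le> max (hyp a b t) (hyp c d t)" for t
        unfolding eq[of t, symmetric] by (rule gmean_le_max)
      moreover have "min (t - x) (t - y) \<le> t - z" if "z \<le> max x y" for x y z t :: real
        using that by (auto simp: min_def max_def split: if_splits)
      ultimately have "min (t - hyp a b t) (t - hyp c d t) \<le> t - hyp p q t" for t
        by blast
      then show "\<forall>\<^sub>F t in at_top. min (t - hyp a b t) (t - hyp c d t) \<le> t - hyp p q t"
        by simp
    qed
    with P show False by (rule tendsto_at_top_contra[rotated]) simp
  qed
  have eq': "gmean p q (hyp c d t) (hyp a b t) = hyp p q t" for t
    using eq[of t] by (simp add: gmean_swap)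
  show ?thesis
    using one[OF eq] one[OF eq'] two by (meson not_le)
qed

section \<open>Expansion of the outer mean for positive parameters\<close>

lemma coth_slope_bounds:
  fixes x :: real
  assumes "x > 0"
  shows "0 \<le> cosh x / sinh x - x / (sinh x)\<^sup>2" "cosh x / sinh x - x / (sinh x)\<^sup>2 < 1"
proof -
  have s: "sinh x > 0" using assms by simp
  have "x \<le> sinh x * cosh x"
  proof -
    have "(\<lambda>x. sinh x * cosh x - x) 0 \<le> (\<lambda>x. sinh x * cosh x - x) x"
    proof (rule DERIV_nonneg_imp_nondecreasing[where f = "\<lambda>x. sinh x * cosh x - x"])
      fix u :: real
      have "((\<lambda>x. sinh x * cosh x - x) has_real_derivative 2 * (sinh u)\<^sup>2) (at u)"
        by (auto intro!: derivative_eq_intros simp: cosh_square_eq power2_eq_square)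
           (simp add: cosh_square_eq[unfolded power2_eq_square])
      then show "\<exists>y. ((\<lambda>x. sinh x * cosh x - x) has_real_derivative y) (at u) \<and> 0 \<le> y"
        by (intro exI[of _ "2 * (sinh u)\<^sup>2"]) simp
    qed (use assms in auto)
    then show ?thesis by simp
  qed
  then show "0 \<le> cosh x / sinh x - x / (sinh x)\<^sup>2"
    using s by (simp add: field_simps power2_eq_square)
  have "1 - 2 * x < exp (- 2 * x)"
  proof (cases "x < 1")
    case True
    have "1 - x \<le> exp (- x)" using exp_ge_add_one_self[of "- x"] by simp
    then have "(1 - x)\<^sup>2 \<le> (exp (- x))\<^sup>2" using True by (intro power_mono) auto
    also have "\<dots> = exp (- 2 * x)" by (simp add: power2_eq_square flip: exp_add)
    finally have "(1 - x)\<^sup>2 \<le> exp (- 2 * x)" .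
    moreover have "1 - 2 * x < (1 - x)\<^sup>2" using assms by (simp add: power2_eq_square algebra_simps)
    ultimately show ?thesis by linarith
  next
    case False
    then have "1 - 2 * x < 0" by simp
    then show ?thesis using exp_gt_zero less_trans by blast
  qed
  then have "sinh x * (cosh x - sinh x) < x"
    by (simp add: cosh_minus_sinh) (simp add: sinh_field_def left_diff_distrib flip: exp_add)
  then have "sinh x * cosh x - x < (sinh x)\<^sup>2" by (simp add: algebra_simps power2_eq_square)
  then show "cosh x / sinh x - x / (sinh x)\<^sup>2 < 1"
    using s by (simp add: field_simps power2_eq_square)
qed

text \<open>Forming the difference quotient of the holomorphic continuation twice gives a Taylor
  formula whose second coefficient k is continuous at 0. It also has the right value at x = 0, so x
  may be replaced by a function with zeros.\<close>

lemma hyp_expansion: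
  "\<exists>h1 k k0. (\<forall>x. hyp p q (w + x) = hyp p q w + h1 * x + k x * x\<^sup>2) \<and> (k \<longlongrightarrow> k0) (at 0) \<and> k 0 = k0"
proof -
  define T where "T = {z. \<bar>p * Im z\<bar> < pi \<and> \<bar>q * Im z\<bar> < pi}"
  have oT: "open T"
    unfolding T_def by (intro open_Collect_conj open_Collect_less continuous_intros)
  have hol: "chyp p q holomorphic_on T"
    by (rule holomorphic_chyp[of "\<lambda>z. z", simplified]) (auto simp: T_def)
  define g where "g = (\<lambda>z. if z = of_real w then deriv (chyp p q) (of_real w)
      else (chyp p q z - chyp p q (of_real w)) / (z - of_real w))"
  have hg: "g holomorphic_on T"
    unfolding g_def by (rule pole_lemma_open[OF hol oT])
  define f where "f = (\<lambda>z. if z = of_real w then deriv g (of_real w)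
      else (g z - g (of_real w)) / (z - of_real w))"
  have hf: "f holomorphic_on T"
    unfolding f_def by (rule pole_lemma_open[OF hg oT])
  have "isCont f (of_real w)"
    using holomorphic_on_imp_continuous_on[OF hf] oT
    by (simp add: continuous_on_eq_continuous_at T_def)
  then have "isCont f (of_real (w + 0))" by simp
  then have "isCont (\<lambda>x. f (of_real (w + x))) 0"
    by (intro isCont_o2[of 0 "\<lambda>x. of_real (w + x)" f]) (auto intro!: continuous_intros)
  then have "isCont (\<lambda>x. Re (f (of_real (w + x)))) 0"
    by (rule continuous_Re)
  then have k: "((\<lambda>x. Re (f (of_real (w + x)))) \<longlongrightarrow> Re (f (of_real w))) (at 0)"
    by (simp add: isCont_def)
  have "hyp p q (w + x) = hyp p q w + Re (g (of_real w)) * x + Re (f (of_real (w + x))) * x\<^sup>2" for x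
  proof -
    have 1: "chyp p q (of_real (w + x)) = chyp p q (of_real w) + g (of_real (w + x)) * of_real x"
      by (simp add: g_def)
    have 2: "g (of_real (w + x)) = g (of_real w) + f (of_real (w + x)) * of_real x"
      by (simp add: f_def)
    have "chyp p q (of_real (w + x)) = chyp p q (of_real w) + g (of_real w) * of_real x
        + f (of_real (w + x)) * of_real (x\<^sup>2)"
      unfolding 1 2 by (simp add: algebra_simps power2_eq_square)
    from arg_cong[OF this, of Re] show ?thesis
      by (simp only: chyp_of_real plus_complex.sel Re_complex_of_real times_complex.sel Im_complex_of_real mult_zero_right diff_zero)
  qed
  with k show ?thesis
    by (intro exI[of _ "Re (g (of_real w))"] exI[of _ "\<lambda>x. Re (f (of_real (w + x)))"] exI[of _ "Re (f (of_real w))"]) simp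
qed

text \<open>The strict bound says that the outer mean increases strictly in both arguments. For p
  \<noteq> q the terms 1 / w cancel, and the mean value theorem in the parameter reduces the
  derivative to that of the diagonal case.\<close>

lemma DERIV_hyp_bound:
  assumes "p > 0" "q > 0" "w > 0"
  shows "\<exists>D. (hyp p q has_real_derivative D) (at w) \<and> \<bar>D\<bar> < 1"
proof -
  define \<phi>' where "\<phi>' = (\<lambda>s. cosh (s * w) / sinh (s * w) - s * w / (sinh (s * w))\<^sup>2)"
  have b: "\<bar>\<phi>' s\<bar> < 1" if "s > 0" for s
    using coth_slope_bounds[of "s * w"] that assms by (simp add: \<phi>'_def)
  have coth: "((\<lambda>x. cosh x / sinh x) has_real_derivative - (1 / (sinh x)\<^sup>2)) (at x)" if "x > 0" for x :: real
    using that by (auto intro!: derivative_eq_intros simp: power2_eq_square field_simps cosh_square_eq[unfolded power2_eq_square])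
  \<comment> \<open>Used twice: with t as the variable w on the diagonal, and with t as the
    parameter s when \<open>\<phi>\<close> is differentiated.\<close>
  have dcoth: "((\<lambda>t. t * (cosh (u * t) / sinh (u * t))) has_real_derivative
      cosh (u * v) / sinh (u * v) - u * v / (sinh (u * v))\<^sup>2) (at v)" if "u > 0" "v > 0" for u v :: real
  proof -
    have "((\<lambda>t. cosh (u * t) / sinh (u * t)) has_real_derivative - (1 / (sinh (u * v))\<^sup>2) * u) (at v)"
      by (rule DERIV_chain2[OF coth]) (use that in \<open>auto intro!: derivative_eq_intros\<close>)
    from DERIV_mult[OF DERIV_ident this] show ?thesis
      by (rule DERIV_cong) (simp add: mult_ac)
  qed
  show ?thesis
  proof (cases "p = q")
    case True
    have "((\<lambda>t. t * (cosh (p * t) / sinh (p * t)) - 1 / p) has_real_derivative \<phi>' p) (at w)"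
      using DERIV_diff[OF dcoth[OF assms(1,3)] DERIV_const] by (simp add: \<phi>'_def)
    then have "(hyp p q has_real_derivative \<phi>' p) (at w)"
      by (rule has_field_derivative_transform_within[where d = w])
         (use True assms in \<open>auto simp: hyp_def dist_real_def\<close>)
    then show ?thesis using b assms by blast
  next
    case False
    have main: "\<exists>D. (hyp p q has_real_derivative D) (at w) \<and> \<bar>D\<bar> < 1" if pq: "p > q" "q > 0" for p q
    proof -
      define \<phi> where "\<phi> = (\<lambda>s. s * (cosh (s * w) / sinh (s * w)))"
      have d\<phi>: "(\<phi> has_real_derivative \<phi>' s) (at s)" if "s > 0" for s
        using dcoth[OF assms(3) that] unfolding \<phi>_def \<phi>'_def by (simp add: mult.commute)
      obtain z where z: "q < z" "z < p" "\<phi> p - \<phi> q = (p - q) * \<phi>' z"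
        using MVT2[OF pq(1), of \<phi> \<phi>'] d\<phi> pq(2) by force
      have l: "((\<lambda>t. lsinh (s * t)) has_real_derivative \<phi> s - 1 / w) (at w)" if "s > 0" for s
      proof -
        have "((\<lambda>t. lsinh (s * t)) has_real_derivative (cosh (s * w) / sinh (s * w) - 1 / (s * w)) * s) (at w)"
          by (rule DERIV_chain2[where f = lsinh and g = "\<lambda>t. s * t" and x = w])
             (use that assms in \<open>auto intro!: DERIV_lsinh derivative_eq_intros\<close>)
        then show ?thesis by (rule DERIV_cong) (use that assms in \<open>simp add: \<phi>_def field_simps\<close>)
      qed
      have "((\<lambda>t. (lsinh (p * t) - lsinh (q * t)) / (p - q)) has_real_derivative ((\<phi> p - 1 / w) - (\<phi> q - 1 / w)) / (p - q)) (at w)"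
        using that by (intro DERIV_cdivide DERIV_diff l) auto
      also have "((\<phi> p - 1 / w) - (\<phi> q - 1 / w)) / (p - q) = \<phi>' z"
        using that z by (simp add: field_simps)
      also have "(\<lambda>t. (lsinh (p * t) - lsinh (q * t)) / (p - q)) = hyp p q"
        using that by (simp add: hyp_def fun_eq_iff)
      finally show ?thesis using b[of z] z that by auto
    qed
    have "hyp q p = hyp p q" by (simp add: hyp_commute fun_eq_iff)
    then show ?thesis using main[of p q] main[of q p] False assms by (cases "p > q") auto
  qed
qed

lemma hyp_expansion_bound:
  assumes "p > 0" "q > 0"
    and ex: "\<And>x. hyp p q (w + x) = hyp p q w + h1 * x + k x * x\<^sup>2" and k: "(k \<longlongrightarrow> k0) (at 0)"
  shows "\<bar>h1\<bar> < 1"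
proof -
  have quot: "((\<lambda>x. (hyp p q (w + x) - hyp p q w) / x) \<longlongrightarrow> h1) (at 0)"
  proof -
    have "((\<lambda>x. h1 + k x * x) \<longlongrightarrow> h1 + k0 * 0) (at 0)"
      by (intro tendsto_intros k)
    then have "((\<lambda>x. h1 + k x * x) \<longlongrightarrow> h1) (at 0)" by simp
    then show ?thesis
    proof (rule Lim_transform_eventually)
      show "\<forall>\<^sub>F x in at 0. h1 + k x * x = (hyp p q (w + x) - hyp p q w) / x"
        unfolding ex
        by (intro eventually_mono[OF eventually_neq_at_within[of 0]]) (auto simp: field_simps power2_eq_square)
    qed
  qed
  then have D: "(hyp p q has_real_derivative h1) (at w)"
    by (simp add: DERIV_def)
  consider "w > 0" | "w = 0" | "- w > 0" by linarith
  then show ?thesis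
  proof cases
    case 1
    then show ?thesis using DERIV_hyp_bound[OF assms(1,2) 1] DERIV_unique[OF D] by blast
  next
    case 2
    \<comment> \<open>\<open>hyp\<close> is of second order at 0, so its derivative there
      vanishes.\<close>
    have "((\<lambda>x. hyp p q x / x\<^sup>2 * x) \<longlongrightarrow> (p + q) / 6 * 0) (at_right 0)"
      by (intro tendsto_mult hyp_small tendsto_ident_at)
    then have "((\<lambda>x. hyp p q x / x) \<longlongrightarrow> 0) (at_right 0)"
      by (rule Lim_transform_eventually[OF tendsto_eq_rhs])
         (auto simp: eventually_at_filter power2_eq_square)
    moreover have "((\<lambda>x. hyp p q x / x) \<longlongrightarrow> h1) (at_right 0)"
      using quot 2 by (simp add: filterlim_at_split)
    ultimately have "h1 = 0" by (meson tendsto_unique trivial_limit_at_right_real)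
    then show ?thesis by simp
  next
    case 3
    have "((\<lambda>x. hyp p q (- x)) has_real_derivative - h1) (at (- w))"
      using DERIV_mirror[of "hyp p q" h1 "- w"] D by simp
    then have "(hyp p q has_real_derivative - h1) (at (- w))"
      by (simp add: hyp_even)
    then show ?thesis using DERIV_hyp_bound[OF assms(1,2) 3] DERIV_unique by fastforce
  qed
qed

text \<open>The half difference of the inner means tends to the constant w = (C - A) / 2. Expanding
  the outer mean at w yields l = (1 + h1) / 2, and |h1| < 1 makes both weights positive.\<close>

lemma infinity_expansion:
  assumes eq: "\<And>t. gmean p q (hyp a b t) (hyp c d t) = hyp p q t"
    and pos: "p > 0" "q > 0" "a > 0" "b > 0" "c > 0" "d > 0"
  obtains l k k0 where "0 < l" "l < 1" "(k \<longlongrightarrow> k0) at_top"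
    "\<forall>\<^sub>F t in at_top. mrest p q t = l * mrest a b t + (1 - l) * mrest c d t
        + k t * (mrest a b t - mrest c d t)\<^sup>2"
proof -
  define A C where "A = mconst a b" and "C = mconst c d"
  define w where "w = (C - A) / 2"
  define x where "x = (\<lambda>t. (mrest a b t - mrest c d t) / 2)"
  obtain h1 k k0 where ex: "\<And>x. hyp p q (w + x) = hyp p q w + h1 * x + k x * x\<^sup>2"
    and k: "(k \<longlongrightarrow> k0) (at 0)" "k 0 = k0"
    using hyp_expansion[of p q w] by blast
  have h1: "\<bar>h1\<bar> < 1" by (rule hyp_expansion_bound[OF pos(1,2) ex k(1)])
  have r0: "(mrest a b \<longlongrightarrow> 0) at_top" "(mrest c d \<longlongrightarrow> 0) at_top" "(mrest p q \<longlongrightarrow> 0) at_top"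
    using pos by (auto intro: mrest_tendsto_0)
  have x0: "(x \<longlongrightarrow> 0) at_top"
    unfolding x_def using tendsto_divide[OF tendsto_diff[OF r0(1,2)] tendsto_const[of 2]] by simp
  have "isCont k 0" using k by (simp add: isCont_def)
  then have kx: "((\<lambda>t. k (x t)) \<longlongrightarrow> k0) at_top"
    using isCont_tendsto_compose[of 0 k x at_top] x0 k(2) by simp
  \<comment> \<open>M collects the constants of both sides; all other terms tend to 0, so M =
    0.\<close>
  define M where "M = - mconst p q - (- A - C) / 2 - hyp p q w"
  have key: "\<forall>\<^sub>F t in at_top. M + mrest p q t = (mrest a b t + mrest c d t) / 2 + h1 * x t + k (x t) * (x t)\<^sup>2"
    using eventually_gt_at_top[of 0]
  proof eventually_elim
    case (elim t)
    have "(hyp a b t - hyp c d t) / 2 = w + x t"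
      using elim pos by (simp add: hyp_eq_mrest w_def x_def A_def C_def field_simps)
    then have "hyp p q t = (hyp a b t + hyp c d t) / 2 + (hyp p q w + h1 * x t + k (x t) * (x t)\<^sup>2)"
      using eq[of t] by (simp only: gmean_def ex)
    then show ?case
      using elim pos by (simp add: hyp_eq_mrest M_def A_def C_def field_simps)
  qed
  have l1: "((\<lambda>t. M + mrest p q t) \<longlongrightarrow> M + 0) at_top"
    by (intro tendsto_intros r0)
  have l2: "((\<lambda>t. (mrest a b t + mrest c d t) / 2 + h1 * x t + k (x t) * (x t)\<^sup>2) \<longlongrightarrow> (0 + 0) / 2 + h1 * 0 + k0 * 0\<^sup>2) at_top"
    by (intro tendsto_intros r0 x0 kx) auto
  have M: "M = 0"
    using tendsto_unique[OF _ Lim_transform_eventually[OF l1 key] l2] by simp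
  show ?thesis
  proof (rule that)
    show "0 < (1 + h1) / 2" "(1 + h1) / 2 < 1" using h1 by auto
    show "((\<lambda>t. k (x t) / 4) \<longlongrightarrow> k0 / 4) at_top" by (intro tendsto_intros kx) auto
    show "\<forall>\<^sub>F t in at_top. mrest p q t = (1 + h1) / 2 * mrest a b t + (1 - (1 + h1) / 2) * mrest c d t
        + k (x t) / 4 * (mrest a b t - mrest c d t)\<^sup>2"
      using key
    proof eventually_elim
      case (elim t)
      have "(x t)\<^sup>2 = (mrest a b t - mrest c d t)\<^sup>2 / 4"
        by (simp add: x_def power_divide)
      moreover have "(mrest a b t + mrest c d t) / 2 + h1 * x t
          = (1 + h1) / 2 * mrest a b t + (1 - (1 + h1) / 2) * mrest c d t"
        by (simp add: x_def field_simps)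
      ultimately show ?case using elim M by simp
    qed
  qed
qed

text \<open>The rests are positive and their difference tends to 0, so half of the linear part
  absorbs the square.\<close>

lemma infinity_lower_bound:
  assumes "0 < l" "l < 1" "(k \<longlongrightarrow> k0) at_top"
    and pos: "a > 0" "b > 0" "c > 0" "d > 0"
    and ex: "\<forall>\<^sub>F t in at_top. f t = l * mrest a b t + (1 - l) * mrest c d t
        + k t * (mrest a b t - mrest c d t)\<^sup>2"
  obtains \<mu> where "\<mu> > 0" "\<forall>\<^sub>F t in at_top. \<mu> * (mrest a b t + mrest c d t) \<le> f t"
proof -
  define \<mu> where "\<mu> = min l (1 - l) / 2"
  have \<mu>: "\<mu> > 0" "2 * \<mu> \<le> l" "2 * \<mu> \<le> 1 - l" using assms(1,2) by (auto simp: \<mu>_def)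
  have "((\<lambda>t. \<bar>k t * (mrest a b t - mrest c d t)\<bar>) \<longlongrightarrow> \<bar>k0 * (0 - 0)\<bar>) at_top"
    by (intro tendsto_intros assms(3) mrest_tendsto_0 pos)
  then have small: "\<forall>\<^sub>F t in at_top. \<bar>k t * (mrest a b t - mrest c d t)\<bar> < \<mu>"
    using \<mu>(1) by (intro order_tendstoD) auto
  have "\<forall>\<^sub>F t in at_top. \<mu> * (mrest a b t + mrest c d t) \<le> f t"
    using ex small eventually_gt_at_top[of 0]
  proof eventually_elim
    case (elim t)
    define y z where "y = mrest a b t" and "z = mrest c d t"
    have yz: "y > 0" "z > 0" using mrest_pos pos elim by (auto simp: y_def z_def)
    have "\<bar>k t * (y - z)\<^sup>2\<bar> = \<bar>k t * (y - z)\<bar> * \<bar>y - z\<bar>"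
      by (simp add: abs_mult power2_eq_square)
    also have "\<dots> \<le> \<mu> * (y + z)"
      using elim yz by (intro mult_mono) (auto simp: y_def z_def)
    finally have "- (\<mu> * (y + z)) \<le> k t * (y - z)\<^sup>2" by linarith
    moreover have "2 * \<mu> * y \<le> l * y" "2 * \<mu> * z \<le> (1 - l) * z"
      using \<mu> yz by (auto intro: mult_right_mono)
    ultimately show ?case using elim by (simp add: y_def z_def distrib_left)
  qed
  with \<mu>(1) show ?thesis by (rule that)
qed

text \<open>By the lower bound neither inner rest can decay more slowly than the outer one, whose
  rate is q.\<close>

lemma infinity_exponents:
  assumes eq: "\<And>t. gmean p q (hyp a b t) (hyp c d t) = hyp p q t"
    and pos: "0 < q" "q \<le> p" "0 < b" "b \<le> a" "0 < d" "d \<le> c"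
  shows "q \<le> b \<and> q \<le> d"
proof -
  have p: "p > 0" "a > 0" "c > 0" using pos by auto
  obtain l k k0 where *: "0 < l" "l < 1" "(k \<longlongrightarrow> k0) at_top"
    "\<forall>\<^sub>F t in at_top. mrest p q t = l * mrest a b t + (1 - l) * mrest c d t
        + k t * (mrest a b t - mrest c d t)\<^sup>2"
    by (rule infinity_expansion[OF eq p(1) pos(1) p(2) pos(3) p(3) pos(5)])
  obtain \<mu> where \<mu>: "\<mu> > 0" and bd: "\<forall>\<^sub>F t in at_top. \<mu> * (mrest a b t + mrest c d t) \<le> mrest p q t"
    by (rule infinity_lower_bound[OF *(1,2,3) p(2) pos(3) p(3) pos(5) *(4)])
  have "s < b \<and> s < d" if "s < q" for s
  proof -
    have lim: "((\<lambda>t. mrest p q t * exp (2 * s * t) / \<mu>) \<longlongrightarrow> 0) at_top"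
      using tendsto_divide[OF mrest_small[OF pos(1,2) that] tendsto_const[of \<mu>]] \<mu> by simp
    have bd': "\<forall>\<^sub>F t in at_top. mrest a b t * exp (2 * s * t) \<ge> 0 \<and> mrest c d t * exp (2 * s * t) \<ge> 0
        \<and> (mrest a b t + mrest c d t) * exp (2 * s * t) \<le> mrest p q t * exp (2 * s * t) / \<mu>"
      using bd eventually_gt_at_top[of 0]
    proof eventually_elim
      case (elim t)
      have "mrest a b t > 0" "mrest c d t > 0" using mrest_pos pos p elim by auto
      moreover have "mrest a b t + mrest c d t \<le> mrest p q t / \<mu>"
        using elim \<mu> by (simp add: field_simps)
      then have "(mrest a b t + mrest c d t) * exp (2 * s * t) \<le> mrest p q t / \<mu> * exp (2 * s * t)"
        by (rule mult_right_mono) simp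
      ultimately show ?case by simp
    qed
    have "((\<lambda>t. mrest a b t * exp (2 * s * t)) \<longlongrightarrow> 0) at_top"
      by (rule tendsto_sandwich[OF _ _ tendsto_const lim])
         (use bd' in \<open>eventually_elim; simp add: distrib_right\<close>)+
    moreover have "((\<lambda>t. mrest c d t * exp (2 * s * t)) \<longlongrightarrow> 0) at_top"
      by (rule tendsto_sandwich[OF _ _ tendsto_const lim])
         (use bd' in \<open>eventually_elim; simp add: distrib_right\<close>)+
    ultimately show ?thesis
      using mrest_limit_cases[OF pos(3,4), of s 0] mrest_limit_cases[OF pos(5,6), of s 0] by auto
  qed
  then show ?thesis by (meson dense not_le less_irrefl less_trans)
qed

text \<open>The rate q is matched by \<open>mrest c d\<close> alone, which fixes d = q and c. After
  removing this contribution the next rate c is matched by \<open>mrest a b\<close>, which forces a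
  = p.\<close>

lemma infinity_first_order:
  assumes eq: "\<And>t. gmean p q (hyp a b t) (hyp c d t) = hyp p q t"
    and pos: "0 < q" "q < p" "q < b" "b \<le> a" "0 < d" "d \<le> c"
    and gap: "a - b \<le> q" "p < a" and sum: "a + b + c + d = 2 * (p + q)"
  shows False
proof -
  have p: "p > 0" "a > 0" "b > 0" "c > 0" using pos by auto
  obtain l k k0 where l: "0 < l" "l < 1" and k: "(k \<longlongrightarrow> k0) at_top" and
    ex: "\<forall>\<^sub>F t in at_top. mrest p q t = l * mrest a b t + (1 - l) * mrest c d t
        + k t * (mrest a b t - mrest c d t)\<^sup>2"
    by (rule infinity_expansion[OF eq p(1) pos(1) p(2,3,4) pos(5)])
  have "q \<le> d" using infinity_exponents[OF eq pos(1) _ p(3) pos(4,5,6)] pos by auto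
  \<comment> \<open>Each rest beats exp (- 2 * s * t) for s < q, hence the square does so for s < 2
    * q.\<close>
  have quad: "((\<lambda>t. k t * (mrest a b t - mrest c d t)\<^sup>2 * exp (2 * s * t)) \<longlongrightarrow> 0) at_top" if "s < 2 * q" for s
  proof -
    have "((\<lambda>t. k t * (mrest a b t * exp (2 * (s / 2) * t) - mrest c d t * exp (2 * (s / 2) * t))\<^sup>2) \<longlongrightarrow> k0 * (0 - 0)\<^sup>2) at_top"
      using that pos \<open>q \<le> d\<close> by (intro tendsto_intros k mrest_small) auto
    moreover have "(y * exp (2 * (s / 2) * t) - z * exp (2 * (s / 2) * t))\<^sup>2 = (y - z)\<^sup>2 * exp (2 * s * t)" for y z t
      by (simp add: left_diff_distrib[symmetric] power_mult_distrib) (simp add: power2_eq_square flip: exp_add)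
    ultimately show ?thesis by (simp add: mult.assoc)
  qed
  have "((\<lambda>t. (mrest p q t * exp (2 * q * t) - l * (mrest a b t * exp (2 * q * t))
      - k t * (mrest a b t - mrest c d t)\<^sup>2 * exp (2 * q * t)) / (1 - l)) \<longlongrightarrow> (1 / (p - q) - l * 0 - 0) / (1 - l)) at_top"
    using pos l by (intro tendsto_divide tendsto_diff tendsto_mult tendsto_const mrest_exact mrest_small quad) auto
  moreover have "\<forall>\<^sub>F t in at_top. (mrest p q t * exp (2 * q * t) - l * (mrest a b t * exp (2 * q * t))
      - k t * (mrest a b t - mrest c d t)\<^sup>2 * exp (2 * q * t)) / (1 - l) = mrest c d t * exp (2 * q * t)"
    using ex
  proof eventually_elim
    case (elim t)
    show ?case unfolding elim using l by (simp add: field_simps)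
  qed
  ultimately have "((\<lambda>t. mrest c d t * exp (2 * q * t)) \<longlongrightarrow> (1 / (p - q) - l * 0 - 0) / (1 - l)) at_top"
    by (rule Lim_transform_eventually)
  from mrest_limit_cases[OF pos(5,6) this] have d: "q = d" "d < c" and c: "1 / (p - q) / (1 - l) = 1 / (c - d)"
    using pos l by auto
  have f: "c - q = (1 - l) * (p - q)"
    using c d l pos by (simp add: field_simps)
  have "(1 - l) * (p - q) < 1 * (p - q)"
    using l pos by (intro mult_strict_right_mono) auto
  then have cp: "c < p" using f by simp
  show False
  proof (cases "c < 2 * q")
    case False
    \<comment> \<open>Together with b >= a - q, a > p and d = q this pushes the sum of the
      parameters above 2 * (p + q).\<close>
    then have "2 * q \<le> c" by simp
    with gap sum d(1) show False by argo
  next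
    case True
    have "((\<lambda>t. ((p - c) / (p - q) * (mrest p c t * exp (2 * c * t))
        - k t * (mrest a b t - mrest c d t)\<^sup>2 * exp (2 * c * t)) / l) \<longlongrightarrow> ((p - c) / (p - q) * (1 / (p - c)) - 0) / l) at_top"
      using pos l cp p True by (intro tendsto_divide tendsto_diff tendsto_mult tendsto_const mrest_exact quad) auto
    moreover have "\<forall>\<^sub>F t in at_top. ((p - c) / (p - q) * (mrest p c t * exp (2 * c * t))
        - k t * (mrest a b t - mrest c d t)\<^sup>2 * exp (2 * c * t)) / l = mrest a b t * exp (2 * c * t)"
      using ex
    proof eventually_elim
      case (elim t)
      \<comment> \<open>In this divided difference identity the terms of rate q cancel, leaving the
        rate c.\<close>
      have "(p - c) / (p - q) * mrest p c t = mrest p q t - (c - q) / (p - q) * mrest c q t"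
      proof -
        have "(p - c) / (p - q) * ((P - C) / (p - c)) = (P - Q) / (p - q) - (c - q) / (p - q) * ((C - Q) / (c - q))" for P Q C
          using pos cp d by (simp add: diff_divide_distrib[symmetric])
        then show ?thesis using pos cp d by (simp only: mrest_def) auto
      qed
      also have "(c - q) / (p - q) = 1 - l" using f pos by simp
      finally have "(p - c) / (p - q) * mrest p c t = l * mrest a b t + k t * (mrest a b t - mrest c d t)\<^sup>2"
        using elim d by simp
      then have "(p - c) / (p - q) * mrest p c t - k t * (mrest a b t - mrest c d t)\<^sup>2 = l * mrest a b t"
        by simp
      then show ?case using l
        by (simp only: mult.assoc[symmetric] left_diff_distrib[symmetric]) simp
    qed
    ultimately have "((\<lambda>t. mrest a b t * exp (2 * c * t)) \<longlongrightarrow> ((p - c) / (p - q) * (1 / (p - c)) - 0) / l) at_top"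
      by (rule Lim_transform_eventually)
    from mrest_limit_cases[OF p(3) pos(4) this] have b: "c = b" "b < a" "1 / (p - q) / l = 1 / (a - b)"
      using pos l cp by auto
    then have "a - b = l * (p - q)" using l pos by (simp add: field_simps)
    then have "a = p" using f b(1) by (simp add: algebra_simps)
    then show False using gap by simp
  qed
qed

subsection \<open>The invariance equation at the first singularity\<close>

lemma trig_div_ln_pole:
  assumes "a \<noteq> 0"
  shows "filterlim (\<lambda>e. sgn a * (trig a a (pi / \<bar>a\<bar> - e) / ln e)) at_top (at_right 0)"
proof -
  have "((\<lambda>e. - sgn a * (trig a a (pi / \<bar>a\<bar> - e) * e)) \<longlongrightarrow> - sgn a * - (pi / (a * \<bar>a\<bar>))) (at_right 0)"
    by (intro tendsto_mult tendsto_const trig_singular_pole assms)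
  moreover have "- sgn a * - (pi / (a * \<bar>a\<bar>)) > 0"
    using assms by (cases a "0::real" rule: linorder_cases) (auto simp: zero_less_divide_iff mult_neg_neg)
  moreover have "filterlim (\<lambda>e::real. - (1 / (e * ln e))) at_top (at_right 0)"
    by real_asymp
  ultimately have "filterlim (\<lambda>e. - sgn a * (trig a a (pi / \<bar>a\<bar> - e) * e) * - (1 / (e * ln e))) at_top (at_right 0)"
    by (rule filterlim_tendsto_pos_mult_at_top)
  moreover have "\<forall>\<^sub>F e in at_right 0. - sgn a * (trig a a (pi / \<bar>a\<bar> - e) * e) * - (1 / (e * ln e))
      = sgn a * (trig a a (pi / \<bar>a\<bar> - e) / ln e)"
    using eventually_at_right_less[of 0] by eventually_elim simp
  ultimately show ?thesis by (subst (asm) filterlim_cong[OF refl refl])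
qed

lemma minus_ln_at_top: "filterlim (\<lambda>e::real. - ln e) at_top (at_right 0)"
  using ln_at_0 by (simp add: filterlim_uminus_at_bot)

text \<open>A positive dominant parameter makes the continued mean tend to 0 at its singularity, a
  negative one makes it tend to infinity.\<close>

lemma trig_unbounded:
  assumes "\<bar>b\<bar> \<le> \<bar>a\<bar>" "a + b \<noteq> 0"
  shows "filterlim (\<lambda>e. sgn a * trig a b (pi / \<bar>a\<bar> - e)) at_bot (at_right 0)"
proof -
  have neg: "\<forall>\<^sub>F e in at_right 0. ln e < (0::real)"
    using eventually_at_right_real[OF zero_less_one] by eventually_elim (auto simp: ln_less_zero)
  have "filterlim (\<lambda>e. sgn a * (trig a b (pi / \<bar>a\<bar> - e) / ln e) * ln e) at_bot (at_right 0)"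
  proof (cases "b = a")
    case True
    have "filterlim (\<lambda>e. sgn a * (trig a a (pi / \<bar>a\<bar> - e) / ln e) * - ln e) at_top (at_right 0)"
      by (rule filterlim_at_top_mult_at_top[OF trig_div_ln_pole minus_ln_at_top]) (use assms True in auto)
    then show ?thesis using True by (simp add: filterlim_uminus_at_bot)
  next
    case False
    then have b: "\<bar>b\<bar> < \<bar>a\<bar>" using assms by linarith
    have "((\<lambda>e. sgn a * (trig a b (pi / \<bar>a\<bar> - e) / ln e)) \<longlongrightarrow> sgn a * (1 / (a - b))) (at_right 0)"
      by (intro tendsto_mult tendsto_const trig_singular_log b)
    moreover have "sgn a * (1 / (a - b)) > 0"
      using b by (cases "a > 0") (auto simp: sgn_if)
    ultimately show ?thesis
      by (rule filterlim_tendsto_pos_mult_at_bot[OF _ _ ln_at_0])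
  qed
  moreover have "\<forall>\<^sub>F e in at_right 0. sgn a * (trig a b (pi / \<bar>a\<bar> - e) / ln e) * ln e = sgn a * trig a b (pi / \<bar>a\<bar> - e)"
    using neg by eventually_elim simp
  ultimately show ?thesis by (subst (asm) filterlim_cong[OF refl refl])
qed

lemma trig_at_left_limit:
  assumes "\<bar>a\<bar> * s < pi" "\<bar>b\<bar> * s < pi" "s \<ge> 0"
  shows "((\<lambda>e. trig a b (s - e)) \<longlongrightarrow> trig a b s) (at_right 0)"
  using assms by (intro tendsto_left_shift isCont_trig) (auto simp: abs_mult)

lemma tendsto_gmean:
  assumes "(u \<longlongrightarrow> x) F" "(v \<longlongrightarrow> y) F"
  shows "((\<lambda>t. gmean p q (u t) (v t)) \<longlongrightarrow> gmean p q x y) F"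
proof -
  have "((\<lambda>t. (u t + v t) / 2 + hyp p q ((u t - v t) / 2)) \<longlongrightarrow> (x + y) / 2 + hyp p q ((x - y) / 2)) F"
    by (intro tendsto_intros assms isCont_tendsto_compose[OF isCont_hyp]) auto
  then show ?thesis by (simp add: gmean_def)
qed

text \<open>
  The first parameter of each inner mean has the larger modulus, so that it determines the first
  singularity. A geometric mean is represented by the parameters 0 and 0: for \<open>b = - a\<close> the
  singularities of the two terms of \<open>trig a b\<close> cancel.
\<close>

locale invariance =
  fixes a b c d p q :: real
  assumes eq: "\<And>t. gmean p q (hyp a b t) (hyp c d t) = hyp p q t"
    and pq: "p + q > 0" "q \<le> p"
    and ab: "a = 0 \<and> b = 0 \<or> \<bar>b\<bar> \<le> \<bar>a\<bar> \<and> a + b \<noteq> 0"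
    and cd: "c = 0 \<and> d = 0 \<or> \<bar>d\<bar> \<le> \<bar>c\<bar> \<and> c + d \<noteq> 0"
    and dom: "\<bar>c\<bar> \<le> \<bar>a\<bar>"
begin

text \<open>e is the distance to the first inner singularity pi / |a|, approached from
  below.\<close>

abbreviation U :: "real \<Rightarrow> real" where "U e \<equiv> trig a b (pi / \<bar>a\<bar> - e)"
abbreviation V :: "real \<Rightarrow> real" where "V e \<equiv> trig c d (pi / \<bar>a\<bar> - e)"
abbreviation R :: "real \<Rightarrow> real" where "R e \<equiv> trig p q (pi / \<bar>a\<bar> - e)"

lemma sum: "a + b + c + d = 2 * (p + q)"
  by (rule sum_identity[OF eq])

lemma p_pos: "p > 0" and q_abs: "\<bar>q\<bar> \<le> p"
  using pq by linarith+

lemma a_nz: "a \<noteq> 0"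
  using sum pq ab cd dom by auto

lemma ab': "\<bar>b\<bar> \<le> \<bar>a\<bar>" "a + b \<noteq> 0"
  using ab a_nz by auto

lemma b_cases: "b = a \<or> \<bar>b\<bar> < \<bar>a\<bar>"
  using ab' by linarith

lemma d_le: "\<bar>d\<bar> \<le> \<bar>c\<bar>"
  using cd by auto

lemma d_cases: "c \<noteq> 0 \<Longrightarrow> d = c \<or> \<bar>d\<bar> < \<bar>c\<bar>"
  using cd by linarith

lemma swapped: "\<bar>c\<bar> = \<bar>a\<bar> \<Longrightarrow> invariance c d a b p q"
  using eq pq ab cd by unfold_locales (auto simp: gmean_swap)

lemma trig_eq:
  assumes "0 \<le> s" "p * s < pi" "\<bar>a\<bar> * s < pi"
  shows "gmean p q (trig a b s) (trig c d s) = trig p q s"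
proof (rule trig_identity[OF eq _ assms(1)])
  fix r assume "r \<in> {a, b, c, d, p, q}"
  then have "\<bar>r\<bar> \<le> p \<or> \<bar>r\<bar> \<le> \<bar>a\<bar>"
    using ab' d_le dom q_abs p_pos by auto
  then show "\<bar>r\<bar> * s < pi"
    using assms mult_right_mono[of "\<bar>r\<bar>" p s] mult_right_mono[of "\<bar>r\<bar>" "\<bar>a\<bar>" s] by auto
qed

text \<open>Otherwise pi / p would come before every inner singularity: the left side converges
  there and the right side tends to minus infinity.\<close>

lemma p_le: "p \<le> \<bar>a\<bar>"
proof (rule ccontr)
  assume "\<not> p \<le> \<bar>a\<bar>"
  then have ap: "\<bar>a\<bar> < p" by simp
  define s where "s = pi / p"
  have s: "s > 0" "p * s = pi" using p_pos by (auto simp: s_def)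
  have small: "\<bar>r\<bar> * s < pi" if "\<bar>r\<bar> \<le> \<bar>a\<bar>" for r
    using mult_strict_right_mono[of "\<bar>r\<bar>" p s] that ap s by simp
  have "((\<lambda>e. gmean p q (trig a b (s - e)) (trig c d (s - e))) \<longlongrightarrow> gmean p q (trig a b s) (trig c d s)) (at_right 0)"
    by (intro tendsto_gmean trig_at_left_limit small) (use ab' d_le dom s in auto)
  moreover have "\<forall>\<^sub>F e in at_right 0. gmean p q (trig a b (s - e)) (trig c d (s - e)) = trig p q (s - e)"
    using eventually_at_right_real[OF s(1)]
  proof eventually_elim
    case (elim e)
    have 1: "p * (s - e) < pi" using elim s p_pos by (simp add: right_diff_distrib)
    have 2: "\<bar>a\<bar> * (s - e) \<le> p * (s - e)" using ap elim by (intro mult_right_mono) auto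
    show ?case by (rule trig_eq[OF _ 1 order.strict_trans1[OF 2 1]]) (use elim in simp)
  qed
  ultimately have "((\<lambda>e. trig p q (s - e)) \<longlongrightarrow> gmean p q (trig a b s) (trig c d s)) (at_right 0)"
    by (rule Lim_transform_eventually)
  moreover have "filterlim (\<lambda>e. trig p q (s - e)) at_bot (at_right 0)"
    using trig_unbounded[of q p] pq p_pos q_abs by (simp add: s_def)
  ultimately show False by (rule tendsto_at_bot_contra[rotated]) simp
qed

lemma mean_identity: "\<forall>\<^sub>F e in at_right 0. gmean p q (U e) (V e) = R e"
proof -
  have "pi / \<bar>a\<bar> > 0" using a_nz by simp
  from eventually_at_right_real[OF this] show ?thesis
  proof eventually_elim
    case (elim e)
    have 1: "\<bar>a\<bar> * (pi / \<bar>a\<bar> - e) < pi" using elim a_nz by (simp add: right_diff_distrib)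
    have 2: "p * (pi / \<bar>a\<bar> - e) \<le> \<bar>a\<bar> * (pi / \<bar>a\<bar> - e)"
      using p_le elim by (intro mult_right_mono) auto
    show ?case by (rule trig_eq[OF _ order.strict_trans1[OF 2 1] 1]) (use elim in simp)
  qed
qed

lemma small_param: "\<bar>r\<bar> < \<bar>a\<bar> \<Longrightarrow> \<bar>r\<bar> * (pi / \<bar>a\<bar>) < pi"
  using a_nz by (simp add: field_simps)

lemma R_at_bot: "p = \<bar>a\<bar> \<Longrightarrow> filterlim R at_bot (at_right 0)"
  using trig_unbounded[of q p] pq p_pos q_abs by simp

lemma R_limit: "p < \<bar>a\<bar> \<Longrightarrow> (R \<longlongrightarrow> trig p q (pi / \<bar>a\<bar>)) (at_right 0)"
  using q_abs p_pos by (intro trig_at_left_limit small_param) auto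

lemma V_limit: "\<bar>c\<bar> < \<bar>a\<bar> \<Longrightarrow> (V \<longlongrightarrow> trig c d (pi / \<bar>a\<bar>)) (at_right 0)"
  using d_le by (intro trig_at_left_limit small_param) auto

text \<open>For p < |a| the right side converges at pi / |a|, and for p = |a| it tends to minus
  infinity. So the behaviour of the left side decides between the two.\<close>

lemma p_eq_if_unbounded:
  assumes "filterlim (\<lambda>e. gmean p q (U e) (V e)) at_bot (at_right 0)"
  shows "p = \<bar>a\<bar>"
proof (rule ccontr)
  assume "p \<noteq> \<bar>a\<bar>"
  then have "(R \<longlongrightarrow> trig p q (pi / \<bar>a\<bar>)) (at_right 0)" using p_le by (intro R_limit) simp
  moreover have "filterlim R at_bot (at_right 0)"
    using assms by (subst (asm) filterlim_cong[OF refl refl mean_identity])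
  ultimately show False by (rule tendsto_at_bot_contra[rotated]) simp
qed

lemma gmean_not_at_top: "\<not> filterlim (\<lambda>e. gmean p q (U e) (V e)) at_top (at_right 0)"
proof
  assume "filterlim (\<lambda>e. gmean p q (U e) (V e)) at_top (at_right 0)"
  then have top: "filterlim R at_top (at_right 0)"
    by (subst (asm) filterlim_cong[OF refl refl mean_identity])
  show False
  proof (cases "p = \<bar>a\<bar>")
    case True
    then have "filterlim R at_bot (at_right 0)" by (rule R_at_bot)
    then have "\<forall>\<^sub>F e in at_right 0. R e < 0" by (simp add: filterlim_at_bot_dense)
    moreover have "\<forall>\<^sub>F e in at_right 0. R e > 0" using top by (simp add: filterlim_at_top_dense)
    ultimately have "\<forall>\<^sub>F e in at_right (0::real). False" by eventually_elim simp
    then show False by simp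
  next
    case False
    then have "(R \<longlongrightarrow> trig p q (pi / \<bar>a\<bar>)) (at_right 0)" using p_le by (intro R_limit) simp
    then show False using top by (rule tendsto_at_top_contra[rotated]) simp
  qed
qed

lemma p_less_if_bounded:
  assumes "((\<lambda>e. gmean p q (U e) (V e)) \<longlongrightarrow> L) (at_right 0)"
  shows "p < \<bar>a\<bar>"
proof (rule ccontr)
  assume "\<not> p < \<bar>a\<bar>"
  then have "filterlim R at_bot (at_right 0)" using p_le by (intro R_at_bot) simp
  moreover have "(R \<longlongrightarrow> L) (at_right 0)"
    using assms mean_identity by (rule Lim_transform_eventually)
  ultimately show False using tendsto_at_bot_contra[of "at_right (0::real)" R L] by simp
qed

lemma R_div_ln:
  assumes "q \<noteq> p"
  shows "((\<lambda>e. R e / ln e) \<longlongrightarrow> (if p = \<bar>a\<bar> then 1 / (p - q) else 0)) (at_right 0)"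
proof (cases "p = \<bar>a\<bar>")
  case True
  then show ?thesis using trig_singular_log[of q p] pq assms p_pos by auto
next
  case False
  then show ?thesis using p_le bounded_div_ln[OF R_limit] by simp
qed

lemma gmean_div_ln:
  assumes "q \<noteq> p"
  shows "((\<lambda>e. gmean p q (U e) (V e) / ln e) \<longlongrightarrow> (if p = \<bar>a\<bar> then 1 / (p - q) else 0)) (at_right 0)"
  using R_div_ln[OF assms]
  by (rule Lim_transform_eventually) (use mean_identity in \<open>eventually_elim; simp\<close>)

text \<open>x and y are the exponents of the inner means as powers of e. The growing scale is - ln
  e, so \<open>tendsto_gmean_div\<close> is applied with -x and -y, which puts a minus sign before
  the absolute value.\<close>

lemma balance:
  assumes "q \<noteq> p" and u: "((\<lambda>e. U e / ln e) \<longlongrightarrow> x) (at_right 0)" and v: "((\<lambda>e. V e / ln e) \<longlongrightarrow> y) (at_right 0)"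
  shows "x + y - mslope p q * \<bar>x - y\<bar> = 2 * (if p = \<bar>a\<bar> then 1 / (p - q) else 0)"
proof -
  have "((\<lambda>e. U e / - ln e) \<longlongrightarrow> - x) (at_right 0)" "((\<lambda>e. V e / - ln e) \<longlongrightarrow> - y) (at_right 0)"
    using tendsto_minus[OF u] tendsto_minus[OF v] by simp_all
  from tendsto_gmean_div[OF this minus_ln_at_top, of p q]
  have "((\<lambda>e. gmean p q (U e) (V e) / - ln e) \<longlongrightarrow> (- x + - y + mslope p q * \<bar>- x - - y\<bar>) / 2) (at_right 0)" .
  from tendsto_minus[OF this]
  have "((\<lambda>e. gmean p q (U e) (V e) / ln e) \<longlongrightarrow> - ((- x + - y + mslope p q * \<bar>- x - - y\<bar>) / 2)) (at_right 0)"
    by simp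
  from tendsto_unique[OF _ this gmean_div_ln[OF assms(1)]]
  have "- ((- x + - y + mslope p q * \<bar>- x - - y\<bar>) / 2) = (if p = \<bar>a\<bar> then 1 / (p - q) else 0)" by simp
  moreover have "\<bar>- x - - y\<bar> = \<bar>x - y\<bar>" by linarith
  ultimately show ?thesis by (simp add: field_simps split: if_splits)
qed

lemma U_div_ln: "b \<noteq> a \<Longrightarrow> ((\<lambda>e. U e / ln e) \<longlongrightarrow> 1 / (a - b)) (at_right 0)"
  using b_cases by (intro trig_singular_log) auto

lemma V_div_ln: "\<bar>c\<bar> = \<bar>a\<bar> \<Longrightarrow> d \<noteq> c \<Longrightarrow> ((\<lambda>e. V e / ln e) \<longlongrightarrow> 1 / (c - d)) (at_right 0)"
  using d_cases a_nz trig_singular_log[of d c] by auto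

lemma V_div_ln_0: "\<bar>c\<bar> < \<bar>a\<bar> \<Longrightarrow> ((\<lambda>e. V e / ln e) \<longlongrightarrow> 0) (at_right 0)"
  by (rule bounded_div_ln[OF V_limit])

lemma U_at_bot: "a > 0 \<Longrightarrow> filterlim U at_bot (at_right 0)"
  using trig_unbounded[OF ab'] by simp

lemma U_at_top: "a < 0 \<Longrightarrow> filterlim U at_top (at_right 0)"
  using trig_unbounded[OF ab'] by (simp add: filterlim_uminus_at_bot)

subsection \<open>Outer parameters of opposite signs\<close>

lemma neg_slope: "q < 0 \<Longrightarrow> mslope p q = (p + q) / (p - q)"
  using p_pos by (simp add: mslope_def)

text \<open>With the slope (p + q) / (p - q), the larger exponent receives the weight -q and the
  smaller one the weight p.\<close>

lemma neg_balance:
  assumes "q < 0" "((\<lambda>e. U e / ln e) \<longlongrightarrow> x) (at_right 0)" "((\<lambda>e. V e / ln e) \<longlongrightarrow> y) (at_right 0)" "y \<le> x"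
  shows "- q * x + p * y = (if p = \<bar>a\<bar> then 1 else 0)"
proof -
  have ne: "q \<noteq> p" "p - q > 0" using assms(1) p_pos by auto
  have "(p - q) * (x + y - (p + q) / (p - q) * (x - y)) = (p - q) * (2 * (if p = \<bar>a\<bar> then 1 / (p - q) else 0))"
    using balance[OF ne(1) assms(2,3)] assms(1,4) by (simp add: neg_slope)
  moreover have "(p - q) * (x + y - (p + q) / (p - q) * (x - y)) = (p - q) * (x + y) - (p + q) * (x - y)"
    using ne by (simp add: right_diff_distrib)
  moreover have "(p - q) * (2 * (if P then 1 / (p - q) else 0)) = 2 * (if P then 1 else 0)" for P
    using ne by simp
  ultimately have "(p - q) * (x + y) - (p + q) * (x - y) = 2 * (if p = \<bar>a\<bar> then 1 else 0)"
    by (simp only:)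
  moreover have "(p - q) * (x + y) - (p + q) * (x - y) = 2 * (- q * x + p * y)"
    by (simp add: algebra_simps)
  moreover have "A = 2 * B \<Longrightarrow> A = 2 * C \<Longrightarrow> C = B" for A B C :: real by simp
  ultimately show ?thesis by blast
qed

lemma neg_balance':
  assumes "q < 0" "((\<lambda>e. U e / ln e) \<longlongrightarrow> x) (at_right 0)" "((\<lambda>e. V e / ln e) \<longlongrightarrow> y) (at_right 0)" "x \<le> y"
  shows "- q * y + p * x = (if p = \<bar>a\<bar> then 1 else 0)"
proof -
  have ne: "q \<noteq> p" "p - q > 0" using assms(1) p_pos by auto
  have "(p - q) * (x + y - (p + q) / (p - q) * (y - x)) = (p - q) * (2 * (if p = \<bar>a\<bar> then 1 / (p - q) else 0))"
    using balance[OF ne(1) assms(2,3)] assms(1,4) by (simp add: neg_slope)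
  moreover have "(p - q) * (x + y - (p + q) / (p - q) * (y - x)) = (p - q) * (x + y) - (p + q) * (y - x)"
    using ne by (simp add: right_diff_distrib)
  moreover have "(p - q) * (2 * (if P then 1 / (p - q) else 0)) = 2 * (if P then 1 else 0)" for P
    using ne by simp
  ultimately have "(p - q) * (x + y) - (p + q) * (y - x) = 2 * (if p = \<bar>a\<bar> then 1 else 0)"
    by (simp only:)
  moreover have "(p - q) * (x + y) - (p + q) * (y - x) = 2 * (- q * y + p * x)"
    by (simp add: algebra_simps)
  moreover have "A = 2 * B \<Longrightarrow> A = 2 * C \<Longrightarrow> C = B" for A B C :: real by simp
  ultimately show ?thesis by blast
qed

text \<open>A double parameter makes U grow like 1 / e in modulus, whereas V and the right side grow
  at most like ln e. The slope below 1 prevents the outer mean from hiding U.\<close>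

lemma neg_no_pole:
  assumes q: "q < 0"
  shows "b \<noteq> a"
proof
  assume b: "b = a"
  have "\<exists>y. ((\<lambda>e. V e / ln e) \<longlongrightarrow> y) (at_right 0)"
  proof (cases "\<bar>c\<bar> < \<bar>a\<bar>")
    case True
    then show ?thesis using V_div_ln_0 by blast
  next
    case False
    then have c: "\<bar>c\<bar> = \<bar>a\<bar>" using dom by simp
    \<comment> \<open>Two double parameters would give 2 * |a| = p + q by the sum identity, which
      contradicts p <= |a| and q < 0.\<close>
    have "d \<noteq> c"
    proof
      assume "d = c"
      then have "a + c = p + q" using sum b by simp
      then have "2 * \<bar>a\<bar> = p + q" using c pq by linarith
      then show False using p_le q p_pos by linarith
    qed
    then show ?thesis using V_div_ln c by blast
  qed
  then obtain y where y: "((\<lambda>e. V e / ln e) \<longlongrightarrow> y) (at_right 0)" by blast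
  have neg: "\<forall>\<^sub>F e in at_right 0. ln e < (0::real)"
    using eventually_at_right_real[OF zero_less_one] by eventually_elim (auto simp: ln_less_zero)
  have top: "filterlim (\<lambda>e. sgn a * (U e / ln e)) at_top (at_right 0)"
    using trig_div_ln_pole[OF a_nz] b by simp
  have lim: "((\<lambda>e. gmean p q (U e) (V e) / ln e) \<longlongrightarrow> (if p = \<bar>a\<bar> then 1 / (p - q) else 0)) (at_right 0)"
    using q p_pos by (intro gmean_div_ln) simp
  define k where "k = mslope p q"
  have k: "0 < k" "k < 1" using q pq p_pos by (auto simp: k_def neg_slope)
  show False
  proof (cases "a > 0")
    case True
    then have top': "filterlim (\<lambda>e. U e / ln e) at_top (at_right 0)" using top by simp
    \<comment> \<open>Here U lies below V, and the bound with slope k < 1 leaves U the positive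
      weight (1 - k) / 2. Division by ln e < 0 reverses the inequality.\<close>
    have lb: "\<forall>\<^sub>F e in at_right 0. (1 + k) / 2 * (V e / ln e) + (1 - k) / 2 * (U e / ln e) \<le> gmean p q (U e) (V e) / ln e"
    proof -
      have "\<forall>\<^sub>F e in at_right 0. U e / ln e > y + 1" using top' by (simp add: filterlim_at_top_dense)
      moreover have "\<forall>\<^sub>F e in at_right 0. V e / ln e < y + 1" using y by (rule order_tendstoD) simp
      ultimately show ?thesis using neg
      proof eventually_elim
        case (elim e)
        then have "V e / ln e < U e / ln e" by linarith
        then have uv: "U e < V e" using elim by (simp add: divide_less_cancel)
        have "gmean p q (U e) (V e) \<le> (U e + V e) / 2 + k * \<bar>(U e - V e) / 2\<bar>"
          using hyp_le_slope[of q p "(U e - V e) / 2"] q q_abs by (simp add: gmean_def k_def)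
        also have "\<dots> = (1 + k) / 2 * V e + (1 - k) / 2 * U e"
          using uv by (simp add: field_simps)
        finally have "((1 + k) / 2 * V e + (1 - k) / 2 * U e) / ln e \<le> gmean p q (U e) (V e) / ln e"
          using elim by (intro divide_right_mono_neg) auto
        then show ?case by (simp add: add_divide_distrib)
      qed
    qed
    have "filterlim (\<lambda>e. (1 + k) / 2 * (V e / ln e) + (1 - k) / 2 * (U e / ln e)) at_top (at_right 0)"
      using k by (intro filterlim_tendsto_add_at_top[OF tendsto_mult[OF tendsto_const y]]
        filterlim_tendsto_pos_mult_at_top[OF tendsto_const _ top']) auto
    from tendsto_at_top_contra[OF _ lim filterlim_at_top_mono[OF this lb]] show False by simp
  next
    case False
    then have a: "a < 0" using a_nz by simp
    then have top': "filterlim (\<lambda>e. - (U e / ln e)) at_top (at_right 0)" using top by simp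
    have "filterlim (\<lambda>e. - (V e / ln e) / 2 + 1 / 2 * - (U e / ln e)) at_top (at_right 0)"
      by (intro filterlim_tendsto_add_at_top[OF tendsto_divide[OF tendsto_minus[OF y] tendsto_const]]
        filterlim_tendsto_pos_mult_at_top[OF tendsto_const _ top']) auto
    moreover have "\<forall>\<^sub>F e in at_right 0. - (V e / ln e) / 2 + 1 / 2 * - (U e / ln e) \<le> - (gmean p q (U e) (V e) / ln e)"
      using neg
    proof eventually_elim
      case (elim e)
      have "(U e + V e) / 2 \<le> gmean p q (U e) (V e)"
        using pq by (intro gmean_ge_mean) simp
      then have "gmean p q (U e) (V e) / ln e \<le> (U e + V e) / 2 / ln e"
        using elim by (intro divide_right_mono_neg) auto
      then show ?case by (simp add: add_divide_distrib)
    qed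
    ultimately have "filterlim (\<lambda>e. - (gmean p q (U e) (V e) / ln e)) at_top (at_right 0)"
      by (rule filterlim_at_top_mono)
    from tendsto_at_top_contra[OF _ tendsto_minus[OF lim] this] show False by simp
  qed
qed

text \<open>Only U is singular, so \<open>neg_balance\<close> with y = 0 forces a = p and a - b =
  -q, the configuration of \<open>infinity_opposite_I\<close>.\<close>

lemma neg_dominant:
  assumes q: "q < 0" and c: "\<bar>c\<bar> < \<bar>a\<bar>"
  shows False
proof -
  have b: "b \<noteq> a" by (rule neg_no_pole[OF q])
  then have ba: "\<bar>b\<bar> < \<bar>a\<bar>" using b_cases by simp
  note lims = U_div_ln[OF b] V_div_ln_0[OF c]
  have x: "1 / (a - b) > 0"
  proof (rule ccontr)
    assume "\<not> 1 / (a - b) > 0"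
    then have "1 / (a - b) < 0" using b by (simp add: divide_less_0_iff zero_less_divide_iff)
    then have "p * (1 / (a - b)) < 0" by (rule mult_pos_neg[OF p_pos])
    moreover have "- q * 0 + p * (1 / (a - b)) = (if p = \<bar>a\<bar> then 1 else 0)"
      using \<open>1 / (a - b) < 0\<close> by (intro neg_balance' q lims) simp
    ultimately show False by (simp split: if_splits)
  qed
  have "- q * (1 / (a - b)) + p * 0 = (if p = \<bar>a\<bar> then 1 else 0)"
    using x by (intro neg_balance q lims) simp
  moreover have "- q * (1 / (a - b)) > 0" using q x by (intro mult_pos_pos) auto
  ultimately have *: "p = \<bar>a\<bar>" "- q * (1 / (a - b)) = 1" by (auto split: if_splits)
  have a: "a = p" using * x ba by (simp add: zero_less_divide_iff)
  have bb: "b = p - (- q)" using *(2) b a by (simp add: field_simps)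
  have cd: "(- c) + (- d) = - q" using sum a bb by simp
  have e: "gmean p (- (- q)) (hyp p (p - (- q)) t) (hyp (- (- c)) (- (- d)) t) = hyp p (- (- q)) t" for t
    using eq[of t] unfolding a bb by simp
  have e': "gmean p (- (- q)) (hyp p (p - (- q)) t) (hyp (- (- d)) (- (- c)) t) = hyp p (- (- q)) t" for t
    using e[of t] by (simp add: hyp_commute)
  have pos: "0 < - q" "- q < p" using q pq by auto
  have "- c > 0 \<and> - d > 0"
    by (rule infinity_opposite_params_pos[OF e pos]) (use pq p_pos cd q in auto)
  then show False
    using infinity_opposite_I[OF e pos _ _ cd] infinity_opposite_I[OF e' pos] cd
    by (cases "- d \<le> - c") auto
qed

text \<open>One inner mean vanishes and the other blows up at the same point. The exponent relation
  \<open>rel\<close> is combined with the rates at infinity if b > 0, and with the slopes at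
  infinity if b <= 0.\<close>

lemma neg_antipodal:
  assumes q: "q < 0" and c: "c = - a" "a > 0"
  shows False
proof -
  interpret sw: invariance c d a b p q using swapped c by simp
  define r where "r = - q"
  have r: "0 < r" "r < p" using q pq by (auto simp: r_def)
  have b: "b \<noteq> a" and d: "d \<noteq> c" using neg_no_pole sw.neg_no_pole q by auto
  have ba: "\<bar>b\<bar> < a" and da: "\<bar>d\<bar> < a" using b_cases d_cases b d c by auto
  have bd: "b + d = 2 * (p - r)" using sum c by (simp add: r_def)
  have rel: "r / (a - b) - p / (a + d) = (if p = a then 1 else 0)"
  proof -
    have y: "1 / (c - d) = - (1 / (a + d))" using c da by (simp add: field_simps)
    have "- q * (1 / (a - b)) + p * (1 / (c - d)) = (if p = \<bar>a\<bar> then 1 else 0)"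
      using ba da c by (intro neg_balance q U_div_ln b V_div_ln d) (auto simp: y field_simps)
    then show ?thesis using c unfolding y by (simp add: r_def)
  qed
  have e: "gmean p (- r) (hyp a b t) (hyp (- a) (- (- d)) t) = hyp p (- r) t" for t
    using eq[of t] c by (simp add: r_def)
  show False
  proof (cases "b > 0")
    case True
    have "a > 0 \<and> - d > 0"
      by (rule infinity_opposite_params_pos[OF e r c(2) True]) (use da in auto)
    then have "- d > 0" by simp
    show False
    proof (rule infinity_opposite_II[OF e r \<open>- d > 0\<close>])
      assume n: "- d = r"
      then have b2: "b = 2 * p - r" using bd by simp
      have pa: "p \<noteq> a" using b2 ba r by auto
      \<comment> \<open>For n = r the exponent relation factors and leaves a = 2 * p + r, hence the
        bound demanded by \<open>infinity_opposite_II\<close>.\<close>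
      then have "r / (a - b) = p / (a - r)" using rel n by simp
      then have "r * (a - r) = p * (a - b)" using ba da n by (simp add: field_simps)
      then have "(p - r) * (a - (2 * p + r)) = 0" unfolding b2 by (simp add: algebra_simps)
      then have "a = 2 * p + r" using r by simp
      then show "3 * r \<le> a" using r by simp
    qed (use da ba bd in auto)
  next
    case False
    define u where "u = - b"
    have u: "u \<ge> 0" "u < a" using False ba by (auto simp: u_def)
    have dpos: "d = 2 * (p - r) + u" using bd by (simp add: u_def)
    have d0: "d > 0" using dpos r u by simp
    have m1: "mslope a b = (a - u) / (a + u)" using False ba b c by (simp add: mslope_def u_def)
    have m2: "mslope c d = - ((a - d) / (a + d))" using d0 da c by (simp add: mslope_def field_simps)
    have m3: "mslope p q = (p - r) / (p + r)" using q by (simp add: neg_slope r_def)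
    have s1: "(a - u) / (a + u) > 0" "(a - d) / (a + d) > 0" using u d0 da by auto
    \<comment> \<open>The linear growth at infinity gives a second relation between u and d.\<close>
    have "(a - u) / (a + u) - (a - d) / (a + d) + (p - r) / (p + r) * ((a - u) / (a + u) + (a - d) / (a + d)) = 2 * ((p - r) / (p + r))"
      using slope_equation[OF eq] s1 unfolding m1 m2 m3 by simp
    moreover have "p * X - r * Y = p - r" if "X - Y + (p - r) / (p + r) * (X + Y) = 2 * ((p - r) / (p + r))" for X Y
    proof -
      have "(p + r) * (X - Y) + (p - r) * (X + Y) = 2 * (p - r)" using that r by (simp add: field_simps)
      then show ?thesis by (simp add: algebra_simps)
    qed
    ultimately have "p * ((a - u) / (a + u)) - r * ((a - d) / (a + d)) = p - r"
      by blast
    moreover have "(a - u) / (a + u) = 1 - 2 * (u / (a + u))" "(a - d) / (a + d) = 1 - 2 * (d / (a + d))"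
      using u d0 by (auto simp: field_simps)
    moreover have "p * x = r * y" if "p * (1 - 2 * x) - r * (1 - 2 * y) = p - r" for x y
      using that by (simp add: algebra_simps)
    ultimately have "p * (u / (a + u)) = r * (d / (a + d))" by (simp only:)
    then have E1: "p * u * (a + d) = r * d * (a + u)" using u d0 c by (simp add: field_simps)
    show False
    proof (cases "p = a")
      case True
      have "r / (a - b) = 1 + p / (a + d)" using rel True by simp
      moreover have "p / (a + d) > 0" using p_pos d0 c by simp
      moreover have "r / (a - b) \<le> 1" using True r u by (simp add: u_def divide_le_eq)
      ultimately show False by linarith
    next
      case False
      then have "r / (a + u) = p / (a + d)" using rel by (simp add: u_def)
      then have E2: "r * (a + d) = p * (a + u)" using u d0 c by (simp add: field_simps)
      \<comment> \<open>Combining both relations gives r * a = p * u and p * a = r * d; the latter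
        is impossible because r < p and d < a.\<close>
      have "p * p * u * (a + u) = p * u * (r * (a + d))" unfolding E2 by (simp add: algebra_simps)
      also have "\<dots> = r * (p * u * (a + d))" by simp
      also have "\<dots> = r * r * d * (a + u)" unfolding E1 by simp
      finally have E3: "p * p * u = r * r * d" using u c by simp
      have "r * r * (a + d) = r * p * (a + u)" using E2 by (simp add: algebra_simps)
      then have "(p - r) * (r * a) = (p - r) * (p * u)"
        using E3 by (simp add: algebra_simps)
      then have E4: "r * a = p * u" using r by simp
      have "r * (p * a) = p * (r * a)" by simp
      also have "\<dots> = p * p * u" unfolding E4 by simp
      finally have "r * (p * a) = r * (r * d)" unfolding E3 by simp
      then have "p * a = r * d" using r by simp
      moreover have "r * d < p * a" using r da d0 by (intro mult_strict_mono) auto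
      ultimately show False by simp
    qed
  qed
qed

text \<open>The order d <= b decides which of the two positive exponents is the larger one in
  \<open>neg_balance\<close>; the right side must then be 1, so that p = a.\<close>

lemma neg_equal:
  assumes q: "q < 0" and c: "c = a" "a > 0" and bd: "d \<le> b"
  shows "a = p \<and> b = q \<and> c = p \<and> d = q"
proof -
  interpret sw: invariance c d a b p q using swapped c by simp
  have b: "b \<noteq> a" and d: "d \<noteq> c" using neg_no_pole sw.neg_no_pole q by auto
  have ba: "\<bar>b\<bar> < a" and da: "\<bar>d\<bar> < a" using b_cases d_cases b d c by auto
  have pos: "1 / (a - b) > 0" "1 / (c - d) > 0" using ba da c by auto
  have rel: "- q * (1 / (a - b)) + p * (1 / (c - d)) = (if p = \<bar>a\<bar> then 1 else 0)"
    using ba da c bd by (intro neg_balance q U_div_ln b V_div_ln d) (auto simp: field_simps)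
  moreover have "- q * (1 / (a - b)) > 0" "p * (1 / (c - d)) > 0" by (rule mult_pos_pos; use q p_pos pos in simp)+
  ultimately have p: "p = a" and one: "- q / (p - b) + p / (p - d) = 1"
    using c by (auto split: if_splits)
  \<comment> \<open>By the sum identity b and d deviate from q by s and -s. The exponent relation
    has the roots s = 0 and s = p + q, and the latter would mean d = -p.\<close>
  define s where "s = b - q"
  have bs: "b = q + s" and ds: "d = q - s" using sum p c by (auto simp: s_def)
  have "- q * (p - d) + p * (p - b) = (p - b) * (p - d)"
    using one ba da p by (simp add: field_simps)
  then have "s * (s - (p + q)) = 0" unfolding bs ds by (simp add: algebra_simps)
  moreover have "s \<noteq> p + q" using ds da p by auto
  ultimately have "s = 0" by simp
  then show ?thesis using bs ds p c by simp
qed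

lemma neg_case:
  assumes q: "q < 0"
  shows "{a, b} = {c, d} \<and> {c, d} = {p, q}"
proof (cases "\<bar>c\<bar> < \<bar>a\<bar>")
  case True
  then show ?thesis using neg_dominant[OF q] by simp
next
  case False
  then have c: "\<bar>c\<bar> = \<bar>a\<bar>" using dom by simp
  interpret sw: invariance c d a b p q using swapped c by simp
  consider "c = - a" "a > 0" | "c = - a" "a < 0" | "c = a" "a > 0" | "c = a" "a < 0"
    using c a_nz by linarith
  then show ?thesis
  proof cases
    case 1
    then show ?thesis using neg_antipodal[OF q] by simp
  next
    case 2
    then show ?thesis using sw.neg_antipodal[OF q] by simp
  next
    case 3
    then show ?thesis using neg_equal[OF q] sw.neg_equal[OF q] by (cases "d \<le> b") auto
  next
    case 4
    \<comment> \<open>Two negative dominant parameters would make the sum of all inner parameters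
      nonpositive, although it is 2 * (p + q).\<close>
    then have "b \<le> - a" "d \<le> - a" using ab' d_le by auto
    then have "a + b + c + d \<le> 0" using 4 by simp
    then have False using sum pq by argo
    then show ?thesis ..
  qed
qed

end

section \<open>Further properties of the outer mean\<close>

lemma gmean_at_bot:
  assumes "filterlim u at_bot F" "filterlim v at_bot F"
  shows "filterlim (\<lambda>x. gmean p q (u x) (v x)) at_bot F"
  unfolding filterlim_at_bot
proof
  fix Z
  have "\<forall>\<^sub>F x in F. u x \<le> Z" "\<forall>\<^sub>F x in F. v x \<le> Z"
    using assms by (auto simp: filterlim_at_bot)
  then show "\<forall>\<^sub>F x in F. gmean p q (u x) (v x) \<le> Z"
  proof eventually_elim
    case (elim x)
    then have "max (u x) (v x) \<le> Z" by simp
    with gmean_le_max show ?case by (rule order_trans)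
  qed
qed

text \<open>The defining quotient of the Stolarsky mean of exp (u - v) and 1. It shows the smaller
  argument through exp (p * (u - v)) and exp (q * (u - v)), which the leading asymptotics
  suppress.\<close>

lemma gmean_exp:
  assumes "p > 0" "q > 0" "p \<noteq> q" "u < v"
  shows "exp ((p - q) * (gmean p q u v - v)) = q / p * ((1 - exp (p * (u - v))) / (1 - exp (q * (u - v))))"
proof -
  define x where "x = u - v"
  have x: "x < 0" using assms by (simp add: x_def)
  have "(p - q) * (gmean p q u v - v) = (p * (x / 2) + lsinh (p * (x / 2))) - (q * (x / 2) + lsinh (q * (x / 2)))"
    using assms by (simp add: gmean_def hyp_def x_def field_simps)
  moreover have "exp (s * (x / 2) + lsinh (s * (x / 2))) = (1 - exp (s * x)) / - (s * x)" if "s > 0" for s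
  proof -
    have "2 * exp (s * (x / 2)) * sinh (s * (x / 2)) = exp (s * x) - 1"
      unfolding exp_mult_sinh by simp
    then have "exp (s * (x / 2)) * sinh (s * (x / 2)) = (exp (s * x) - 1) / 2" by simp
    then show ?thesis
      unfolding exp_add exp_lsinh using that x by (simp add: field_simps)
  qed
  ultimately have "exp ((p - q) * (gmean p q u v - v)) = (1 - exp (p * x)) / - (p * x) / ((1 - exp (q * x)) / - (q * x))"
    using assms by (simp add: exp_diff)
  moreover have "A / - (p * x) / (B / - (q * x)) = q / p * (A / B)" for A B
    using assms x by (cases "B = 0") (simp_all add: field_simps)
  ultimately show ?thesis by (simp only: x_def)
qed

context invariance
begin

subsection \<open>One vanishing outer parameter\<close>

text \<open>With slope 1, \<open>balance\<close> sees only the smaller exponent. The logarithmic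
  correction still tends to minus infinity, which gives p = a; a logarithmic singularity of U is too
  weak, so b = a, and infinity decides.\<close>

lemma zero_dominant:
  assumes q: "q = 0" and c: "\<bar>c\<bar> < \<bar>a\<bar>"
  shows False
proof -
  have ne: "q \<noteq> p" using q p_pos by simp
  have slope: "mslope p q = 1" using q p_pos by (simp add: mslope_def)
  have a: "a > 0"
  proof (rule ccontr)
    assume "\<not> a > 0"
    then have top: "filterlim U at_top (at_right 0)" using a_nz by (intro U_at_top) simp
    have "filterlim (\<lambda>e. V e / 2 + 1 / 2 * U e) at_top (at_right 0)"
      by (intro filterlim_tendsto_add_at_top[OF tendsto_divide[OF V_limit[OF c] tendsto_const]]
        filterlim_tendsto_pos_mult_at_top[OF tendsto_const _ top]) auto
    then have "filterlim (\<lambda>e. gmean p q (U e) (V e)) at_top (at_right 0)"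
    proof (rule filterlim_at_top_mono)
      show "\<forall>\<^sub>F e in at_right 0. V e / 2 + 1 / 2 * U e \<le> gmean p q (U e) (V e)"
        using gmean_ge_mean[of p q] pq by (intro always_eventually allI) (simp add: add_divide_distrib add.commute)
    qed
    then show False using gmean_not_at_top by simp
  qed
  have bot: "filterlim U at_bot (at_right 0)" using a by (rule U_at_bot)
  have gap: "filterlim (\<lambda>e. V e - U e) at_top (at_right 0)"
    using filterlim_tendsto_add_at_top[OF V_limit[OF c] filterlim_uminus_at_bot[THEN iffD1, OF bot]] by simp
  have "filterlim (\<lambda>e. ln (p * (V e - U e))) at_top (at_right 0)"
    by (intro filterlim_compose[OF ln_at_top] filterlim_tendsto_pos_mult_at_top[OF tendsto_const _ gap]) (rule p_pos)
  then have ln_top: "filterlim (\<lambda>e. 1 / p * ln (p * (V e - U e))) at_top (at_right 0)"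
    by (intro filterlim_tendsto_pos_mult_at_top[OF tendsto_const]) (use p_pos in auto)
  have "((\<lambda>e. - (gmean p 0 (U e) (V e) - V e + ln (p * (V e - U e)) / p) - V e) \<longlongrightarrow> - 0 - trig c d (pi / \<bar>a\<bar>)) (at_right 0)"
    by (intro tendsto_diff tendsto_minus gmean_zero_asymp p_pos gap V_limit c)
  from filterlim_tendsto_add_at_top[OF this ln_top]
  have "filterlim (\<lambda>e. - gmean p q (U e) (V e)) at_top (at_right 0)" by (simp add: q)
  then have pa: "p = \<bar>a\<bar>"
    by (intro p_eq_if_unbounded) (simp add: filterlim_uminus_at_bot)
  have ba: "b = a"
  proof (rule ccontr)
    assume "b \<noteq> a"
    from balance[OF ne U_div_ln[OF this] V_div_ln_0[OF c]] \<open>b \<noteq> a\<close> b_cases a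
    show False using slope pa p_pos q by (auto simp: zero_less_divide_iff)
  qed
  then have "c + d = 0" using sum pa a q by simp
  then have cd0: "c = 0" "d = 0" using cd by auto
  show False
    by (rule infinity_zero[of p]) (use eq pa a ba cd0 q p_pos in auto)
qed

text \<open>A logarithmic U would leave the negative exponent of V as the smaller one, while the
  right side has a nonnegative exponent. A pole of U adds 1 / p through the logarithm of the
  distance; the total 1 / (2 * p) is neither 0 nor 1 / p.\<close>

lemma zero_antipodal:
  assumes q: "q = 0" and c: "c = - a" "a > 0"
  shows False
proof -
  have ne: "q \<noteq> p" using q p_pos by simp
  have slope: "mslope p q = 1" using q p_pos by (simp add: mslope_def)
  have bd: "b + d = 2 * p" using sum c q by simp
  have d: "d \<noteq> c" using bd c ab' p_pos by auto
  then have da: "\<bar>d\<bar> < a" using d_cases c by auto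
  have c': "\<bar>c\<bar> = \<bar>a\<bar>" using c by simp
  have y: "1 / (c - d) = - (1 / (a + d))" using c da by (simp add: field_simps)
  have y0: "1 / (a + d) > 0" using da by simp
  have V: "((\<lambda>e. V e / ln e) \<longlongrightarrow> - (1 / (a + d))) (at_right 0)"
    using V_div_ln[OF c' d] unfolding y .
  show False
  proof (cases "b = a")
    case False
    then have x0: "1 / (a - b) > 0" using b_cases c by auto
    have "2 * (- (1 / (a + d))) = 2 * (if p = \<bar>a\<bar> then 1 / (p - q) else 0)"
      using balance[OF ne U_div_ln[OF False] V] slope x0 y0 by (simp add: abs_of_pos add_pos_pos)
    moreover have "(if p = \<bar>a\<bar> then 1 / (p - q) else 0) \<ge> 0" using q p_pos by simp
    ultimately show False using y0 by linarith
  next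
    case True
    have ad: "a + d = 2 * p" using bd True by simp
    have neg: "\<forall>\<^sub>F e in at_right 0. ln e < (0::real)"
      using eventually_at_right_real[OF zero_less_one] by eventually_elim (auto simp: ln_less_zero)
    have eln: "((\<lambda>e::real. e * ln e) \<longlongrightarrow> 0) (at_right 0)" by real_asymp
    have "((\<lambda>e. V e / ln e * (e * ln e)) \<longlongrightarrow> - (1 / (a + d)) * 0) (at_right 0)"
      by (intro tendsto_mult V eln)
    then have Ve: "((\<lambda>e. V e * e) \<longlongrightarrow> 0) (at_right 0)"
      by (rule Lim_transform_eventually[OF tendsto_eq_rhs]) (use neg in \<open>auto elim!: eventually_mono\<close>)
    have Ue: "((\<lambda>e. U e * e) \<longlongrightarrow> - (pi / (a * \<bar>a\<bar>))) (at_right 0)"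
      using trig_singular_pole[OF a_nz] True by simp
    define K where "K = pi / (a * \<bar>a\<bar>)"
    have K: "K > 0" using c by (simp add: K_def)
    have gape: "((\<lambda>e. (V e - U e) * e) \<longlongrightarrow> K) (at_right 0)"
      using tendsto_diff[OF Ve Ue] by (simp add: K_def left_diff_distrib)
    have inv: "filterlim (\<lambda>e::real. 1 / e) at_top (at_right 0)" by real_asymp
    have "filterlim (\<lambda>e. (V e - U e) * e * (1 / e)) at_top (at_right 0)"
      by (rule filterlim_tendsto_pos_mult_at_top[OF gape K inv])
    moreover have "\<forall>\<^sub>F e in at_right 0. (V e - U e) * e * (1 / e) = V e - U e"
      using eventually_at_right_less[of 0] by eventually_elim simp
    ultimately have gap: "filterlim (\<lambda>e. V e - U e) at_top (at_right 0)"
      by (subst (asm) filterlim_cong[OF refl refl])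
    have 1: "((\<lambda>e. (gmean p 0 (U e) (V e) - V e + ln (p * (V e - U e)) / p) / ln e) \<longlongrightarrow> 0) (at_right 0)"
      by (rule bounded_div_ln[OF gmean_zero_asymp[OF p_pos gap]])
    have "((\<lambda>e. ln (p * ((V e - U e) * e))) \<longlongrightarrow> ln (p * K)) (at_right 0)"
      by (intro tendsto_ln tendsto_mult tendsto_const gape) (use p_pos K in auto)
    from bounded_div_ln[OF this]
    have 2: "((\<lambda>e. ln (p * ((V e - U e) * e)) / ln e) \<longlongrightarrow> 0) (at_right 0)" .
    have "((\<lambda>e. (gmean p 0 (U e) (V e) - V e + ln (p * (V e - U e)) / p) / ln e + V e / ln e
        - 1 / p * (ln (p * ((V e - U e) * e)) / ln e) + 1 / p) \<longlongrightarrow> 0 + - (1 / (a + d)) - 1 / p * 0 + 1 / p) (at_right 0)"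
      by (intro tendsto_add tendsto_diff tendsto_mult tendsto_const 1 2 V)
    moreover have "\<forall>\<^sub>F e in at_right 0. (gmean p 0 (U e) (V e) - V e + ln (p * (V e - U e)) / p) / ln e + V e / ln e
        - 1 / p * (ln (p * ((V e - U e) * e)) / ln e) + 1 / p = gmean p q (U e) (V e) / ln e"
      using neg eventually_at_right_less[of 0] gap[unfolded filterlim_at_top_dense, rule_format, of 0]
    proof eventually_elim
      case (elim e)
      have "ln (p * ((V e - U e) * e)) = ln (p * (V e - U e)) + ln e"
        using elim p_pos by (simp add: ln_mult flip: mult.assoc)
      then show ?case using elim p_pos q by (simp add: field_simps)
    qed
    ultimately have "((\<lambda>e. gmean p q (U e) (V e) / ln e) \<longlongrightarrow> 0 + - (1 / (a + d)) - 1 / p * 0 + 1 / p) (at_right 0)"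
      by (rule Lim_transform_eventually)
    from tendsto_unique[OF _ this gmean_div_ln[OF ne]]
    have "- (1 / (2 * p)) + 1 / p = (if p = \<bar>a\<bar> then 1 / (p - q) else 0)" by (simp add: ad)
    then show False using p_pos q by (auto simp: field_simps split: if_splits)
  qed
qed

text \<open>The smaller of the exponents 1 / (p - b) and 1 / (p - d) must equal 1 / p, so b or d
  vanishes, and b + d = 0.\<close>

lemma zero_equal:
  assumes q: "q = 0" and c: "c = a" "a > 0"
  shows "a = p \<and> b = q \<and> c = p \<and> d = q"
proof -
  interpret sw: invariance c d a b p q using swapped c by simp
  have ne: "q \<noteq> p" using q p_pos by simp
  have slope: "mslope p q = 1" using q p_pos by (simp add: mslope_def)
  have "filterlim U at_bot (at_right 0)" "filterlim V at_bot (at_right 0)"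
    using U_at_bot sw.U_at_bot c by auto
  then have "filterlim (\<lambda>e. gmean p q (U e) (V e)) at_bot (at_right 0)"
    by (rule gmean_at_bot)
  then have pa: "p = a" using p_eq_if_unbounded c by simp
  have bd: "b + d = 0" using sum c pa q by simp
  have b: "b \<noteq> a" "d \<noteq> c" using bd ab' sw.ab' c by auto
  have ba: "\<bar>b\<bar> < a" "\<bar>d\<bar> < a" using b_cases sw.b_cases b c by auto
  have "1 / (a - b) + 1 / (c - d) - \<bar>1 / (a - b) - 1 / (c - d)\<bar> = 2 * (1 / p)"
    using balance[OF ne U_div_ln V_div_ln] b c pa q slope by simp
  then have "min (1 / (a - b)) (1 / (c - d)) = 1 / p" by (simp add: min_def abs_if split: if_splits)
  then have "1 / (p - b) = 1 / p \<or> 1 / (p - d) = 1 / p" using c pa by (auto simp: min_def split: if_splits)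
  then have "b = 0 \<or> d = 0" using p_pos ba pa by (auto simp: field_simps)
  then show ?thesis using bd pa c q by auto
qed

lemma zero_case:
  assumes q: "q = 0"
  shows "{a, b} = {c, d} \<and> {c, d} = {p, q}"
proof (cases "\<bar>c\<bar> < \<bar>a\<bar>")
  case True
  then show ?thesis using zero_dominant[OF q] by simp
next
  case False
  then have c: "\<bar>c\<bar> = \<bar>a\<bar>" using dom by simp
  interpret sw: invariance c d a b p q using swapped c by simp
  consider "c = - a" "a > 0" | "c = - a" "a < 0" | "c = a" "a > 0" | "c = a" "a < 0"
    using c a_nz by linarith
  then show ?thesis
  proof cases
    case 1
    then show ?thesis using zero_antipodal[OF q] by simp
  next
    case 2
    then show ?thesis using sw.zero_antipodal[OF q] by simp
  next
    case 3
    then show ?thesis using zero_equal[OF q] by auto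
  next
    case 4
    then have "b \<le> - a" "d \<le> - a" using ab' d_le by auto
    then have "a + b + c + d \<le> 0" using 4 by simp
    then have False using sum pq by argo
    then show ?thesis ..
  qed
qed

subsection \<open>Positive outer parameters\<close>

text \<open>
  With W = exp (U - V), the function exp ((p - q) (R - V)) = q (1 - W^p) / (p (1 - W^q)) is
  holomorphic at the singularity of U. Thus W^q, and then W^p, vanish there to an integer order,
  while W itself vanishes to the order 1 / (a - b).
\<close>

lemma pos_exponents:
  assumes q: "0 < q" "q < p" and pos: "a > 0" "b > 0" "c > 0" "d > 0" and c: "c < a" and p: "p < a"
  shows "a - b \<le> q \<and> a - b \<le> p - q"
proof -
  define \<xi> where "\<xi> = \<i> * of_real (pi / a)"
  have V: "(V \<longlongrightarrow> trig c d (pi / \<bar>a\<bar>)) (at_right 0)" using V_limit c pos by simp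
  have le_ca: "d \<le> c" "d \<le> a" "c \<le> a" using d_le c pos by auto
  define X where "X = (\<lambda>e. U e - V e)"
  have "filterlim (\<lambda>e. V e + - U e) at_top (at_right 0)"
    by (rule filterlim_tendsto_add_at_top[OF V filterlim_uminus_at_bot[THEN iffD1, OF U_at_bot[OF pos(1)]]])
  then have Xbot: "filterlim X at_bot (at_right 0)"
    unfolding filterlim_uminus_at_bot by (simp add: X_def)
  have Xneg: "\<forall>\<^sub>F e in at_right 0. X e < 0" using Xbot by (simp add: filterlim_at_bot_dense)
  have Xexp: "((\<lambda>e. exp (s * X e)) \<longlongrightarrow> 0) (at_right 0)" if "s > 0" for s
    by (intro filterlim_compose[OF exp_at_bot] filterlim_tendsto_pos_mult_at_bot[OF tendsto_const that Xbot])
  have near: "\<forall>\<^sub>F e in at_right 0. 0 < e \<and> e < pi / a"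
    using eventually_at_right_real[of 0 "pi / a"] pos by simp
  have point: "\<xi> - \<i> * of_real e = \<i> * of_real (pi / \<bar>a\<bar> - e)" for e
    using pos by (simp add: \<xi>_def right_diff_distrib)
  have lt: "\<bar>r * (pi / \<bar>a\<bar> - e)\<bar> < pi" if "0 \<le> r" "r \<le> a" "0 < e" "e < pi / a" for r e
  proof -
    have "r * (pi / a - e) \<le> a * (pi / a - e)" using that by (intro mult_right_mono) auto
    also have "\<dots> < pi" using that pos by (simp add: right_diff_distrib)
    finally show ?thesis using that pos by simp
  qed
  \<comment> \<open>m < a bounds all parameters that must be regular at \<open>\<xi>\<close>, so
    \<open>\<xi>\<close> lies inside the strip S. b is included only if b < a, since b = a is
    excluded later.\<close>
  define m where "m = max (max p c) (if b < a then b else 0)"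
  have m: "0 < m" "m < a" "p \<le> m" "c \<le> m" "b < a \<Longrightarrow> b \<le> m"
    using p c pos p_pos by (auto simp: m_def)
  define S where "S = {z. m * \<bar>Im z\<bar> < pi}"
  have oS: "open S"
    unfolding S_def by (intro open_Collect_less continuous_intros)
  have S: "\<xi> \<in> S"
    using m pos by (simp add: S_def \<xi>_def abs_mult field_simps)
  have S_le: "\<bar>r * Im z\<bar> < pi" if "z \<in> S" "\<bar>r\<bar> \<le> m" for r z
  proof -
    have "\<bar>r\<bar> * \<bar>Im z\<bar> \<le> m * \<bar>Im z\<bar>" using that(2) by (rule mult_right_mono) simp
    then show ?thesis using that(1) by (simp add: S_def abs_mult)
  qed
  have hol: "chyp p q holomorphic_on S" "chyp c d holomorphic_on S"
    by (rule holomorphic_chyp[of "\<lambda>z. z", simplified]; rule S_le; use m q pos le_ca in simp)+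
  define K where "K = (\<lambda>z. exp (of_real (p - q) * (chyp p q z - chyp c d z)))"
  have hK: "K holomorphic_on S" unfolding K_def by (intro holomorphic_intros hol)
  have K: "\<forall>\<^sub>F e in at_right 0. K (\<xi> - \<i> * of_real e)
      = of_real (q / p * ((1 - exp (p * X e)) / (1 - exp (q * X e))))"
    using near mean_identity Xneg
  proof eventually_elim
    case (elim e)
    have "chyp p q (\<i> * of_real (pi / \<bar>a\<bar> - e)) = of_real (R e)"
      "chyp c d (\<i> * of_real (pi / \<bar>a\<bar> - e)) = of_real (V e)"
      by (rule chyp_imag; rule lt; use elim(1) pos q p c le_ca in simp)+
    then have "K (\<xi> - \<i> * of_real e) = of_real (exp ((p - q) * (R e - V e)))"
      unfolding K_def point by (simp only: flip: exp_of_real of_real_diff of_real_mult)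
    also have "exp ((p - q) * (R e - V e)) = q / p * ((1 - exp (p * X e)) / (1 - exp (q * X e)))"
      using gmean_exp[of p q "U e" "V e"] elim q p_pos by (simp add: X_def)
    finally show ?case .
  qed
  \<comment> \<open>Along the ray K tends to q / p, so this difference isolates the next term, which
    behaves like exp (q * X).\<close>
  define N where "N = (\<lambda>z. K z * of_real (p / q) - 1)"
  have hN: "N holomorphic_on S" unfolding N_def by (intro holomorphic_intros hK)
  have N: "\<forall>\<^sub>F e in at_right 0. N (\<xi> - \<i> * of_real e)
      = of_real (exp (q * X e) * ((1 - exp ((p - q) * X e)) / (1 - exp (q * X e))))
      \<and> exp (q * X e) < 1 \<and> exp ((p - q) * X e) < 1"
    using K Xneg
  proof eventually_elim
    case (elim e)
    have lt1: "exp (q * X e) < 1" "exp ((p - q) * X e) < 1"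
      using elim q by (auto simp: mult_pos_neg)
    have "exp (p * X e) = exp (q * X e) * exp ((p - q) * X e)"
      by (simp add: algebra_simps flip: exp_add)
    moreover have "q / p * ((1 - Q * P) / (1 - Q)) * (p / q) - 1 = Q * ((1 - P) / (1 - Q))" if "Q < 1" for P Q
      using that q by (simp add: field_simps)
    ultimately have "q / p * ((1 - exp (p * X e)) / (1 - exp (q * X e))) * (p / q) - 1
        = exp (q * X e) * ((1 - exp ((p - q) * X e)) / (1 - exp (q * X e)))"
      using lt1 by simp
    moreover have "N (\<xi> - \<i> * of_real e)
        = of_real (q / p * ((1 - exp (p * X e)) / (1 - exp (q * X e))) * (p / q) - 1)"
      unfolding N_def elim(1) by (simp only: of_real_mult of_real_diff of_real_1)
    ultimately show ?case using lt1 by (simp only: simp_thms)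
  qed
  have "\<forall>\<^sub>F e in at_right 0. N (\<xi> - \<i> * of_real e) \<noteq> 0"
    using N by eventually_elim (auto simp del: of_real_mult of_real_divide)
  from holomorphic_order_along_ray[OF hN oS S this] obtain n :: nat where
    n: "((\<lambda>e. ln (cmod (N (\<xi> - \<i> * of_real e))) / ln e) \<longlongrightarrow> of_nat n) (at_right 0)" by blast
  have rest: "((\<lambda>e. (ln (1 - exp ((p - q) * X e)) - ln (1 - exp (q * X e))) / ln e) \<longlongrightarrow> 0) (at_right 0)"
  proof (rule bounded_div_ln)
    show "((\<lambda>e. ln (1 - exp ((p - q) * X e)) - ln (1 - exp (q * X e))) \<longlongrightarrow> ln (1 - 0) - ln (1 - 0)) (at_right 0)"
      using q by (intro tendsto_diff tendsto_ln tendsto_const Xexp) auto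
  qed
  have "((\<lambda>e. (ln (cmod (N (\<xi> - \<i> * of_real e))) / ln e
      - (ln (1 - exp ((p - q) * X e)) - ln (1 - exp (q * X e))) / ln e) / q + V e / ln e) \<longlongrightarrow> (of_nat n - 0) / q + 0) (at_right 0)"
    using q c pos by (intro tendsto_add tendsto_divide tendsto_diff n rest V_div_ln_0 tendsto_const) auto
  moreover have "\<forall>\<^sub>F e in at_right 0. (ln (cmod (N (\<xi> - \<i> * of_real e))) / ln e
      - (ln (1 - exp ((p - q) * X e)) - ln (1 - exp (q * X e))) / ln e) / q + V e / ln e = U e / ln e"
    using N
  proof eventually_elim
    case (elim e)
    then have "cmod (N (\<xi> - \<i> * of_real e)) = exp (q * X e) * ((1 - exp ((p - q) * X e)) / (1 - exp (q * X e)))"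
      by (simp del: of_real_mult of_real_divide add: norm_of_real)
    moreover have "ln (exp (q * X e) * ((1 - P) / (1 - Q))) = q * X e + (ln (1 - P) - ln (1 - Q))"
      if "P < 1" "Q < 1" for P Q
      using that by (simp add: ln_mult ln_div)
    ultimately have "ln (cmod (N (\<xi> - \<i> * of_real e))) = q * X e + (ln (1 - exp ((p - q) * X e)) - ln (1 - exp (q * X e)))"
      using elim by simp
    then show ?case using q by (simp add: X_def add_divide_distrib diff_divide_distrib right_diff_distrib)
  qed
  ultimately have Uln: "((\<lambda>e. U e / ln e) \<longlongrightarrow> of_nat n / q) (at_right 0)"
    using Lim_transform_eventually by fastforce
  \<comment> \<open>A double parameter would give U a pole, incompatible with the finite limit of U
    / ln e.\<close>
  have ba: "b < a"
  proof (rule ccontr)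
    assume "\<not> b < a"
    then have "b = a" using b_cases pos by auto
    then have "filterlim (\<lambda>e. U e / ln e) at_top (at_right 0)"
      using trig_div_ln_pole[OF a_nz] pos by simp
    with Uln show False using tendsto_at_top_contra[of "at_right (0::real)"] by simp
  qed
  have "1 / (a - b) = of_nat n / q"
    using tendsto_unique[OF _ U_div_ln Uln] ba by simp
  then have qn: "q = of_nat n * (a - b)" using ba q by (simp add: field_simps)
  have n1: "n \<ge> 1" using qn q by (cases n) auto
  \<comment> \<open>continues \<open>exp ((a - b) * X)\<close> through the singularity, since \<open>sin (a * s)\<close> has a simple zero there\<close>
  define Z where "Z = (\<lambda>z. exp (- of_real (a - b) * chyp c d z) * (sinhc (of_real a * z) / sinhc (of_real b * z)))"
  have hZ: "Z holomorphic_on S"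
  proof -
    have "(\<lambda>z. sinhc (of_real r * z)) holomorphic_on S" for r
      by (rule holomorphic_on_compose_gen[OF _ holomorphic_sinhc, unfolded o_def]) (auto intro!: holomorphic_intros)
    moreover have "sinhc (of_real b * z) \<noteq> 0" if "z \<in> S" for z
    proof -
      have "\<bar>Im (of_real b * z)\<bar> < pi" using S_le[OF that, of b] m(5)[OF ba] pos by simp
      from sinhc_nonpos[OF this] show ?thesis by auto
    qed
    ultimately show ?thesis unfolding Z_def by (intro holomorphic_intros hol) auto
  qed
  \<comment> \<open>The formula for K solved for exp (p * X), with exp (q * X) replaced by its
    holomorphic continuation Z^n; this uses q = n * (a - b).\<close>
  define M where "M = (\<lambda>z. 1 - (1 - Z z ^ n) * (K z * of_real (p / q)))"
  have hM: "M holomorphic_on S" unfolding M_def by (intro holomorphic_intros hK hZ)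
  have M: "\<forall>\<^sub>F e in at_right 0. M (\<xi> - \<i> * of_real e) = of_real (exp (p * X e))"
    using K Xneg near
  proof eventually_elim
    case (elim e)
    define s where "s = pi / \<bar>a\<bar> - e"
    have Z: "Z (\<i> * of_real s) = of_real (exp ((a - b) * X e))"
    proof -
      have l: "\<bar>a * s\<bar> < pi" "\<bar>b * s\<bar> < pi" "\<bar>c * s\<bar> < pi" "\<bar>d * s\<bar> < pi"
        unfolding s_def by (rule lt; use elim(3) pos ba le_ca in simp)+
      have "sinhc (of_real r * (\<i> * of_real s)) = of_real (exp (lsin (r * s)))" if "\<bar>r * s\<bar> < pi" for r
        using sinhc_imag[OF that] by (simp add: mult.left_commute)
      then have "Z (\<i> * of_real s) = exp (- of_real (a - b) * of_real (trig c d s))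
          * (of_real (exp (lsin (a * s))) / of_real (exp (lsin (b * s))))"
        using l by (simp add: Z_def chyp_imag)
      also have "\<dots> = of_real (exp (- (a - b) * V e) * (exp (lsin (a * s)) / exp (lsin (b * s))))"
        unfolding s_def by (simp only: exp_of_real flip: of_real_minus of_real_mult of_real_divide)
      also have "exp (- (a - b) * V e) * (exp (lsin (a * s)) / exp (lsin (b * s)))
          = exp (- (a - b) * V e + (lsin (a * s) - lsin (b * s)))"
        by (simp only: exp_add exp_diff)
      also have "lsin (a * s) - lsin (b * s) = (a - b) * U e"
        using ba by (simp add: trig_def s_def)
      finally show ?thesis by (simp add: X_def algebra_simps)
    qed
    have "Z (\<i> * of_real s) ^ n = of_real (exp (q * X e))"
      unfolding Z of_real_power[symmetric] exp_of_nat_mult[symmetric] qn by (simp add: mult.assoc)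
    moreover have "exp (q * X e) < 1" using elim q by (simp add: mult_pos_neg)
    moreover have "1 - (1 - Q) * (q / p * ((1 - P) / (1 - Q)) * (p / q)) = P" if "Q < 1" for P Q
      using that q by simp
    ultimately have Zn: "Z (\<i> * of_real s) ^ n = of_real (exp (q * X e))"
      and real: "1 - (1 - exp (q * X e)) * (q / p * ((1 - exp (p * X e)) / (1 - exp (q * X e))) * (p / q)) = exp (p * X e)"
      by blast+
    have "M (\<xi> - \<i> * of_real e)
        = of_real (1 - (1 - exp (q * X e)) * (q / p * ((1 - exp (p * X e)) / (1 - exp (q * X e))) * (p / q)))"
    proof -
      have "K (\<i> * of_real s) = of_real (q / p * ((1 - exp (p * X e)) / (1 - exp (q * X e))))"
        using elim(1) unfolding point s_def[symmetric] .
      then show ?thesis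
        unfolding M_def point s_def[symmetric] Zn by (simp only: of_real_mult of_real_diff of_real_1)
    qed
    then show ?case unfolding real .
  qed
  have "\<forall>\<^sub>F e in at_right 0. M (\<xi> - \<i> * of_real e) \<noteq> 0"
    using M by eventually_elim simp
  from holomorphic_order_along_ray[OF hM oS S this] obtain l :: nat where
    l: "((\<lambda>e. ln (cmod (M (\<xi> - \<i> * of_real e))) / ln e) \<longlongrightarrow> of_nat l) (at_right 0)" by blast
  have "((\<lambda>e. p * (U e / ln e - V e / ln e)) \<longlongrightarrow> p * (1 / (a - b) - 0)) (at_right 0)"
    using c pos ba by (intro tendsto_mult tendsto_diff tendsto_const U_div_ln V_div_ln_0) auto
  moreover have "\<forall>\<^sub>F e in at_right 0. p * (U e / ln e - V e / ln e) = ln (cmod (M (\<xi> - \<i> * of_real e))) / ln e"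
    using M by eventually_elim (simp add: X_def diff_divide_distrib norm_of_real right_diff_distrib)
  ultimately have "((\<lambda>e. ln (cmod (M (\<xi> - \<i> * of_real e))) / ln e) \<longlongrightarrow> p * (1 / (a - b) - 0)) (at_right 0)"
    by (rule Lim_transform_eventually)
  from tendsto_unique[OF _ this l] have "p = of_nat l * (a - b)" using ba by (simp add: field_simps)
  then have pl: "p - q = (of_nat l - of_nat n) * (a - b)" using qn by (simp add: algebra_simps)
  \<comment> \<open>Both q and p - q are positive integer multiples of a - b, hence at least a -
    b.\<close>
  have "0 < (of_nat l - of_nat n) * (a - b)" unfolding pl[symmetric] using q by simp
  then have "n < l" using ba by (simp add: zero_less_mult_iff)
  then have "1 \<le> of_nat l - (of_nat n :: real)" by simp
  then have "1 * (a - b) \<le> p - q" unfolding pl using ba by (intro mult_right_mono) auto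
  moreover have "1 * (a - b) \<le> q" unfolding qn using ba n1 by (intro mult_right_mono) auto
  ultimately show ?thesis by simp
qed

lemma pos_case:
  assumes q: "q > 0"
  shows "{a, b} = {c, d} \<and> {c, d} = {p, q}"
proof -
  have pos: "a > 0" "b > 0" "c > 0" "d > 0"
    using infinity_params_pos[OF eq p_pos q] by auto
  have le: "b \<le> a" "d \<le> c" "c \<le> a" using ab' d_le dom pos by auto
  have exps: "q \<le> b" "q \<le> d"
    using infinity_exponents[OF eq q pq(2) pos(2) le(1) pos(4) le(2)] by auto
  show ?thesis
  proof (cases "c = a")
    case True
    interpret sw: invariance c d a b p q using swapped True by simp
    have "filterlim U at_bot (at_right 0)" "filterlim V at_bot (at_right 0)"
      using U_at_bot sw.U_at_bot pos True by auto
    then have "filterlim (\<lambda>e. gmean p q (U e) (V e)) at_bot (at_right 0)"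
      by (rule gmean_at_bot)
    then have pa: "p = a" using p_eq_if_unbounded pos by simp
    then have "b + d = 2 * q" using sum True by simp
    then have "b = q" "d = q" using exps by linarith+
    then show ?thesis using True pa by simp
  next
    case False
    then have c: "\<bar>c\<bar> < \<bar>a\<bar>" using le pos by simp
    \<comment> \<open>Here U tends to minus infinity and V converges, so the outer mean converges to
      the limit of V minus \<open>mconst p q\<close>. A bounded left side means p < a.\<close>
    have gap: "filterlim (\<lambda>e. (1 / 2) * (V e - U e)) at_top (at_right 0)"
      using filterlim_tendsto_add_at_top[OF V_limit[OF c] filterlim_uminus_at_bot[THEN iffD1, OF U_at_bot[OF pos(1)]]]
      by (intro filterlim_tendsto_pos_mult_at_top[OF tendsto_const]) auto
    have "((\<lambda>e. (hyp p q (1 / 2 * (V e - U e)) - 1 / 2 * (V e - U e)) + V e) \<longlongrightarrow> - mconst p q + trig c d (pi / \<bar>a\<bar>)) (at_right 0)"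
      by (intro tendsto_add V_limit c filterlim_compose[OF hyp_pos_pos_limit[OF p_pos q] gap])
    moreover have "(hyp p q (1 / 2 * (V e - U e)) - 1 / 2 * (V e - U e)) + V e = gmean p q (U e) (V e)" for e
      unfolding gmean_swap[of p q "U e"] by (simp add: gmean_def field_simps)
    ultimately have p: "p < a" using p_less_if_bounded pos by simp
    show ?thesis
    proof (cases "p = q")
      case True
      \<comment> \<open>Every inner parameter is at least q = p and a exceeds it, so the sum would
        exceed 4 * p.\<close>
      then have False using sum exps p le by argo
      then show ?thesis ..
    next
      case False
      then have qp: "q < p" using pq by simp
      have gaps: "a - b \<le> q" "a - b \<le> p - q" using pos_exponents[OF q qp pos _ p] c pos by auto
      have "q < b" using gaps p by linarith
      from infinity_first_order[OF eq q qp this le(1) pos(4) le(2) gaps(1) p sum] show ?thesis ..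
    qed
  qed
qed

lemma conclusion: "{a, b} = {c, d} \<and> {c, d} = {p, q}"
  using neg_case zero_case pos_case by (cases q "0::real" rule: linorder_cases) auto

end

section \<open>Reduction to the normalised parameters\<close>

lemma normal_pair:
  obtains a' b' where "hyp a' b' = hyp a b" "a' = 0 \<and> b' = 0 \<or> \<bar>b'\<bar> \<le> \<bar>a'\<bar> \<and> a' + b' \<noteq> 0"
    "a + b \<noteq> 0 \<Longrightarrow> {a', b'} = {a, b}" "a + b = 0 \<Longrightarrow> a' = 0 \<and> b' = 0"
proof (cases "a + b = 0")
  case True
  then have "b = - a" by simp
  then have "hyp 0 0 = hyp a b" by (simp add: fun_eq_iff hyp_def)
  with True show ?thesis by (intro that[of 0 0]) auto
next
  case False
  show ?thesis
  proof (cases "\<bar>b\<bar> \<le> \<bar>a\<bar>")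
    case True
    with False show ?thesis by (intro that[of a b]) auto
  next
    case b: False
    have "hyp b a = hyp a b" by (simp add: fun_eq_iff hyp_commute)
    with False b show ?thesis by (intro that[of b a]) (auto simp: add.commute)
  qed
qed

lemma invariance_pos_imp_equal:
  assumes eq: "\<And>t. gmean p q (hyp a b t) (hyp c d t) = hyp p q t" and "p + q > 0" "q \<le> p"
  shows "{a, b} = {c, d} \<and> {c, d} = {p, q}"
proof -
  obtain a' b' where ab: "hyp a' b' = hyp a b" "a' = 0 \<and> b' = 0 \<or> \<bar>b'\<bar> \<le> \<bar>a'\<bar> \<and> a' + b' \<noteq> 0"
    "a + b \<noteq> 0 \<Longrightarrow> {a', b'} = {a, b}" "a + b = 0 \<Longrightarrow> a' = 0 \<and> b' = 0"
    using normal_pair[of a b] by metis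
  obtain c' d' where cd: "hyp c' d' = hyp c d" "c' = 0 \<and> d' = 0 \<or> \<bar>d'\<bar> \<le> \<bar>c'\<bar> \<and> c' + d' \<noteq> 0"
    "c + d \<noteq> 0 \<Longrightarrow> {c', d'} = {c, d}" "c + d = 0 \<Longrightarrow> c' = 0 \<and> d' = 0"
    using normal_pair[of c d] by metis
  have *: "{a', b'} = {c', d'} \<and> {c', d'} = {p, q}"
  proof (cases "\<bar>c'\<bar> \<le> \<bar>a'\<bar>")
    case True
    then interpret invariance a' b' c' d' p q
      using assms ab(2) cd(2) by unfold_locales (simp_all add: ab(1) cd(1))
    show ?thesis by (rule conclusion)
  next
    case False
    then interpret invariance c' d' a' b' p q
      using assms ab(2) cd(2) by unfold_locales (simp_all add: ab(1) cd(1) gmean_swap)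
    show ?thesis using conclusion by simp
  qed
  \<comment> \<open>This rules out that an inner mean was geometric and had been replaced by the
    parameters 0 and 0, so the normalised pairs are the original ones.\<close>
  have "{p, q} \<noteq> {0}" using assms(2,3) by auto
  then have "\<not> (a' = 0 \<and> b' = 0)" "\<not> (c' = 0 \<and> d' = 0)" using * by auto
  then show ?thesis using * ab(3,4) cd(3,4) by auto
qed

lemma invariance_imp_equal:
  assumes eq: "\<And>t. gmean p q (hyp a b t) (hyp c d t) = hyp p q t" and "p + q \<noteq> 0"
  shows "{a, b} = {c, d} \<and> {c, d} = {p, q}"
proof -
  have pos: "{a, b} = {c, d} \<and> {c, d} = {p, q}"
    if e: "\<And>t. gmean p q (hyp a b t) (hyp c d t) = hyp p q t" and "p + q > 0" for a b c d p q
  proof (cases "q \<le> p")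
    case True
    then show ?thesis using invariance_pos_imp_equal that by blast
  next
    case False
    have "hyp q p = hyp p q" by (simp add: fun_eq_iff hyp_commute)
    then have "gmean q p (hyp a b t) (hyp c d t) = hyp q p t" for t
      using e[of t] by (simp add: gmean_def)
    from invariance_pos_imp_equal[OF this] False that(2) show ?thesis by (auto simp: insert_commute)
  qed
  show ?thesis
  proof (cases "p + q > 0")
    case True
    then show ?thesis using pos eq by blast
  next
    case False
    \<comment> \<open>Taking reciprocals of all values turns the equation into the one with negated
      parameters.\<close>
    have "gmean (- p) (- q) (hyp (- a) (- b) t) (hyp (- c) (- d) t) = hyp (- p) (- q) t" for t
      using eq[of t] by (simp add: hyp_uminus gmean_uminus)
    from pos[OF this] False assms(2) have "{- a, - b} = {- c, - d}" "{- c, - d} = {- p, - q}" by auto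
    then show ?thesis by (auto simp: doubleton_eq_iff)
  qed
qed

theorem theoremS:
  fixes a b c d p q :: real
  shows "(\<forall>x y. x > 0 \<longrightarrow> y > 0 \<longrightarrow>
            stolarsky p q (stolarsky a b x y) (stolarsky c d x y) = stolarsky p q x y)
    \<longleftrightarrow> ((a + b = 0 \<and> c + d = 0 \<and> p + q = 0)
       \<or> ({a, b} = {c, d} \<and> {c, d} = {p, q})
       \<or> ({a, b} = {- c, - d} \<and> p + q = 0))"
  unfolding invariance_iff
proof
  assume eq: "\<forall>t. gmean p q (hyp a b t) (hyp c d t) = hyp p q t"
  show "(a + b = 0 \<and> c + d = 0 \<and> p + q = 0)
       \<or> ({a, b} = {c, d} \<and> {c, d} = {p, q})
       \<or> ({a, b} = {- c, - d} \<and> p + q = 0)"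
  proof (cases "p + q = 0")
    case False
    then show ?thesis using invariance_imp_equal eq by blast
  next
    case True
    then have q: "q = - p" by simp
    have sum: "a + b + (c + d) = 0" using sum_identity[of p q a b c d] eq True by simp
    show ?thesis
    proof (cases "c + d = 0")
      case True
      then show ?thesis using sum q by simp
    next
      case False
      have same: "hyp a b t = hyp (- c) (- d) t" for t
        using spec[OF eq, of t] by (simp add: q gmean_def hyp_uminus)
      \<comment> \<open>The mean of a value with itself is that value, so the coincidence is an
        invariance equation with the pair -c, -d as second inner and as outer parameters.\<close>
      have "{a, b} = {- c, - d} \<and> {- c, - d} = {- c, - d}"
        by (rule invariance_imp_equal) (use False in \<open>auto simp: same\<close>)
      then show ?thesis using True by simp
    qed
  qed
next
  have sym: "{u, v} = {x, y} \<Longrightarrow> hyp u v = hyp x y" for u v x y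
    by (auto simp: doubleton_eq_iff fun_eq_iff hyp_commute)
  assume "(a + b = 0 \<and> c + d = 0 \<and> p + q = 0)
       \<or> ({a, b} = {c, d} \<and> {c, d} = {p, q})
       \<or> ({a, b} = {- c, - d} \<and> p + q = 0)"
  then consider "a + b = 0" "c + d = 0" "p + q = 0" | "{a, b} = {c, d}" "{c, d} = {p, q}"
    | "{a, b} = {- c, - d}" "p + q = 0" by blast
  then show "\<forall>t. gmean p q (hyp a b t) (hyp c d t) = hyp p q t"
  proof cases
    case 1
    then have "b = - a" "d = - c" "q = - p" by auto
    then show ?thesis by simp
  next
    case 2
    from sym[OF 2(1)] sym[OF 2(2)] show ?thesis by simp
  next
    case 3
    then have "q = - p" by simp
    with sym[OF 3(1)] show ?thesis by (simp add: gmean_def hyp_uminus)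
  qed
qed

end
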